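(* Let $n_1=\cdots=n_k=1$ and $\Lambda_{ij}=\lambda_{ij}\in\mathbb T$ ($i\ne j$) with $\lambda_{ji}=\overline{\lambda_{ij}}$. If $T=(T_1,\ldots,T_k)$, $T_i\in B(\mathcal H)$, is a $k$-tuple in the regular $\Lambda$-polyball, then there is a Hilbert space $\widetilde{\mathcal K}\supset\mathcal H$ and a $k$-tuple $U=(U_1,\ldots,U_k)$, $U_i\in B(\widetilde{\mathcal K})$, of doubly $\Lambda$-commuting unitary operators such that the following statements hold. (i) The $k$-tuple $U=(U_1,\ldots,U_k)$ is a unitary dilation of $T=(T_1,\ldots,T_k)$, i.e. $P_{\mathcal H}U_{i_1}^{p_1}\cdots U_{i_m}^{p_m}|_{\mathcal H}=T_{i_1}^{p_1}\cdots T_{i_m}^{p_m}$ for any $i_1,\ldots,i_m\in\{1,\ldots,k\}$, any nonnegative integers $p_1,\ldots,p_m$, and $m\in\mathbb N$. (ii) For any $(m_1,\ldots,m_k)\in\mathbb Z^k$, $$P_{\mathcal H}\big(U_1^{m_1^-}\cdots U_k^{m_k^-}{U_1^*}^{m_1^+}\cdots{U_k^*}^{m_k^+}\big)|_{\mathcal H}=T_1^{m_1^-}\cdots T_k^{m_k^-}{T_1^*}^{m_1^+}\cdots{T_k^*}^{m_k^+}.$$ (iii) The dilation $U=(U_1,\ldots,U_k)$ is minimal, i.e. $\widetilde{\mathcal K}=\overline{\operatorname{span}}\{U_{i_1}^{p_1}\cdots U_{i_m}^{p_m}\mathcal H:\ p_1,\ldots,p_m\in\mathbb Z,\ i_1,\ldots,i_m\in\{1,\ldots,k\},\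 m\in\mathbb N\}$. (iv) The minimal unitary dilation $U=(U_1,\ldots,U_k)$ is unique up to an isomorphism. (v) The $k$-tuple $V=(V_1,\ldots,V_k)$, where $V_i:=U_i|_{\mathcal K}$ and $$\mathcal K=\overline{\operatorname{span}}\{U_{i_1}^{p_1}\cdots U_{i_m}^{p_m}\mathcal H:\ p_1,\ldots,p_m\in\{0,1,2,\ldots\},\ i_1,\ldots,i_m\in\{1,\ldots,k\},\ m\in\mathbb N\},$$ is a minimal doubly $\Lambda$-commuting isometric dilation of $T=(T_1,\ldots,T_k)$ satisfying the relation $T_i^*=V_i^*|_{\mathcal H}$, $i\in\{1,\ldots,k\}$.
   Context: $\mathbb T=\{z\in\mathbb C:|z|=1\}$. Given $\lambda_{ij}\in\mathbb T$ for $i\ne j$ in $\{1,\ldots,k\}$ with $\lambda_{ji}=\overline{\lambda_{ij}}$, the regular $\Lambda$-polyball (in the case $n_1=\cdots=n_k=1$) is the set of $k$-tuples $T=(T_1,\ldots,T_k)$ of contractions on a Hilbert space $\mathcal H$ with $T_iT_j=\lambda_{ij}T_jT_i$ for $i\neq j$ and $(id-\Phi_{rT_1})\circ\cdots\circ(id-\Phi_{rT_k})(I)\ge0$ for all $r\in[0,1)$, where $\Phi_{rT_i}(X)=r^2T_iXT_i^*$. A $k$-tuple of isometries (in particular unitaries) $V_i$ is doubly $\Lambda$-commuting if $V_i^*V_j=\overline{\lambda_{ij}}V_jV_i^*$ for all $i\ne j$ (this implies $V_iV_j=\lambda_{ij}V_jV_i$). Minimality of the isometric dilation $V$ on $\mathcal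 K$ means that $\mathcal K$ is the closed span of all $V_{i_1}^{p_1}\cdots V_{i_m}^{p_m}\mathcal H$ with nonnegative exponents. An isomorphism between two dilations $U$ on $\widetilde{\mathcal K}$ and $U'$ on $\widetilde{\mathcal K}'$ is a unitary $\Gamma:\widetilde{\mathcal K}\to\widetilde{\mathcal K}'$ with $\Gamma h=h$ for $h\in\mathcal H$ and $\Gamma U_i=U_i'\Gamma$ for all $i$. $m^+:=\max\{m,0\}$ and $m^-:=\max\{-m,0\}$ for $m\in\mathbb Z$. Negative powers of a unitary are powers of its adjoint. $P_{\mathcal H}$ is the orthogonal projection onto $\mathcal H$.
   Formalization: In (iv), uniqueness is among minimal doubly Λ-commuting unitary dilations that also satisfy (ii); with only (i) and (iii) it fails, e.g. T=(0,0) on ℂ, λ=1: independent bilateral shifts on L²(𝕋²) versus U₁=U₂ the bilateral shift on L²(𝕋). *)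

theory Defs
  imports "HOL-Analysis.Analysis" "HOL-Library.Function_Algebras"
begin

text \<open>
  Complex Hilbert spaces with an explicit carrier, so that Hilbert spaces can be quantified
  existentially and closed subspaces are Hilbert spaces in their own right. Addition is the one of
  the ambient type; operators are functions on that type, and only their values on the carrier
  matter. The inner product is linear in its first argument.
\<close>

record 'a hspace =
  hcarrier :: "'a set"
  hscale :: "complex \<Rightarrow> 'a \<Rightarrow> 'a"
  hinner :: "'a \<Rightarrow> 'a \<Rightarrow> complex"

definition hnorm :: "'a hspace \<Rightarrow> 'a \<Rightarrow> real" where
  "hnorm H x = sqrt (Re (hinner H x x))"

text \<open>
  The case distinction is there because the library's \<open>Metric_space\<close> wants nonnegativity and
  symmetry of the distance on the whole type.
\<close>

definition hdist :: "'a::ab_group_add hspace \<Rightarrow> 'a \<Rightarrow> 'a \<Rightarrow> real" where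
  "hdist H x y = (if x \<in> hcarrier H \<and> y \<in> hcarrier H then hnorm H (x - y) else 0)"

locale complex_hilbert_space =
  fixes H :: "'a::ab_group_add hspace"
  assumes vector_space: "vector_space (hscale H)"
    and subspace: "module.subspace (hscale H) (hcarrier H)"
    and inner_add: "\<lbrakk>x \<in> hcarrier H; y \<in> hcarrier H; z \<in> hcarrier H\<rbrakk>
      \<Longrightarrow> hinner H (x + y) z = hinner H x z + hinner H y z"
    and inner_scale: "\<lbrakk>x \<in> hcarrier H; y \<in> hcarrier H\<rbrakk>
      \<Longrightarrow> hinner H (hscale H c x) y = c * hinner H x y"
    and inner_cnj: "\<lbrakk>x \<in> hcarrier H; y \<in> hcarrier H\<rbrakk>
      \<Longrightarrow> hinner H y x = cnj (hinner H x y)"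
    and inner_nonneg: "x \<in> hcarrier H \<Longrightarrow> 0 \<le> Re (hinner H x x)"
    and inner_definite: "\<lbrakk>x \<in> hcarrier H; hinner H x x = 0\<rbrakk> \<Longrightarrow> x = 0"
    and complete: "Metric_space.mcomplete (hcarrier H) (hdist H)"

definition closed_span :: "'a::ab_group_add hspace \<Rightarrow> 'a set \<Rightarrow> 'a set" where
  "closed_span H S =
     Metric_space.mtopology (hcarrier H) (hdist H) closure_of (module.span (hscale H) S)"

definition linear_op ::
    "'a::ab_group_add hspace \<Rightarrow> 'b::ab_group_add hspace \<Rightarrow> ('a \<Rightarrow> 'b) \<Rightarrow> bool" where
  "linear_op H K A \<longleftrightarrow> A \<in> hcarrier H \<rightarrow> hcarrier K
     \<and> (\<forall>x\<in>hcarrier H. \<forall>y\<in>hcarrier H. A (x + y) = A x + A y)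
     \<and> (\<forall>c. \<forall>x\<in>hcarrier H. A (hscale H c x) = hscale K c (A x))"

definition contraction_op ::
    "'a::ab_group_add hspace \<Rightarrow> 'b::ab_group_add hspace \<Rightarrow> ('a \<Rightarrow> 'b) \<Rightarrow> bool" where
  "contraction_op H K A \<longleftrightarrow> linear_op H K A \<and> (\<forall>x\<in>hcarrier H. hnorm K (A x) \<le> hnorm H x)"

definition isometry_op ::
    "'a::ab_group_add hspace \<Rightarrow> 'b::ab_group_add hspace \<Rightarrow> ('a \<Rightarrow> 'b) \<Rightarrow> bool" where
  "isometry_op H K A \<longleftrightarrow> linear_op H K A \<and> (\<forall>x\<in>hcarrier H. hnorm K (A x) = hnorm H x)"

definition unitary_op ::
    "'a::ab_group_add hspace \<Rightarrow> 'b::ab_group_add hspace \<Rightarrow> ('a \<Rightarrow> 'b) \<Rightarrow> bool" where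
  "unitary_op H K A \<longleftrightarrow> isometry_op H K A \<and> A ` hcarrier H = hcarrier K"

definition adj :: "'a::ab_group_add hspace \<Rightarrow> ('a \<Rightarrow> 'a) \<Rightarrow> 'a \<Rightarrow> 'a" where
  "adj H A x = (THE y. y \<in> hcarrier H \<and> (\<forall>z\<in>hcarrier H. hinner H (A z) x = hinner H z y))"

definition orth_proj :: "'a::ab_group_add hspace \<Rightarrow> 'a set \<Rightarrow> 'a \<Rightarrow> 'a" where
  "orth_proj H M x = (THE y. y \<in> M \<and> (\<forall>z\<in>M. hinner H (x - y) z = 0))"

definition positive_op :: "'a::ab_group_add hspace \<Rightarrow> ('a \<Rightarrow> 'a) \<Rightarrow> bool" where
  "positive_op H X \<longleftrightarrow>
     (\<forall>x\<in>hcarrier H. Im (hinner H (X x) x) = 0 \<and> 0 \<le> Re (hinner H (X x) x))"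

definition Phi :: "'a::ab_group_add hspace \<Rightarrow> real \<Rightarrow> ('a \<Rightarrow> 'a) \<Rightarrow> ('a \<Rightarrow> 'a) \<Rightarrow> 'a \<Rightarrow> 'a" where
  "Phi H r A X = (\<lambda>x. hscale H (of_real (r\<^sup>2)) (A (X (adj H A x))))"

text \<open>\<open>(id - \<Phi>\<^bsub>rT\<^sub>1\<^esub>) \<circ> \<cdots> \<circ> (id - \<Phi>\<^bsub>rT\<^sub>k\<^esub>)\<close> applied to the identity operator.\<close>

definition defect ::
    "nat \<Rightarrow> 'a::ab_group_add hspace \<Rightarrow> (nat \<Rightarrow> 'a \<Rightarrow> 'a) \<Rightarrow> real \<Rightarrow> 'a \<Rightarrow> 'a" where
  "defect k H T r = foldr (\<lambda>i X x. X x - Phi H r (T i) X x) [1..<Suc k] (\<lambda>x. x)"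

definition regular_polyball ::
    "nat \<Rightarrow> (nat \<Rightarrow> nat \<Rightarrow> complex) \<Rightarrow> 'a::ab_group_add hspace \<Rightarrow> (nat \<Rightarrow> 'a \<Rightarrow> 'a) set" where
  "regular_polyball k lam H = {T.
     (\<forall>i\<in>{1..k}. contraction_op H H (T i))
   \<and> (\<forall>i\<in>{1..k}. \<forall>j\<in>{1..k}. i \<noteq> j \<longrightarrow>
        (\<forall>x\<in>hcarrier H. T i (T j x) = hscale H (lam i j) (T j (T i x))))
   \<and> (\<forall>r. 0 \<le> r \<and> r < 1 \<longrightarrow> positive_op H (defect k H T r))}"

definition doubly_commuting ::
    "nat \<Rightarrow> (nat \<Rightarrow> nat \<Rightarrow> complex) \<Rightarrow> 'a::ab_group_add hspace \<Rightarrow> (nat \<Rightarrow> 'a \<Rightarrow> 'a) \<Rightarrow> bool" where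
  "doubly_commuting k lam K V \<longleftrightarrow>
     (\<forall>i\<in>{1..k}. \<forall>j\<in>{1..k}. i \<noteq> j \<longrightarrow>
        (\<forall>x\<in>hcarrier K. adj K (V i) (V j x) = hscale K (cnj (lam i j)) (V j (adj K (V i) x))))"

text \<open>
  A product \<open>A\<^bsub>i\<^sub>1\<^esub>\<^bsup>p\<^sub>1\<^esup> \<cdots> A\<^bsub>i\<^sub>m\<^esub>\<^bsup>p\<^sub>m\<^esup>\<close> is encoded by the list of the pairs \<open>(i\<^sub>j, p\<^sub>j)\<close>.
\<close>

definition word_op :: "(nat \<Rightarrow> 'a \<Rightarrow> 'a) \<Rightarrow> (nat \<times> nat) list \<Rightarrow> 'a \<Rightarrow> 'a" where
  "word_op A w = foldr (\<lambda>(i, p) F. (A i ^^ p) \<circ> F) w id"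

definition zpower :: "'a::ab_group_add hspace \<Rightarrow> ('a \<Rightarrow> 'a) \<Rightarrow> int \<Rightarrow> 'a \<Rightarrow> 'a" where
  "zpower K A p = (if 0 \<le> p then A ^^ nat p else adj K A ^^ nat (- p))"

definition zword_op ::
    "'a::ab_group_add hspace \<Rightarrow> (nat \<Rightarrow> 'a \<Rightarrow> 'a) \<Rightarrow> (nat \<times> int) list \<Rightarrow> 'a \<Rightarrow> 'a" where
  "zword_op K A w = foldr (\<lambda>(i, p) F. zpower K (A i) p \<circ> F) w id"

text \<open>\<open>A\<^sub>1\<^bsup>a 1\<^esup> \<cdots> A\<^sub>k\<^bsup>a k\<^esup>\<close>\<close>

definition ordered_monomial :: "nat \<Rightarrow> (nat \<Rightarrow> 'a \<Rightarrow> 'a) \<Rightarrow> (nat \<Rightarrow> nat) \<Rightarrow> 'a \<Rightarrow> 'a" where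
  "ordered_monomial k A a = foldr (\<lambda>i F. (A i ^^ a i) \<circ> F) [1..<Suc k] id"

text \<open>\<open>A\<^sub>1\<^bsup>m\<^sub>1\<^sup>-\<^esup> \<cdots> A\<^sub>k\<^bsup>m\<^sub>k\<^sup>-\<^esup> A\<^sub>1\<^sup>*\<^bsup>m\<^sub>1\<^sup>+\<^esup> \<cdots> A\<^sub>k\<^sup>*\<^bsup>m\<^sub>k\<^sup>+\<^esup>\<close>\<close>

definition mixed_monomial ::
    "nat \<Rightarrow> 'a::ab_group_add hspace \<Rightarrow> (nat \<Rightarrow> 'a \<Rightarrow> 'a) \<Rightarrow> (nat \<Rightarrow> int) \<Rightarrow> 'a \<Rightarrow> 'a" where
  "mixed_monomial k K A m =
     ordered_monomial k A (\<lambda>i. nat (max (- m i) 0))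
     \<circ> ordered_monomial k (\<lambda>i. adj K (A i)) (\<lambda>i. nat (max (m i) 0))"

text \<open>
  The inclusion of \<open>H\<close> in \<open>K\<close> is a linear isometry \<open>J\<close>, so \<open>P\<^sub>H A|\<^sub>H = B\<close> reads
  \<open>orth_proj K (J ` hcarrier H) (A (J h)) = J (B h)\<close>.
\<close>

definition dilates ::
    "nat \<Rightarrow> 'a::ab_group_add hspace \<Rightarrow> (nat \<Rightarrow> 'a \<Rightarrow> 'a)
     \<Rightarrow> 'b::ab_group_add hspace \<Rightarrow> ('a \<Rightarrow> 'b) \<Rightarrow> (nat \<Rightarrow> 'b \<Rightarrow> 'b) \<Rightarrow> bool" where
  "dilates k H T K J A \<longleftrightarrow>
     (\<forall>w\<in>lists ({1..k} \<times> UNIV). \<forall>h\<in>hcarrier H.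
        orth_proj K (J ` hcarrier H) (word_op A w (J h)) = J (word_op T w h))"

definition regular_dilates ::
    "nat \<Rightarrow> 'a::ab_group_add hspace \<Rightarrow> (nat \<Rightarrow> 'a \<Rightarrow> 'a)
     \<Rightarrow> 'b::ab_group_add hspace \<Rightarrow> ('a \<Rightarrow> 'b) \<Rightarrow> (nat \<Rightarrow> 'b \<Rightarrow> 'b) \<Rightarrow> bool" where
  "regular_dilates k H T K J A \<longleftrightarrow>
     (\<forall>m :: nat \<Rightarrow> int. \<forall>h\<in>hcarrier H.
        orth_proj K (J ` hcarrier H) (mixed_monomial k K A m (J h))
          = J (mixed_monomial k H T m h))"

definition unitary_minimal ::
    "nat \<Rightarrow> 'a::ab_group_add hspace
     \<Rightarrow> 'b::ab_group_add hspace \<Rightarrow> ('a \<Rightarrow> 'b) \<Rightarrow> (nat \<Rightarrow> 'b \<Rightarrow> 'b) \<Rightarrow> bool" where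
  "unitary_minimal k H K J U \<longleftrightarrow>
     hcarrier K = closed_span K
       {zword_op K U w (J h) | w h. w \<in> lists ({1..k} \<times> UNIV) \<and> h \<in> hcarrier H}"

definition analytic_part ::
    "nat \<Rightarrow> 'a::ab_group_add hspace
     \<Rightarrow> 'b::ab_group_add hspace \<Rightarrow> ('a \<Rightarrow> 'b) \<Rightarrow> (nat \<Rightarrow> 'b \<Rightarrow> 'b) \<Rightarrow> 'b set" where
  "analytic_part k H K J A = closed_span K
     {word_op A w (J h) | w h. w \<in> lists ({1..k} \<times> UNIV) \<and> h \<in> hcarrier H}"

definition isometric_minimal ::
    "nat \<Rightarrow> 'a::ab_group_add hspace
     \<Rightarrow> 'b::ab_group_add hspace \<Rightarrow> ('a \<Rightarrow> 'b) \<Rightarrow> (nat \<Rightarrow> 'b \<Rightarrow> 'b) \<Rightarrow> bool" where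
  "isometric_minimal k H K J V \<longleftrightarrow> hcarrier K = analytic_part k H K J V"

definition commuting_isometries_over ::
    "nat \<Rightarrow> (nat \<Rightarrow> nat \<Rightarrow> complex) \<Rightarrow> 'a::ab_group_add hspace
     \<Rightarrow> 'b::ab_group_add hspace \<Rightarrow> ('a \<Rightarrow> 'b) \<Rightarrow> (nat \<Rightarrow> 'b \<Rightarrow> 'b) \<Rightarrow> bool" where
  "commuting_isometries_over k lam H K J V \<longleftrightarrow>
     complex_hilbert_space K \<and> isometry_op H K J
   \<and> (\<forall>i\<in>{1..k}. isometry_op K K (V i)) \<and> doubly_commuting k lam K V"

text \<open>
  A minimal unitary dilation space can be realised on the type \<open>(nat \<Rightarrow> int) \<Rightarrow> 'a\<close> with pointwise
  operations: by minimality \<open>x\<close> is determined by the family \<open>m \<mapsto> P\<^sub>H (U\<^sub>1\<^bsup>m 1\<^esup> \<cdots> U\<^sub>k\<^bsup>m k\<^esup>)\<^sup>* x\<close>.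
\<close>

definition commuting_unitaries_over ::
    "nat \<Rightarrow> (nat \<Rightarrow> nat \<Rightarrow> complex) \<Rightarrow> 'a::ab_group_add hspace
     \<Rightarrow> 'b::ab_group_add hspace \<Rightarrow> ('a \<Rightarrow> 'b) \<Rightarrow> (nat \<Rightarrow> 'b \<Rightarrow> 'b) \<Rightarrow> bool" where
  "commuting_unitaries_over k lam H K J U \<longleftrightarrow>
     complex_hilbert_space K \<and> isometry_op H K J
   \<and> (\<forall>i\<in>{1..k}. unitary_op K K (U i)) \<and> doubly_commuting k lam K U"

definition dilation_iso ::
    "nat \<Rightarrow> 'a::ab_group_add hspace
     \<Rightarrow> 'b::ab_group_add hspace \<Rightarrow> ('a \<Rightarrow> 'b) \<Rightarrow> (nat \<Rightarrow> 'b \<Rightarrow> 'b)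
     \<Rightarrow> 'c::ab_group_add hspace \<Rightarrow> ('a \<Rightarrow> 'c) \<Rightarrow> (nat \<Rightarrow> 'c \<Rightarrow> 'c) \<Rightarrow> ('b \<Rightarrow> 'c) \<Rightarrow> bool" where
  "dilation_iso k H K J U K' J' U' \<Gamma> \<longleftrightarrow>
     unitary_op K K' \<Gamma>
   \<and> (\<forall>h\<in>hcarrier H. \<Gamma> (J h) = J' h)
   \<and> (\<forall>i\<in>{1..k}. \<forall>x\<in>hcarrier K. \<Gamma> (U i x) = U' i (\<Gamma> x))"

end

theory Submission
  imports Defs
begin

text \<open>
  Write \<open>c(m,n) = \<Prod>\<^bsub>j < i\<^esub> \<lambda>\<^bsub>ij\<^esub>\<^bsup>m i * n j\<^esup>\<close>, \<open>S\<^sub>i = T\<^sub>i\<^sup>*\<close> and \<open>S\<^bsup>a\<^esup>\<close> for the ordered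
  monomials, so that \<open>S\<^bsup>a\<^esup>S\<^bsup>b\<^esup> = c(a,b) S\<^bsup>a+b\<^esup>\<close>. If \<open>U\<close> is a regular dilation, the vectors
  \<open>E m h = U\<^sub>1\<^bsup>m 1\<^esup> \<cdots> U\<^sub>k\<^bsup>m k\<^esup> h\<close> satisfy \<open>U\<^sub>i E m = c(e\<^sub>i,m) E (m + e\<^sub>i)\<close>, and their Gram matrix
  is forced; in a minimal dilation they are total, whence uniqueness.

  For existence one shows that the forced Gram matrix is positive semidefinite. It equals
  \<open>\<langle>D\<^sub>s(m)h, D\<^sub>s(n)g\<rangle>\<close> with \<open>s = max m n\<close>, where \<open>D\<^sub>p(m)\<close> is the conjugate of \<open>c(p,m)\<close> times
  \<open>S\<^bsup>p-m\<^esup>\<close> if \<open>m \<le> p\<close>, and zero otherwise. For \<open>rT\<close> in place of \<open>T\<close> it is the limit over growing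
  boxes of \<open>\<Sum>\<^sub>p \<langle>\<Delta>\<^sub>r D\<^sub>p(m)h, D\<^sub>p(n)g\<rangle>\<close>, where \<open>\<Delta>\<^sub>r \<ge> 0\<close> is the defect operator, because
  \<open>\<Sum>\<^sub>a (rT)\<^bsup>a\<^esup> \<Delta>\<^sub>r (rT)\<^sup>*\<^bsup>a\<^esup>\<close> telescopes to the identity; then \<open>r\<close> tends to 1. The Hilbert space
  of this kernel carries the unitaries \<open>E m h \<mapsto> c(e\<^sub>i,m) E (m + e\<^sub>i) h\<close>.

  On the closed span of the \<open>E m h\<close> with \<open>m \<ge> 0\<close> the adjoints are explicit: \<open>V\<^sub>i\<^sup>* E m h\<close> is a multiple
  of \<open>E (m - e\<^sub>i) h\<close> if \<open>m i > 0\<close> and of \<open>E m (S\<^sub>i h)\<close> if \<open>m i = 0\<close>.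
\<close>

section \<open>Semi-inner product spaces\<close>

text \<open>Words of nonnegative powers, as in (i), reveal a Gram entry only when the difference of
  its two indices has one sign; (ii) supplies the entries of mixed sign, and these tie any two
  minimal dilations together. For existence the obstacle is positivity. At r = 1 the telescoping sum
  may lose everything: for unitary \<open>T\<close> the defect vanishes, although the sum should
  give the identity. A factor r < 1 makes the boundary terms of the boxes decay geometrically, and
  it changes each kernel entry only by a power of r, so finite sums pass to the limit. The phases
  are the second difficulty: reordering monomials costs a factor depending on both, and the
  conjugate of \<open>c p m\<close> in \<open>D\<close> is chosen so that these factors cancel in
  every inner product. Finally, a completion usually consists of equivalence classes, whereas here
  the type of the dilation space is prescribed; so the quotient is realised as the image of a linear
  map into families of vectors of \<open>H\<close> that kills exactly the null vectors.\<close>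

lemma tendsto_0_le_seq:
  fixes f :: "nat \<Rightarrow> 'a::real_normed_vector"
  assumes "\<And>n. norm (f n) \<le> g n" "g \<longlonglongrightarrow> 0"
  shows "f \<longlonglongrightarrow> 0"
  by (rule Lim_null_comparison[OF always_eventually]) (use assms in auto)

text \<open>Definiteness is left out because finitely supported families under the kernel, and
  Cauchy sequences of such families, may contain nonzero null vectors. The norm calculus below thus
  serves these spaces as well as Hilbert spaces.\<close>

locale semi_inner_space =
  fixes H :: "'a::ab_group_add hspace"
  assumes vector_space: "vector_space (hscale H)"
    and subspace: "module.subspace (hscale H) (hcarrier H)"
    and inner_add: "\<lbrakk>x \<in> hcarrier H; y \<in> hcarrier H; z \<in> hcarrier H\<rbrakk>
      \<Longrightarrow> hinner H (x + y) z = hinner H x z + hinner H y z"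
    and inner_scale: "\<lbrakk>x \<in> hcarrier H; y \<in> hcarrier H\<rbrakk>
      \<Longrightarrow> hinner H (hscale H c x) y = c * hinner H x y"
    and inner_cnj: "\<lbrakk>x \<in> hcarrier H; y \<in> hcarrier H\<rbrakk>
      \<Longrightarrow> hinner H y x = cnj (hinner H x y)"
    and inner_nonneg: "x \<in> hcarrier H \<Longrightarrow> 0 \<le> Re (hinner H x x)"
begin

sublocale vs: vector_space "hscale H"
  by (rule vector_space)

lemma carrier_0 [simp]: "0 \<in> hcarrier H"
  by (rule vs.subspace_0[OF subspace])

lemma carrier_add [simp]: "x \<in> hcarrier H \<Longrightarrow> y \<in> hcarrier H \<Longrightarrow> x + y \<in> hcarrier H"
  by (rule vs.subspace_add[OF subspace])

lemma carrier_scale [simp]: "x \<in> hcarrier H \<Longrightarrow> hscale H c x \<in> hcarrier H"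
  by (rule vs.subspace_scale[OF subspace])

lemma carrier_diff [simp]: "x \<in> hcarrier H \<Longrightarrow> y \<in> hcarrier H \<Longrightarrow> x - y \<in> hcarrier H"
  by (rule vs.subspace_diff[OF subspace])

lemma carrier_sum: "(\<And>i. i \<in> I \<Longrightarrow> f i \<in> hcarrier H) \<Longrightarrow> sum f I \<in> hcarrier H"
  by (rule vs.subspace_sum[OF subspace])

lemma inner_add_right:
  "\<lbrakk>x \<in> hcarrier H; y \<in> hcarrier H; z \<in> hcarrier H\<rbrakk>
    \<Longrightarrow> hinner H z (x + y) = hinner H z x + hinner H z y"
  using inner_cnj[of "x + y" z] inner_cnj[of x z] inner_cnj[of y z] by (simp add: inner_add)

lemma inner_scale_right:
  "\<lbrakk>x \<in> hcarrier H; y \<in> hcarrier H\<rbrakk> \<Longrightarrow> hinner H y (hscale H c x) = cnj c * hinner H y x"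
  using inner_cnj[of "hscale H c x" y] inner_cnj[of x y] by (simp add: inner_scale)

lemma inner_0_left [simp]: "x \<in> hcarrier H \<Longrightarrow> hinner H 0 x = 0"
  using inner_add[of 0 0 x] by simp

lemma inner_0_right [simp]: "x \<in> hcarrier H \<Longrightarrow> hinner H x 0 = 0"
  using inner_add_right[of 0 0 x] by simp

lemma inner_diff:
  "\<lbrakk>x \<in> hcarrier H; y \<in> hcarrier H; z \<in> hcarrier H\<rbrakk>
    \<Longrightarrow> hinner H (x - y) z = hinner H x z - hinner H y z"
  using inner_add[of "x - y" y z] by simp

lemma inner_diff_right:
  "\<lbrakk>x \<in> hcarrier H; y \<in> hcarrier H; z \<in> hcarrier H\<rbrakk>
    \<Longrightarrow> hinner H z (x - y) = hinner H z x - hinner H z y"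
  using inner_add_right[of "x - y" y z] by simp

lemma inner_sum:
  assumes "\<And>i. i \<in> I \<Longrightarrow> f i \<in> hcarrier H" "z \<in> hcarrier H"
  shows "hinner H (sum f I) z = (\<Sum>i\<in>I. hinner H (f i) z)"
  using assms
  by (induction I rule: infinite_finite_induct) (simp_all add: inner_add carrier_sum)

lemma inner_sum_right:
  assumes "\<And>i. i \<in> I \<Longrightarrow> f i \<in> hcarrier H" "z \<in> hcarrier H"
  shows "hinner H z (sum f I) = (\<Sum>i\<in>I. hinner H z (f i))"
  using assms
  by (induction I rule: infinite_finite_induct) (simp_all add: inner_add_right carrier_sum)

lemma inner_self: "x \<in> hcarrier H \<Longrightarrow> hinner H x x = of_real ((hnorm H x)\<^sup>2)"
  using arg_cong[OF inner_cnj[of x x], of Im] inner_nonneg[of x]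
  by (simp add: hnorm_def complex_eq_iff)

lemma norm_sq: "x \<in> hcarrier H \<Longrightarrow> (hnorm H x)\<^sup>2 = Re (hinner H x x)"
  using inner_nonneg[of x] by (simp add: hnorm_def)

lemma norm_nonneg [simp]: "x \<in> hcarrier H \<Longrightarrow> 0 \<le> hnorm H x"
  using inner_nonneg[of x] by (simp add: hnorm_def)

lemma norm_0 [simp]: "hnorm H 0 = 0"
  by (simp add: hnorm_def)

lemma norm_scale: "x \<in> hcarrier H \<Longrightarrow> hnorm H (hscale H c x) = cmod c * hnorm H x"
proof -
  assume x: "x \<in> hcarrier H"
  have "hinner H (hscale H c x) (hscale H c x) = (c * cnj c) * hinner H x x"
    using x by (simp add: inner_scale inner_scale_right)
  also have "\<dots> = of_real ((cmod c)\<^sup>2 * (hnorm H x)\<^sup>2)"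
    by (simp add: complex_norm_square[symmetric] inner_self x)
  finally have "Re (hinner H (hscale H c x) (hscale H c x)) = (cmod c * hnorm H x)\<^sup>2"
    by (simp add: power_mult_distrib)
  then show ?thesis
    using x by (simp add: hnorm_def[of H "hscale H c x"])
qed

lemma norm_sq_add:
  assumes "x \<in> hcarrier H" "y \<in> hcarrier H"
  shows "(hnorm H (x + y))\<^sup>2 = (hnorm H x)\<^sup>2 + 2 * Re (hinner H x y) + (hnorm H y)\<^sup>2"
  using assms inner_cnj[of x y] by (simp add: norm_sq inner_add inner_add_right)

lemma norm_sq_diff:
  assumes "x \<in> hcarrier H" "y \<in> hcarrier H"
  shows "(hnorm H (x - y))\<^sup>2 = (hnorm H x)\<^sup>2 - 2 * Re (hinner H x y) + (hnorm H y)\<^sup>2"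
  using assms inner_cnj[of x y] by (simp add: norm_sq inner_diff inner_diff_right)

lemma norm_uminus: "x \<in> hcarrier H \<Longrightarrow> hnorm H (- x) = hnorm H x"
  using norm_scale[of x "-1"] by simp

lemma norm_minus_commute: "x \<in> hcarrier H \<Longrightarrow> y \<in> hcarrier H \<Longrightarrow> hnorm H (x - y) = hnorm H (y - x)"
  using norm_uminus[of "x - y"] by simp

text \<open>Expand the squared norm of x - t z y, where z is the inner product of x and y. The norm
  of y may vanish even if y does not; the resulting bound is then affine in t and forces z =
  0.\<close>

lemma Cauchy_Schwarz:
  assumes x: "x \<in> hcarrier H" and y: "y \<in> hcarrier H"
  shows "cmod (hinner H x y) \<le> hnorm H x * hnorm H y"
proof -
  define z where "z = hinner H x y"
  define a where "a = hnorm H x"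
  define b where "b = hnorm H y"
  have ab: "0 \<le> a" "0 \<le> b" using x y by (simp_all add: a_def b_def)
  \<comment> \<open>The factor z makes the cross term real, so a single real parameter t
    suffices.\<close>
  have ineq: "0 \<le> a\<^sup>2 - 2 * t * (cmod z)\<^sup>2 + t\<^sup>2 * (cmod z)\<^sup>2 * b\<^sup>2" for t :: real
  proof -
    have "0 \<le> (hnorm H (x - hscale H (of_real t * z) y))\<^sup>2" by simp
    also have "\<dots> = a\<^sup>2 - 2 * Re (cnj (of_real t * z) * z) + (\<bar>t\<bar> * cmod z * b)\<^sup>2"
      using x y by (simp add: norm_sq_diff norm_scale inner_scale_right a_def b_def z_def norm_mult)
    also have "Re (cnj (of_real t * z) * z) = t * (cmod z)\<^sup>2"
      unfolding cmod_power2 by (simp add: power2_eq_square algebra_simps)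
    finally show ?thesis by (simp add: power_mult_distrib)
  qed
  have "(cmod z)\<^sup>2 \<le> (a * b)\<^sup>2"
  proof (cases "b = 0")
    case True
    have "cmod z = 0"
    proof (rule ccontr)
      assume "cmod z \<noteq> 0"
      \<comment> \<open>With b = 0 this value of t turns the right-hand side of \<open>ineq\<close>
        into -1.\<close>
      then show False
        using ineq[of "(a\<^sup>2 + 1) / (2 * (cmod z)\<^sup>2)"] True by simp
    qed
    then show ?thesis by simp
  next
    case False
    \<comment> \<open>The bound is smallest at t = 1 / b^2.\<close>
    have "0 \<le> a\<^sup>2 - 2 * (1 / b\<^sup>2) * (cmod z)\<^sup>2 + (1 / b\<^sup>2)\<^sup>2 * (cmod z)\<^sup>2 * b\<^sup>2" by (rule ineq)
    also have "\<dots> = a\<^sup>2 - (cmod z)\<^sup>2 / b\<^sup>2"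
      using False by (simp add: power2_eq_square)
    finally have "(cmod z)\<^sup>2 / b\<^sup>2 \<le> a\<^sup>2" by simp
    then show ?thesis using False by (simp add: power_mult_distrib pos_divide_le_eq)
  qed
  then show ?thesis
    using ab power2_le_imp_le[of "cmod z" "a * b"] by (simp add: z_def a_def b_def)
qed

lemma norm_triangle:
  assumes x: "x \<in> hcarrier H" and y: "y \<in> hcarrier H"
  shows "hnorm H (x + y) \<le> hnorm H x + hnorm H y"
proof (rule power2_le_imp_le)
  have "Re (hinner H x y) \<le> hnorm H x * hnorm H y"
    using Cauchy_Schwarz[OF x y] complex_Re_le_cmod order_trans by blast
  then show "(hnorm H (x + y))\<^sup>2 \<le> (hnorm H x + hnorm H y)\<^sup>2"
    using x y by (simp add: norm_sq_add power2_sum mult.assoc)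
qed (use x y in simp)

lemma norm_triangle_diff:
  assumes "x \<in> hcarrier H" "y \<in> hcarrier H" "z \<in> hcarrier H"
  shows "hnorm H (x - z) \<le> hnorm H (x - y) + hnorm H (y - z)"
  using norm_triangle[of "x - y" "y - z"] assms by simp

lemma norm_diff_ge:
  assumes "x \<in> hcarrier H" "y \<in> hcarrier H"
  shows "\<bar>hnorm H x - hnorm H y\<bar> \<le> hnorm H (x - y)"
  using norm_triangle[of "x - y" y] norm_triangle[of "y - x" x] norm_minus_commute[of x y] assms
  by simp

lemma inner_diff_bound:
  assumes "x \<in> hcarrier H" "x' \<in> hcarrier H" "y \<in> hcarrier H" "y' \<in> hcarrier H"
  shows "cmod (hinner H x y - hinner H x' y')
    \<le> hnorm H (x - x') * hnorm H y + hnorm H x' * hnorm H (y - y')"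
proof -
  have "hinner H x y - hinner H x' y' = hinner H (x - x') y + hinner H x' (y - y')"
    using assms by (simp add: inner_diff inner_diff_right)
  then show ?thesis
    using norm_triangle_ineq[of "hinner H (x - x') y" "hinner H x' (y - y')"]
      Cauchy_Schwarz[of "x - x'" y] Cauchy_Schwarz[of x' "y - y'"] assms by simp
qed

lemma tendsto_norm_seq:
  assumes "\<And>n. x n \<in> hcarrier H" "a \<in> hcarrier H" "(\<lambda>n. hnorm H (x n - a)) \<longlonglongrightarrow> 0"
  shows "(\<lambda>n. hnorm H (x n)) \<longlonglongrightarrow> hnorm H a"
proof (rule LIM_zero_cancel, rule tendsto_0_le_seq)
  show "norm (hnorm H (x n) - hnorm H a) \<le> hnorm H (x n - a)" for n
    using norm_diff_ge[OF assms(1)[of n] assms(2)] by simp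
qed (rule assms(3))

lemma tendsto_inner_seq:
  assumes "\<And>n. x n \<in> hcarrier H" "a \<in> hcarrier H" "(\<lambda>n. hnorm H (x n - a)) \<longlonglongrightarrow> 0"
    and "\<And>n. y n \<in> hcarrier H" "b \<in> hcarrier H" "(\<lambda>n. hnorm H (y n - b)) \<longlonglongrightarrow> 0"
  shows "(\<lambda>n. hinner H (x n) (y n)) \<longlonglongrightarrow> hinner H a b"
proof (rule LIM_zero_cancel, rule tendsto_0_le_seq)
  show "cmod (hinner H (x n) (y n) - hinner H a b)
    \<le> hnorm H (x n - a) * hnorm H (y n) + hnorm H a * hnorm H (y n - b)" for n
    by (rule inner_diff_bound) (use assms in auto)
  have "(\<lambda>n. hnorm H (y n)) \<longlonglongrightarrow> hnorm H b"
    by (rule tendsto_norm_seq) (use assms in auto)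
  from tendsto_add[OF tendsto_mult[OF assms(3) this] tendsto_mult[OF tendsto_const assms(6)]]
  show "(\<lambda>n. hnorm H (x n - a) * hnorm H (y n) + hnorm H a * hnorm H (y n - b)) \<longlonglongrightarrow> 0"
    by simp
qed

definition Cauchy_seq :: "(nat \<Rightarrow> 'a) \<Rightarrow> bool" where
  "Cauchy_seq x \<longleftrightarrow> (\<forall>n. x n \<in> hcarrier H)
    \<and> (\<forall>e>0. \<exists>N. \<forall>m\<ge>N. \<forall>n\<ge>N. hnorm H (x m - x n) < e)"

end

sublocale complex_hilbert_space \<subseteq> semi_inner_space
  by (rule semi_inner_space.intro[OF vector_space subspace inner_add inner_scale inner_cnj inner_nonneg])

section \<open>Hilbert spaces on a carrier\<close>

locale pre_hilbert_space = semi_inner_space H for H :: "'a::ab_group_add hspace" +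
  assumes inner_definite: "\<lbrakk>x \<in> hcarrier H; hinner H x x = 0\<rbrakk> \<Longrightarrow> x = 0"
begin

lemma norm_eq_0: "x \<in> hcarrier H \<Longrightarrow> hnorm H x = 0 \<longleftrightarrow> x = 0"
  using inner_self inner_definite by auto

lemma eq_iff_norm_diff: "x \<in> hcarrier H \<Longrightarrow> y \<in> hcarrier H \<Longrightarrow> x = y \<longleftrightarrow> hnorm H (x - y) = 0"
  by (simp add: norm_eq_0)

sublocale metric: Metric_space "hcarrier H" "hdist H"
proof
  fix x y z
  show "0 \<le> hdist H x y" by (simp add: hdist_def)
  show "hdist H x y = hdist H y x" by (simp add: hdist_def norm_minus_commute)
  assume "x \<in> hcarrier H" "y \<in> hcarrier H"
  then show "hdist H x y = 0 \<longleftrightarrow> x = y"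
    by (simp add: hdist_def norm_eq_0)
  assume "z \<in> hcarrier H"
  then show "hdist H x z \<le> hdist H x y + hdist H y z"
    using \<open>x \<in> hcarrier H\<close> \<open>y \<in> hcarrier H\<close> by (simp add: hdist_def norm_triangle_diff)
qed

text \<open>Carrier membership is part of \<open>Cauchy_seq\<close>, so along such sequences the
  case distinction in \<open>hdist\<close> never takes its default branch.\<close>

lemma mcomplete_iff:
  "Metric_space.mcomplete (hcarrier H) (hdist H) \<longleftrightarrow>
    (\<forall>x. Cauchy_seq x \<longrightarrow> (\<exists>a\<in>hcarrier H. (\<lambda>n. hnorm H (x n - a)) \<longlonglongrightarrow> 0))"
proof -
  have 1: "metric.MCauchy x \<longleftrightarrow> Cauchy_seq x" for x
    unfolding metric.MCauchy_def Cauchy_seq_def hdist_def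
    by (simp add: image_subset_iff) (metis (full_types))
  have 2: "limitin metric.mtopology x a sequentially \<longleftrightarrow>
      a \<in> hcarrier H \<and> (\<lambda>n. hnorm H (x n - a)) \<longlonglongrightarrow> 0" if "\<And>n. x n \<in> hcarrier H" for x a
    using that unfolding metric.limit_metric_sequentially LIMSEQ_def hdist_def dist_real_def
    by auto
  show ?thesis
    unfolding metric.mcomplete_def 1 by (metis 2 Cauchy_seq_def)
qed

lemma span_carrier: "S \<subseteq> hcarrier H \<Longrightarrow> vs.span S \<subseteq> hcarrier H"
  by (rule vs.span_minimal[OF _ subspace])

lemma closed_span_iff:
  assumes "S \<subseteq> hcarrier H"
  shows "x \<in> closed_span H S \<longleftrightarrow>
    x \<in> hcarrier H \<and> (\<forall>e>0. \<exists>y\<in>vs.span S. hnorm H (x - y) < e)"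
  using span_carrier[OF assms]
  unfolding closed_span_def metric.metric_closure_of metric.mball_def hdist_def
  by (auto simp: subset_iff)

lemma closed_span_carrier: "S \<subseteq> hcarrier H \<Longrightarrow> closed_span H S \<subseteq> hcarrier H"
  by (simp add: closed_span_iff subset_iff)

lemma span_closed_span: "S \<subseteq> hcarrier H \<Longrightarrow> x \<in> vs.span S \<Longrightarrow> x \<in> closed_span H S"
  using span_carrier[of S] by (auto simp: closed_span_iff intro!: bexI[of _ x])

lemma closed_span_base: "S \<subseteq> hcarrier H \<Longrightarrow> x \<in> S \<Longrightarrow> x \<in> closed_span H S"
  by (simp add: span_closed_span vs.span_base)

lemma closed_span_seq:
  assumes "S \<subseteq> hcarrier H" "x \<in> closed_span H S"
  obtains y where "\<And>n. y n \<in> vs.span S" "(\<lambda>n. hnorm H (y n - x)) \<longlonglongrightarrow> 0"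
proof -
  have x: "x \<in> hcarrier H" and "\<exists>y\<in>vs.span S. hnorm H (x - y) < 1 / real (Suc n)" for n
    using assms by (simp_all add: closed_span_iff)
  then obtain y where y: "y n \<in> vs.span S" "hnorm H (x - y n) < 1 / real (Suc n)" for n
    by metis
  have yc: "y n \<in> hcarrier H" for n using y span_carrier[OF assms(1)] by auto
  have "(\<lambda>n. hnorm H (y n - x)) \<longlonglongrightarrow> 0"
  proof (rule tendsto_0_le_seq[OF _ LIMSEQ_Suc[OF lim_1_over_n]])
    show "norm (hnorm H (y n - x)) \<le> 1 / real (Suc n)" for n
      using y(2)[of n] x yc[of n] norm_minus_commute[of "y n" x] by simp
  qed
  with y that show ?thesis by blast
qed

lemma closed_spanI_seq:
  assumes S: "S \<subseteq> hcarrier H" and x: "x \<in> hcarrier H"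
    and y: "\<And>n. y n \<in> closed_span H S" "(\<lambda>n. hnorm H (y n - x)) \<longlonglongrightarrow> 0"
  shows "x \<in> closed_span H S"
  unfolding closed_span_iff[OF S]
proof (intro conjI allI impI)
  fix e :: real assume e: "e > 0"
  then obtain n where n: "hnorm H (y n - x) < e / 2"
    using y(2) unfolding LIMSEQ_def dist_real_def
    by (metis abs_less_iff diff_zero half_gt_zero order_refl)
  obtain z where z: "z \<in> vs.span S" "hnorm H (y n - z) < e / 2"
    using y(1)[of n] e unfolding closed_span_iff[OF S] by (meson half_gt_zero)
  have c: "y n \<in> hcarrier H" "z \<in> hcarrier H"
    using y(1)[of n] z span_carrier[OF S] by (auto simp: closed_span_iff[OF S])
  have "hnorm H (x - z) < e"
    using norm_triangle_diff[OF x c] n z norm_minus_commute[OF x c(1)] by simp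
  with z show "\<exists>z\<in>vs.span S. hnorm H (x - z) < e" by blast
qed (rule x)

lemma subspace_closed_span:
  assumes S: "S \<subseteq> hcarrier H"
  shows "vs.subspace (closed_span H S)"
proof (rule vs.subspaceI)
  note SC = span_carrier[OF S]
  show "0 \<in> closed_span H S" by (rule span_closed_span[OF S vs.span_zero])
next
  fix x y assume xy: "x \<in> closed_span H S" "y \<in> closed_span H S"
  note c = closed_span_carrier[OF S, THEN subsetD]
  note SC = span_carrier[OF S, THEN subsetD]
  obtain u where u: "\<And>n. u n \<in> vs.span S" "(\<lambda>n. hnorm H (u n - x)) \<longlonglongrightarrow> 0"
    using closed_span_seq[OF S xy(1)] by blast
  obtain v where v: "\<And>n. v n \<in> vs.span S" "(\<lambda>n. hnorm H (v n - y)) \<longlonglongrightarrow> 0"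
    using closed_span_seq[OF S xy(2)] by blast
  show "x + y \<in> closed_span H S"
  proof (rule closed_spanI_seq[OF S])
    show "x + y \<in> hcarrier H" using xy c by simp
    show "u n + v n \<in> closed_span H S" for n
      by (intro span_closed_span[OF S] vs.span_add u v)
    show "(\<lambda>n. hnorm H (u n + v n - (x + y))) \<longlonglongrightarrow> 0"
    proof (rule tendsto_0_le_seq[OF _ tendsto_add[OF u(2) v(2), simplified]])
      show "norm (hnorm H (u n + v n - (x + y))) \<le> hnorm H (u n - x) + hnorm H (v n - y)" for n
        using norm_triangle[of "u n - x" "v n - y"] u(1)[of n, THEN SC] v(1)[of n, THEN SC] xy[THEN c]
        by (simp add: algebra_simps)
    qed
  qed
next
  fix a x assume x: "x \<in> closed_span H S"
  note c = closed_span_carrier[OF S, THEN subsetD]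
  note SC = span_carrier[OF S, THEN subsetD]
  obtain u where u: "\<And>n. u n \<in> vs.span S" "(\<lambda>n. hnorm H (u n - x)) \<longlonglongrightarrow> 0"
    using closed_span_seq[OF S x] by blast
  show "hscale H a x \<in> closed_span H S"
  proof (rule closed_spanI_seq[OF S])
    show "hscale H a x \<in> hcarrier H" using x c by simp
    show "hscale H a (u n) \<in> closed_span H S" for n
      by (intro span_closed_span[OF S] vs.span_scale u)
    have "hnorm H (hscale H a (u n) - hscale H a x) = cmod a * hnorm H (u n - x)" for n
      using norm_scale[of "u n - x" a] u(1)[of n, THEN SC] c[OF x]
      by (simp add: vs.scale_right_diff_distrib)
    then show "(\<lambda>n. hnorm H (hscale H a (u n) - hscale H a x)) \<longlonglongrightarrow> 0"
      using tendsto_mult[OF tendsto_const[of "cmod a"] u(2)] by simp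
  qed
qed

lemma closed_span_minimal:
  assumes S: "S \<subseteq> hcarrier H" and R: "R \<subseteq> closed_span H S"
  shows "closed_span H R \<subseteq> closed_span H S"
proof
  have Rc: "R \<subseteq> hcarrier H" using R closed_span_carrier[OF S] by blast
  fix x assume x: "x \<in> closed_span H R"
  then obtain u where u: "\<And>n. u n \<in> vs.span R" "(\<lambda>n. hnorm H (u n - x)) \<longlonglongrightarrow> 0"
    using closed_span_seq[OF Rc] by blast
  show "x \<in> closed_span H S"
  proof (rule closed_spanI_seq[OF S _ _ u(2)])
    show "x \<in> hcarrier H" using x closed_span_carrier[OF Rc] by blast
    show "u n \<in> closed_span H S" for n
      using u(1)[of n] vs.span_minimal[OF R subspace_closed_span[OF S]] by blast
  qed
qed

lemma orthogonal_closed_span: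
  assumes S: "S \<subseteq> hcarrier H" and x: "x \<in> hcarrier H"
    and "\<And>s. s \<in> S \<Longrightarrow> hinner H s x = 0" and y: "y \<in> closed_span H S"
  shows "hinner H y x = 0"
proof -
  have sp: "s \<in> hcarrier H \<and> hinner H s x = 0" if "s \<in> vs.span S" for s
    using that
    by (induction rule: vs.span_induct_alt)
       (use assms in \<open>auto simp: inner_add inner_scale subset_iff\<close>)
  obtain u where u: "\<And>n. u n \<in> vs.span S" "(\<lambda>n. hnorm H (u n - y)) \<longlonglongrightarrow> 0"
    using closed_span_seq[OF S y] by blast
  have "(\<lambda>n. hinner H (u n) x) \<longlonglongrightarrow> hinner H y x"
    by (rule tendsto_inner_seq)
       (use u sp x closed_span_carrier[OF S] y in auto)
  then show ?thesis
    using sp[OF u(1)] by (simp add: LIMSEQ_const_iff)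
qed

text \<open>The difference of the two vectors is orthogonal to a total set, hence to itself.\<close>

lemma eq_if_inner_eq_dense:
  assumes S: "S \<subseteq> hcarrier H" "closed_span H S = hcarrier H"
    and "x \<in> hcarrier H" "y \<in> hcarrier H"
    and "\<And>s. s \<in> S \<Longrightarrow> hinner H s x = hinner H s y"
  shows "x = y"
proof -
  have "hinner H (x - y) (x - y) = 0"
    by (rule orthogonal_closed_span[OF S(1)])
       (use assms in \<open>auto simp: inner_diff_right subset_iff\<close>)
  then show ?thesis using inner_definite[of "x - y"] assms by simp
qed

lemma orth_proj_eqI:
  assumes M: "vs.subspace M" "M \<subseteq> hcarrier H" and x: "x \<in> hcarrier H" and y: "y \<in> M"
    and o: "\<And>z. z \<in> M \<Longrightarrow> hinner H x z = hinner H y z"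
  shows "orth_proj H M x = y"
  unfolding orth_proj_def
proof (rule the_equality)
  show "y \<in> M \<and> (\<forall>z\<in>M. hinner H (x - y) z = 0)"
    using assms by (auto simp: inner_diff subset_iff)
  fix y' assume y': "y' \<in> M \<and> (\<forall>z\<in>M. hinner H (x - y') z = 0)"
  then have d: "y - y' \<in> M" using vs.subspace_diff[OF M(1)] y by blast
  have "hinner H (x - y') (y - y') = 0" using y' d by blast
  moreover have "hinner H x (y - y') = hinner H y (y - y')" using o d by blast
  ultimately have "hinner H (y - y') (y - y') = 0"
    using M y y' x d by (auto simp: inner_diff subset_iff)
  then show "y' = y" using inner_definite[of "y - y'"] d M by auto
qed

text \<open>\<open>orth_proj\<close> is a definite description, so an equation about its value
  carries information only if a projection exists; assumption \<open>ex\<close> provides it.\<close>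

lemma orth_projD:
  assumes M: "vs.subspace M" "M \<subseteq> hcarrier H" and x: "x \<in> hcarrier H" and y: "y \<in> M"
    and ex: "\<exists>y'\<in>M. \<forall>z\<in>M. hinner H x z = hinner H y' z"
    and eq: "orth_proj H M x = y" and z: "z \<in> M"
  shows "hinner H x z = hinner H y z"
  using ex orth_proj_eqI[OF M x] eq z by metis

lemma adj_eqI:
  assumes "y \<in> hcarrier H" "\<And>z. z \<in> hcarrier H \<Longrightarrow> hinner H (A z) x = hinner H z y"
  shows "adj H A x = y"
  unfolding adj_def
proof (rule the_equality)
  show "y \<in> hcarrier H \<and> (\<forall>z\<in>hcarrier H. hinner H (A z) x = hinner H z y)" using assms by blast
  fix y' assume y': "y' \<in> hcarrier H \<and> (\<forall>z\<in>hcarrier H. hinner H (A z) x = hinner H z y')"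
  then have "hinner H (y' - y) y' = hinner H (y' - y) y" using assms by (metis carrier_diff)
  then have "hinner H (y' - y) (y' - y) = 0"
    using y' assms(1) by (simp add: inner_diff_right)
  then show "y' = y" using inner_definite[of "y' - y"] y' assms(1) by simp
qed

end

sublocale complex_hilbert_space \<subseteq> pre_hilbert_space
  by (unfold_locales) (rule inner_definite)

context pre_hilbert_space
begin

lemma complex_hilbert_spaceI:
  assumes "\<And>x. Cauchy_seq x \<Longrightarrow> \<exists>a\<in>hcarrier H. (\<lambda>n. hnorm H (x n - a)) \<longlonglongrightarrow> 0"
  shows "complex_hilbert_space H"
  by (rule complex_hilbert_space.intro[OF vector_space subspace inner_add inner_scale inner_cnj
        inner_nonneg inner_definite])
     (use assms in \<open>auto simp: mcomplete_iff\<close>)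

end

context complex_hilbert_space
begin

lemma Cauchy_seq_convergent:
  assumes "Cauchy_seq x"
  obtains a where "a \<in> hcarrier H" "(\<lambda>n. hnorm H (x n - a)) \<longlonglongrightarrow> 0"
  using assms complete unfolding mcomplete_iff by blast

text \<open>The representing vector minimises |x|^2 - 2 Re (f x), which is bounded below by - C^2.
  The parallelogram identity makes a minimising sequence Cauchy, and completeness supplies the
  minimiser.\<close>

theorem Riesz_representation:
  assumes add: "\<And>x y. x \<in> hcarrier H \<Longrightarrow> y \<in> hcarrier H \<Longrightarrow> f (x + y) = f x + f y"
    and scale: "\<And>c x. x \<in> hcarrier H \<Longrightarrow> f (hscale H c x) = c * f x"
    and bound: "\<And>x. x \<in> hcarrier H \<Longrightarrow> cmod (f x) \<le> C * hnorm H x"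
  obtains y where "y \<in> hcarrier H" "\<And>x. x \<in> hcarrier H \<Longrightarrow> f x = hinner H x y"
proof -
  define F where "F x = (hnorm H x)\<^sup>2 - 2 * Re (f x)" for x
  have lb: "- C\<^sup>2 \<le> F x" if "x \<in> hcarrier H" for x
  proof -
    have "Re (f x) \<le> C * hnorm H x"
      using bound[OF that] complex_Re_le_cmod[of "f x"] by linarith
    moreover have "2 * (C * hnorm H x) \<le> (hnorm H x)\<^sup>2 + C\<^sup>2"
      using zero_le_power2[of "hnorm H x - C"] by (simp add: power2_diff mult.commute mult.left_commute)
    ultimately show ?thesis unfolding F_def by linarith
  qed
  define I where "I = Inf (F ` hcarrier H)"
  have bdd: "bdd_below (F ` hcarrier H)" by (rule bdd_belowI2[OF lb])
  have IF: "I \<le> F x" if "x \<in> hcarrier H" for x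
    unfolding I_def by (rule cInf_lower[OF imageI[OF that] bdd])
  have "\<exists>x\<in>hcarrier H. F x < I + 1 / real (Suc n)" for n
  proof -
    have "\<exists>a\<in>F ` hcarrier H. a < I + 1 / real (Suc n)"
      unfolding I_def by (rule cInf_lessD) (use carrier_0 in \<open>auto simp del: carrier_0\<close>)
    then show ?thesis by auto
  qed
  then obtain x where x: "\<And>n. x n \<in> hcarrier H" "\<And>n. F (x n) < I + 1 / real (Suc n)" by metis
  \<comment> \<open>The midpoint w of u and v satisfies F u + F v - 2 F w = |u - v|^2 / 2, and F w
    is at least the infimum.\<close>
  have par: "(hnorm H (u - v))\<^sup>2 \<le> 2 * (F u - I) + 2 * (F v - I)"
    if "u \<in> hcarrier H" "v \<in> hcarrier H" for u v
  proof -
    let ?w = "hscale H (1/2) (u + v)"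
    have "(hnorm H ?w)\<^sup>2 = (1/4) * ((hnorm H (u + v))\<^sup>2)"
      using that by (simp add: norm_scale power_divide norm_divide)
    moreover have "f ?w = (1/2) * (f u + f v)"
      using that by (simp add: scale add)
    then have "2 * Re (f ?w) = Re (f u) + Re (f v)" by (simp only:) simp
    ultimately have "4 * F ?w = (hnorm H u)\<^sup>2 + 2 * Re (hinner H u v) + (hnorm H v)\<^sup>2
        - 4 * Re (f u) - 4 * Re (f v)"
      using that by (simp add: F_def norm_sq_add)
    moreover have "I \<le> F ?w" using that by (intro IF) simp
    ultimately show ?thesis using that by (simp add: F_def norm_sq_diff)
  qed
  have arith: "s < d" if "a \<le> c" "b \<le> c" "s \<le> 2 * (p - I) + 2 * (q - I)"
    "p < I + a" "q < I + b" "c < d / 4" for a b c d p q s :: real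
    using that by (simp add: field_simps)
  have "Cauchy_seq x"
    unfolding Cauchy_seq_def
  proof (intro conjI allI impI)
    fix e :: real assume e: "e > 0"
    obtain N where N: "1 / real (Suc N) < e\<^sup>2 / 4"
      using e by (metis nat_approx_posE zero_less_divide_iff zero_less_numeral zero_less_power)
    show "\<exists>N. \<forall>m\<ge>N. \<forall>n\<ge>N. hnorm H (x m - x n) < e"
    proof (intro exI allI impI)
      fix m n assume mn: "N \<le> m" "N \<le> n"
      have "1 / real (Suc m) \<le> 1 / real (Suc N)" "1 / real (Suc n) \<le> 1 / real (Suc N)"
        using mn by (auto intro!: divide_left_mono)
      then have "(hnorm H (x m - x n))\<^sup>2 < e\<^sup>2"
        using arith[OF _ _ par[OF x(1)[of m] x(1)[of n]] x(2)[of m] x(2)[of n] N] by blast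
      then show "hnorm H (x m - x n) < e"
        using e by (simp add: power2_less_imp_less)
    qed
  qed (rule x)
  then obtain a where a: "a \<in> hcarrier H" "(\<lambda>n. hnorm H (x n - a)) \<longlonglongrightarrow> 0"
    by (rule Cauchy_seq_convergent)
  have "(\<lambda>n. f (x n)) \<longlonglongrightarrow> f a"
  proof (rule LIM_zero_cancel, rule tendsto_0_le_seq)
    show "cmod (f (x n) - f a) \<le> C * hnorm H (x n - a)" for n
    proof -
      have "f (x n) = f (x n - a) + f a" using add[of "x n - a" a] x(1)[of n] a(1) by simp
      then show ?thesis using bound[of "x n - a"] x(1)[of n] a(1) by simp
    qed
    show "(\<lambda>n. C * hnorm H (x n - a)) \<longlonglongrightarrow> 0"
      using tendsto_mult[OF tendsto_const a(2), of C] by simp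
  qed
  then have "(\<lambda>n. F (x n)) \<longlonglongrightarrow> F a"
    unfolding F_def by (intro tendsto_intros tendsto_norm_seq x a)
  moreover have "(\<lambda>n. F (x n)) \<longlonglongrightarrow> I"
  proof (rule tendsto_sandwich[OF _ _ tendsto_const])
    show "(\<lambda>n. I + 1 / real (Suc n)) \<longlonglongrightarrow> I"
      using tendsto_add[OF tendsto_const LIMSEQ_Suc[OF lim_1_over_n], of I] by simp
  qed (use x IF in \<open>auto simp: less_imp_le\<close>)
  ultimately have Fa: "F a = I" by (rule LIMSEQ_unique)
  have "f y = hinner H y a" if y: "y \<in> hcarrier H" for y
  proof (rule ccontr)
    define w where "w = f y - hinner H y a"
    assume "f y \<noteq> hinner H y a"
    then have w: "0 < (cmod w)\<^sup>2" by (simp add: w_def)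
    \<comment> \<open>If the minimiser failed to represent f at y, moving it by
      \<open>s * cnj w\<close> times y would change F by s |w|^2 (s |y|^2 - 2), a negative number.
      The summand 1 keeps the denominator positive for y = 0 too.\<close>
    define s where "s = 1 / ((hnorm H y)\<^sup>2 + 1)"
    have s: "0 < s" "s * (hnorm H y)\<^sup>2 < 1"
      unfolding s_def by (simp_all add: add_nonneg_pos)
    let ?t = "of_real s * cnj w"
    have "F (a + hscale H ?t y) = F a + 2 * Re (hinner H a (hscale H ?t y))
        + (hnorm H (hscale H ?t y))\<^sup>2 - 2 * Re (?t * f y)"
      using a(1) y by (simp add: F_def norm_sq_add add scale)
    also have "Re (hinner H a (hscale H ?t y)) = Re (?t * hinner H y a)"
      using a(1) y inner_cnj[of a "hscale H ?t y"] inner_scale[of y a ?t] by simp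
    also have "(hnorm H (hscale H ?t y))\<^sup>2 = s\<^sup>2 * (cmod w)\<^sup>2 * (hnorm H y)\<^sup>2"
      using y by (simp add: norm_scale norm_mult power_mult_distrib)
    finally have "0 \<le> 2 * Re (?t * hinner H y a) - 2 * Re (?t * f y) + s\<^sup>2 * (cmod w)\<^sup>2 * (hnorm H y)\<^sup>2"
      using IF[of "a + hscale H ?t y"] a(1) y Fa by simp
    moreover have "Re (?t * f y) - Re (?t * hinner H y a) = Re (?t * w)"
      by (simp add: w_def algebra_simps)
    moreover have "Re (?t * w) = s * (cmod w)\<^sup>2"
      unfolding cmod_power2 by (simp add: power2_eq_square algebra_simps)
    ultimately have "0 \<le> (s * (cmod w)\<^sup>2) * (s * (hnorm H y)\<^sup>2 - 2)"
      by (simp add: power2_eq_square algebra_simps)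
    moreover have "(s * (cmod w)\<^sup>2) * (s * (hnorm H y)\<^sup>2 - 2) < 0"
      using s w by (intro mult_pos_neg) auto
    ultimately show False by simp
  qed
  with a that show ?thesis by blast
qed

end

section \<open>Operators\<close>

lemma linear_op_carrier: "linear_op H K A \<Longrightarrow> x \<in> hcarrier H \<Longrightarrow> A x \<in> hcarrier K"
  by (auto simp: linear_op_def)

lemma linear_op_add:
  "linear_op H K A \<Longrightarrow> x \<in> hcarrier H \<Longrightarrow> y \<in> hcarrier H \<Longrightarrow> A (x + y) = A x + A y"
  by (auto simp: linear_op_def)

lemma linear_op_scale:
  "linear_op H K A \<Longrightarrow> x \<in> hcarrier H \<Longrightarrow> A (hscale H c x) = hscale K c (A x)"
  by (auto simp: linear_op_def)

lemma linear_op_0: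
  assumes "linear_op H K A" "semi_inner_space H"
  shows "A 0 = 0"
proof -
  interpret H: semi_inner_space H by fact
  show ?thesis using linear_op_add[OF assms(1), of 0 0] by simp
qed

lemma linear_op_diff:
  assumes "linear_op H K A" "semi_inner_space H" "x \<in> hcarrier H" "y \<in> hcarrier H"
  shows "A (x - y) = A x - A y"
proof -
  interpret H: semi_inner_space H by fact
  show ?thesis using linear_op_add[OF assms(1), of "x - y" y] assms by simp
qed

lemma linear_op_sum:
  assumes A: "linear_op H K A" and H: "semi_inner_space H" and f: "\<And>i. i \<in> I \<Longrightarrow> f i \<in> hcarrier H"
  shows "A (sum f I) = (\<Sum>i\<in>I. A (f i))"
proof -
  interpret H: semi_inner_space H by fact
  show ?thesis
    using f by (induction I rule: infinite_finite_induct)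
      (simp_all add: linear_op_0[OF A H] linear_op_add[OF A] H.carrier_sum)
qed

lemma contraction_op_linear: "contraction_op H K A \<Longrightarrow> linear_op H K A"
  by (simp add: contraction_op_def)

lemma contraction_op_norm: "contraction_op H K A \<Longrightarrow> x \<in> hcarrier H \<Longrightarrow> hnorm K (A x) \<le> hnorm H x"
  by (simp add: contraction_op_def)

lemma isometry_op_contraction: "isometry_op H K A \<Longrightarrow> contraction_op H K A"
  by (simp add: isometry_op_def contraction_op_def)

lemma unitary_op_isometry: "unitary_op H K A \<Longrightarrow> isometry_op H K A"
  by (simp add: unitary_op_def)

lemmas contraction_op_carrier = linear_op_carrier[OF contraction_op_linear]
  and isometry_op_linear = contraction_op_linear[OF isometry_op_contraction]
  and unitary_op_contraction = isometry_op_contraction[OF unitary_op_isometry]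

lemmas isometry_op_carrier = linear_op_carrier[OF isometry_op_linear]
  and unitary_op_carrier = contraction_op_carrier[OF unitary_op_contraction]
  and unitary_op_linear = contraction_op_linear[OF unitary_op_contraction]

lemma contraction_op_compose:
  "contraction_op K L A \<Longrightarrow> contraction_op H K B \<Longrightarrow> contraction_op H L (\<lambda>x. A (B x))"
  unfolding contraction_op_def linear_op_def by (simp add: Pi_iff) (meson order_trans)

lemma contraction_op_scale:
  assumes "complex_hilbert_space K" "contraction_op H K A" "cmod c = 1"
  shows "contraction_op H K (\<lambda>x. hscale K c (A x))"
proof -
  interpret K: complex_hilbert_space K by fact
  show ?thesis using assms(2,3)
    unfolding contraction_op_def linear_op_def
    by (auto simp: K.vs.scale_right_distrib K.vs.scale_left_commute K.norm_scale Pi_iff)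
qed

lemma contraction_op_tendsto:
  assumes H: "complex_hilbert_space H" and K: "complex_hilbert_space K" and A: "contraction_op H K A"
    and x: "\<And>n. x n \<in> hcarrier H" "a \<in> hcarrier H" "(\<lambda>n. hnorm H (x n - a)) \<longlonglongrightarrow> 0"
  shows "(\<lambda>n. hnorm K (A (x n) - A a)) \<longlonglongrightarrow> 0"
proof -
  interpret H: complex_hilbert_space H by fact
  interpret K: complex_hilbert_space K by fact
  note L = linear_op_diff[OF contraction_op_linear[OF A] H.semi_inner_space_axioms]
  show ?thesis
  proof (rule tendsto_0_le_seq[OF _ x(3)])
    show "norm (hnorm K (A (x n) - A a)) \<le> hnorm H (x n - a)" for n
      using contraction_op_norm[OF A, of "x n - a"] contraction_op_carrier[OF A] x
      by (simp add: L)
  qed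
qed

text \<open>Equality passes to the span by linearity and to limits because contractions are
  continuous. Operator identities such as double commutation are later checked on the vectors
  \<open>E m h\<close> alone.\<close>

lemma contraction_ops_agree:
  assumes H: "complex_hilbert_space H" and K: "complex_hilbert_space K"
    and A: "contraction_op H K A" and B: "contraction_op H K B"
    and S: "S \<subseteq> hcarrier H" and eq: "\<And>x. x \<in> S \<Longrightarrow> A x = B x"
    and x: "x \<in> closed_span H S"
  shows "A x = B x"
proof -
  interpret H: complex_hilbert_space H by fact
  interpret K: complex_hilbert_space K by fact
  note AL = contraction_op_linear[OF A] and BL = contraction_op_linear[OF B]
  have sp: "y \<in> hcarrier H \<and> A y = B y" if "y \<in> H.vs.span S" for y
    using that
  proof (induction rule: H.vs.span_induct_alt)
    case base
    show ?case using linear_op_0[OF AL H.semi_inner_space_axioms] linear_op_0[OF BL H.semi_inner_space_axioms]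
      by simp
  next
    case (step c y z)
    then have "y \<in> hcarrier H" "A y = B y" using S eq by auto
    then show ?case using step
      by (simp add: linear_op_add[OF AL] linear_op_add[OF BL] linear_op_scale[OF AL] linear_op_scale[OF BL])
  qed
  obtain u where u: "\<And>n. u n \<in> H.vs.span S" "(\<lambda>n. hnorm H (u n - x)) \<longlonglongrightarrow> 0"
    using H.closed_span_seq[OF S x] by blast
  have xc: "x \<in> hcarrier H" using x H.closed_span_carrier[OF S] by blast
  have a: "(\<lambda>n. hnorm K (A (u n) - A x)) \<longlonglongrightarrow> 0"
    by (rule contraction_op_tendsto[OF H K A]) (use u sp xc in auto)
  have b: "(\<lambda>n. hnorm K (A (u n) - B x)) \<longlonglongrightarrow> 0"
    using contraction_op_tendsto[OF H K B _ xc u(2)] u sp by auto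
  have "(\<lambda>n. hnorm K (A x - B x)) \<longlonglongrightarrow> 0"
  proof (rule tendsto_0_le_seq[OF _ tendsto_add[OF a b, simplified]])
    fix n
    have c: "A x \<in> hcarrier K" "A (u n) \<in> hcarrier K" "B x \<in> hcarrier K"
      using contraction_op_carrier[OF A] contraction_op_carrier[OF B] xc sp[OF u(1)[of n]] by auto
    show "norm (hnorm K (A x - B x)) \<le> hnorm K (A (u n) - A x) + hnorm K (A (u n) - B x)"
      using K.norm_triangle_diff[OF c] K.norm_minus_commute[OF c(1,2)] c by simp
  qed
  then have "hnorm K (A x - B x) = 0" by (simp add: LIMSEQ_const_iff)
  then show ?thesis
    using K.eq_iff_norm_diff contraction_op_carrier[OF A xc] contraction_op_carrier[OF B xc] by blast
qed

text \<open>Polarisation: real parts come from the norm of a sum, imaginary parts from the real part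
  with x replaced by i x.\<close>

lemma isometry_op_inner:
  assumes H: "semi_inner_space H" and K: "semi_inner_space K" and A: "isometry_op H K A"
    and x: "x \<in> hcarrier H" and y: "y \<in> hcarrier H"
  shows "hinner K (A x) (A y) = hinner H x y"
proof -
  interpret H: semi_inner_space H by fact
  interpret K: semi_inner_space K by fact
  note L = isometry_op_linear[OF A] and c = isometry_op_carrier[OF A]
  have n: "hnorm K (A z) = hnorm H z" if "z \<in> hcarrier H" for z
    using A that by (simp add: isometry_op_def)
  have Re: "Re (hinner K (A u) (A v)) = Re (hinner H u v)" if "u \<in> hcarrier H" "v \<in> hcarrier H" for u v
    using K.norm_sq_add[OF c c, of u v] H.norm_sq_add[of u v] n[of u] n[of v] n[of "u + v"] that
    by (simp add: linear_op_add[OF L])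
  have "Re (hinner K (A (hscale H \<i> x)) (A y)) = Re (hinner H (hscale H \<i> x) y)"
    by (rule Re) (use x y in auto)
  then have "Im (hinner K (A x) (A y)) = Im (hinner H x y)"
    using x y c by (simp add: linear_op_scale[OF L] K.inner_scale H.inner_scale)
  with Re[OF x y] show ?thesis by (simp add: complex_eq_iff)
qed

section \<open>Adjoints of contractions, and closed subspaces as Hilbert spaces\<close>

context complex_hilbert_space
begin

text \<open>The functional that sends z to the inner product of A z with x is bounded by the norm of
  x, because A is a contraction; its Riesz vector is the one that the description in
  \<open>adj\<close> refers to.\<close>

lemma adj_exists:
  assumes A: "contraction_op H H A" and x: "x \<in> hcarrier H"
  shows "adj H A x \<in> hcarrier H" "\<And>z. z \<in> hcarrier H \<Longrightarrow> hinner H (A z) x = hinner H z (adj H A x)"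
proof -
  note L = contraction_op_linear[OF A] and c = contraction_op_carrier[OF A]
  obtain y where y: "y \<in> hcarrier H" "\<And>z. z \<in> hcarrier H \<Longrightarrow> hinner H (A z) x = hinner H z y"
  proof (rule Riesz_representation[of "\<lambda>z. hinner H (A z) x" "hnorm H x"])
    fix z assume z: "z \<in> hcarrier H"
    have "cmod (hinner H (A z) x) \<le> hnorm H (A z) * hnorm H x"
      by (rule Cauchy_Schwarz[OF c[OF z] x])
    also have "\<dots> \<le> hnorm H x * hnorm H z"
      using contraction_op_norm[OF A z] x by (simp add: mult.commute mult_left_mono)
    finally show "cmod (hinner H (A z) x) \<le> hnorm H x * hnorm H z" .
  qed (use x c in \<open>auto simp: linear_op_add[OF L] linear_op_scale[OF L] inner_add inner_scale\<close>)
  have "adj H A x = y" by (rule adj_eqI) (use y in auto)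
  with y show "adj H A x \<in> hcarrier H" "\<And>z. z \<in> hcarrier H \<Longrightarrow> hinner H (A z) x = hinner H z (adj H A x)"
    by auto
qed

lemma eqI_inner:
  assumes "x \<in> hcarrier H" "y \<in> hcarrier H" "\<And>z. z \<in> hcarrier H \<Longrightarrow> hinner H z x = hinner H z y"
  shows "x = y"
  using inner_definite[of "x - y"] assms by (simp add: inner_diff_right)

lemma contraction_op_adj:
  assumes A: "contraction_op H H A"
  shows "contraction_op H H (adj H A)"
  unfolding contraction_op_def linear_op_def
proof (intro conjI ballI allI)
  note L = contraction_op_linear[OF A] and c = contraction_op_carrier[OF A]
  note a = adj_exists[OF A]
  show "adj H A \<in> hcarrier H \<rightarrow> hcarrier H" using a by blast
  show "adj H A (x + y) = adj H A x + adj H A y" if "x \<in> hcarrier H" "y \<in> hcarrier H" for x y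
    by (rule adj_eqI) (use that a c in \<open>auto simp: inner_add_right\<close>)
  show "adj H A (hscale H s x) = hscale H s (adj H A x)" if "x \<in> hcarrier H" for s x
    by (rule adj_eqI) (use that a c in \<open>auto simp: inner_scale_right\<close>)
  show "hnorm H (adj H A x) \<le> hnorm H x" if x: "x \<in> hcarrier H" for x
  proof -
    let ?y = "adj H A x"
    have y: "?y \<in> hcarrier H" by (rule a(1)[OF x])
    \<comment> \<open>Writing y for the adjoint applied to x, |y|^2 = Re <A y, x> is at most |y|
      |x|, and one factor |y| is cancelled at the end.\<close>
    have "(hnorm H ?y)\<^sup>2 = Re (hinner H (A ?y) x)"
      using a(2)[OF x y] norm_sq[OF y] by simp
    also have "\<dots> \<le> hnorm H (A ?y) * hnorm H x"
      using Cauchy_Schwarz[OF c[OF y] x] complex_Re_le_cmod order_trans by blast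
    also have "\<dots> \<le> hnorm H ?y * hnorm H x"
      using contraction_op_norm[OF A y] x by (simp add: mult_right_mono)
    finally have "hnorm H ?y * hnorm H ?y \<le> hnorm H ?y * hnorm H x" by (simp add: power2_eq_square)
    then show ?thesis
      using norm_nonneg[OF y] norm_nonneg[OF x] by (cases "hnorm H ?y = 0") auto
  qed
qed

lemma adj_eqI_dense:
  assumes A: "contraction_op H H A" and S: "S \<subseteq> hcarrier H" "closed_span H S = hcarrier H"
    and "x \<in> hcarrier H" "y \<in> hcarrier H" "\<And>z. z \<in> S \<Longrightarrow> hinner H (A z) x = hinner H z y"
  shows "adj H A x = y"
  by (rule eq_if_inner_eq_dense[OF S])
     (use assms adj_exists[OF A] in \<open>auto simp: subset_iff\<close>)

lemma adj_unitary_left: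
  assumes U: "unitary_op H H U" and x: "x \<in> hcarrier H"
  shows "adj H U (U x) = x"
  by (rule adj_eqI[OF x])
     (use x isometry_op_inner[OF semi_inner_space_axioms semi_inner_space_axioms unitary_op_isometry[OF U]]
       in auto)

lemma adj_unitary_right:
  assumes U: "unitary_op H H U" and x: "x \<in> hcarrier H"
  shows "U (adj H U x) = x"
proof -
  obtain y where "y \<in> hcarrier H" "x = U y" using U x by (auto simp: unitary_op_def)
  then show ?thesis using adj_unitary_left[OF U] by simp
qed

lemma hnorm_restrict [simp]: "hnorm (H\<lparr>hcarrier := M\<rparr>) = hnorm H"
  by (simp add: hnorm_def fun_eq_iff)

lemma complex_hilbert_space_closed_span:
  assumes S: "S \<subseteq> hcarrier H"
  shows "complex_hilbert_space (H\<lparr>hcarrier := closed_span H S\<rparr>)" (is "complex_hilbert_space ?L")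
proof -
  note c = closed_span_carrier[OF S, THEN subsetD]
  interpret L: pre_hilbert_space ?L
    by (unfold_locales)
       (use vector_space subspace_closed_span[OF S] in
        \<open>auto simp: vector_space_def inner_add inner_scale c intro: inner_cnj inner_nonneg inner_definite\<close>)
  show ?thesis
  proof (rule L.complex_hilbert_spaceI)
    fix x assume x: "L.Cauchy_seq x"
    then have "Cauchy_seq x" using c unfolding L.Cauchy_seq_def Cauchy_seq_def by auto
    then obtain a where a: "a \<in> hcarrier H" "(\<lambda>n. hnorm H (x n - a)) \<longlonglongrightarrow> 0"
      by (rule Cauchy_seq_convergent)
    moreover have "a \<in> closed_span H S"
      by (rule closed_spanI_seq[OF S a(1) _ a(2)]) (use x in \<open>auto simp: L.Cauchy_seq_def\<close>)
    ultimately show "\<exists>a\<in>hcarrier ?L. (\<lambda>n. hnorm ?L (x n - a)) \<longlonglongrightarrow> 0" by auto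
  qed
qed

text \<open>Closures in a closed subspace and in the whole space agree. Minimality of
  \<open>V\<close> is stated in the subspace and is compared in this way with a closed span in the
  dilation space.\<close>

lemma closed_span_restrict:
  assumes S: "S \<subseteq> hcarrier H" and R: "R \<subseteq> closed_span H S"
  shows "closed_span (H\<lparr>hcarrier := closed_span H S\<rparr>) R = closed_span H R"
proof -
  let ?L = "H\<lparr>hcarrier := closed_span H S\<rparr>"
  interpret L: complex_hilbert_space ?L by (rule complex_hilbert_space_closed_span[OF S])
  have Rc: "R \<subseteq> hcarrier H" using R closed_span_carrier[OF S] by blast
  have "x \<in> closed_span ?L R \<longleftrightarrow> x \<in> closed_span H S \<and> x \<in> closed_span H R" for x
    using L.closed_span_iff[of R x] closed_span_iff[OF Rc, of x] R closed_span_carrier[OF S] by auto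
  then show ?thesis using closed_span_minimal[OF S R] by blast
qed

end

text \<open>The graph of the linear extension of \<open>e i \<mapsto> e' i\<close>, which is a function only if the two
  families have the same Gram matrix.\<close>

inductive span_pair ::
  "'b::ab_group_add hspace \<Rightarrow> 'c::ab_group_add hspace \<Rightarrow> 'i set \<Rightarrow> ('i \<Rightarrow> 'b) \<Rightarrow> ('i \<Rightarrow> 'c) \<Rightarrow> 'b \<Rightarrow> 'c \<Rightarrow> bool"
  for K K' I e e' where
  span_pair_0: "span_pair K K' I e e' 0 0"
| span_pair_add: "span_pair K K' I e e' u v \<Longrightarrow> i \<in> I \<Longrightarrow>
    span_pair K K' I e e' (hscale K c (e i) + u) (hscale K' c (e' i) + v)"

text \<open>Equal Gram matrices make \<open>span_pair\<close> preserve distances, so a sequence in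
  the span that tends to x has a Cauchy partner in K', whose limit is y. Only a vector is produced
  here; once \<open>e'\<close> is total, its inner products with \<open>e'\<close> determine
  it.\<close>

lemma same_gram_transfer:
  assumes K: "complex_hilbert_space K" and K': "complex_hilbert_space K'"
    and e: "e ` I \<subseteq> hcarrier K" and e': "e' ` I \<subseteq> hcarrier K'"
    and gram: "\<And>i j. i \<in> I \<Longrightarrow> j \<in> I \<Longrightarrow> hinner K (e i) (e j) = hinner K' (e' i) (e' j)"
    and x: "x \<in> closed_span K (e ` I)"
  shows "\<exists>y\<in>hcarrier K'. hnorm K' y = hnorm K x \<and> (\<forall>i\<in>I. hinner K x (e i) = hinner K' y (e' i))"
proof -
  interpret K: complex_hilbert_space K by fact
  interpret K': complex_hilbert_space K' by fact
  let ?R = "span_pair K K' I e e'"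
  have ec: "e i \<in> hcarrier K" "e' i \<in> hcarrier K'" if "i \<in> I" for i using that e e' by auto
  have Rc: "u \<in> hcarrier K \<and> v \<in> hcarrier K'" if "?R u v" for u v
    using that by (induction) (use ec in auto)
  have Re: "hinner K u (e i) = hinner K' v (e' i)" if "?R u v" "i \<in> I" for u v i
    using that(1) by (induction)
      (use that(2) ec gram Rc in \<open>auto simp: K.inner_add K'.inner_add K.inner_scale K'.inner_scale\<close>)
  have RR: "hinner K u u' = hinner K' v v'" if "?R u v" "?R u' v'" for u v u' v'
    using that(2)
  proof induction
    case (span_pair_add u' v' i c)
    then show ?case
      using Re[OF that(1)] ec Rc[OF that(1)] Rc[of u' v']
      by (simp add: K.inner_add_right K'.inner_add_right K.inner_scale_right K'.inner_scale_right)
  qed (use Rc[OF that(1)] in auto)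
  have RN: "hnorm K' (v - v') = hnorm K (u - u')" if "?R u v" "?R u' v'" for u v u' v'
    using RR[OF that(1) that(1)] RR[OF that] RR[OF that(2) that(2)] Rc[OF that(1)] Rc[OF that(2)]
    by (simp add: hnorm_def K.inner_diff K.inner_diff_right K'.inner_diff K'.inner_diff_right
        RR[OF that(2) that(1)])
  have Rex: "\<exists>v. ?R u v" if "u \<in> K.vs.span (e ` I)" for u
    using that by (induction rule: K.vs.span_induct_alt) (auto intro: span_pair.intros)
  have xc: "x \<in> hcarrier K" using x K.closed_span_carrier[OF e] by blast
  obtain u where u: "\<And>n. u n \<in> K.vs.span (e ` I)" "(\<lambda>n. hnorm K (u n - x)) \<longlonglongrightarrow> 0"
    using K.closed_span_seq[OF e x] by blast
  obtain v where v: "\<And>n. ?R (u n) (v n)" using Rex[OF u(1)] by metis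
  have uc: "u n \<in> hcarrier K" and vc: "v n \<in> hcarrier K'" for n using Rc[OF v] by auto
  have "K'.Cauchy_seq v"
    unfolding K'.Cauchy_seq_def
  proof (intro conjI allI impI vc)
    fix d :: real assume d: "d > 0"
    then obtain N where N: "\<And>n. n \<ge> N \<Longrightarrow> hnorm K (u n - x) < d / 2"
      using u(2) unfolding LIMSEQ_def dist_real_def
      by (metis abs_less_iff diff_zero half_gt_zero)
    show "\<exists>N. \<forall>m\<ge>N. \<forall>n\<ge>N. hnorm K' (v m - v n) < d"
    proof (intro exI allI impI)
      fix m n assume "N \<le> m" "N \<le> n"
      then show "hnorm K' (v m - v n) < d"
        using N[of m] N[of n] K.norm_triangle_diff[OF uc xc uc, of m n]
          K.norm_minus_commute[OF uc xc, of n] RN[OF v v, of m n] by simp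
    qed
  qed
  then obtain y where y: "y \<in> hcarrier K'" "(\<lambda>n. hnorm K' (v n - y)) \<longlonglongrightarrow> 0"
    by (rule K'.Cauchy_seq_convergent)
  have "hnorm K' (v n) = hnorm K (u n)" for n
    using RN[OF v span_pair_0, of n] by simp
  then have "hnorm K' y = hnorm K x"
    using K'.tendsto_norm_seq[OF vc y] K.tendsto_norm_seq[OF uc xc u(2)] LIMSEQ_unique by fastforce
  moreover have "hinner K x (e i) = hinner K' y (e' i)" if i: "i \<in> I" for i
  proof -
    have "(\<lambda>n. hinner K (u n) (e i)) \<longlonglongrightarrow> hinner K x (e i)"
      by (rule K.tendsto_inner_seq) (use uc xc u(2) ec[OF i] in auto)
    moreover have "(\<lambda>n. hinner K' (v n) (e' i)) \<longlonglongrightarrow> hinner K' y (e' i)"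
      by (rule K'.tendsto_inner_seq) (use vc y ec[OF i] in auto)
    ultimately show ?thesis using Re[OF v i] LIMSEQ_unique by fastforce
  qed
  ultimately show ?thesis using y(1) by blast
qed

text \<open>A vector is sent to one with the same norm and the same inner products with the family.
  Totality of \<open>e'\<close> makes the choice unique, which gives linearity, and the transfer in
  the opposite direction gives surjectivity.\<close>

theorem unitary_extension:
  assumes K: "complex_hilbert_space K" and K': "complex_hilbert_space K'"
    and e: "e ` I \<subseteq> hcarrier K" "closed_span K (e ` I) = hcarrier K"
    and e': "e' ` I \<subseteq> hcarrier K'" "closed_span K' (e' ` I) = hcarrier K'"
    and gram: "\<And>i j. i \<in> I \<Longrightarrow> j \<in> I \<Longrightarrow> hinner K (e i) (e j) = hinner K' (e' i) (e' j)"
  obtains U where "unitary_op K K' U" "\<And>i. i \<in> I \<Longrightarrow> U (e i) = e' i"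
proof -
  interpret K: complex_hilbert_space K by fact
  interpret K': complex_hilbert_space K' by fact
  have "\<forall>x\<in>hcarrier K. \<exists>y. y \<in> hcarrier K' \<and> hnorm K' y = hnorm K x \<and> (\<forall>i\<in>I. hinner K x (e i) = hinner K' y (e' i))"
    using same_gram_transfer[OF K K' e(1) e'(1) gram] e(2) by blast
  then obtain U where U: "\<And>x. x \<in> hcarrier K \<Longrightarrow> U x \<in> hcarrier K'"
    "\<And>x. x \<in> hcarrier K \<Longrightarrow> hnorm K' (U x) = hnorm K x"
    "\<And>x i. x \<in> hcarrier K \<Longrightarrow> i \<in> I \<Longrightarrow> hinner K' (U x) (e' i) = hinner K x (e i)"
    by metis
  have ec: "e i \<in> hcarrier K" "e' i \<in> hcarrier K'" if "i \<in> I" for i using that e e' by auto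
  have eq: "U x = y" if "x \<in> hcarrier K" "y \<in> hcarrier K'"
    "\<And>i. i \<in> I \<Longrightarrow> hinner K' y (e' i) = hinner K x (e i)" for x y
  proof (rule K'.eq_if_inner_eq_dense[OF e'])
    fix s assume "s \<in> e' ` I"
    then obtain i where i: "i \<in> I" "s = e' i" by auto
    then have "hinner K' (U x) (e' i) = hinner K' y (e' i)" using U(3)[of x i] that by simp
    then show "hinner K' s (U x) = hinner K' s y"
      using K'.inner_cnj[of "U x" "e' i"] K'.inner_cnj[of y "e' i"] U(1) that ec i by simp
  qed (use U that in auto)
  have "linear_op K K' U"
    unfolding linear_op_def
  proof (intro conjI ballI allI)
    show "U (x + y) = U x + U y" if "x \<in> hcarrier K" "y \<in> hcarrier K" for x y
      by (rule eq) (use that U ec in \<open>auto simp: K.inner_add K'.inner_add\<close>)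
    show "U (hscale K c x) = hscale K' c (U x)" if "x \<in> hcarrier K" for c x
      by (rule eq) (use that U ec in \<open>auto simp: K.inner_scale K'.inner_scale\<close>)
  qed (use U in auto)
  moreover have "y \<in> U ` hcarrier K" if y: "y \<in> hcarrier K'" for y
  proof -
    obtain x where x: "x \<in> hcarrier K" "\<forall>i\<in>I. hinner K' y (e' i) = hinner K x (e i)"
      using same_gram_transfer[OF K' K e'(1) e(1) gram[symmetric], of y] e'(2) y by blast
    then have "U x = y" using eq y by blast
    with x show ?thesis by blast
  qed
  ultimately have "unitary_op K K' U"
    using U unfolding unitary_op_def isometry_op_def by auto
  moreover have "U (e i) = e' i" if "i \<in> I" for i
    by (rule eq) (use that ec gram in auto)
  ultimately show ?thesis using that by blast
qed

section \<open>Completion\<close>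

text \<open>No classes are formed yet: sequences of vanishing limit norm remain as null vectors.
  Separating this step from the quotient leaves the type of the quotient free.\<close>

definition cauchy_space :: "'a::ab_group_add hspace \<Rightarrow> (nat \<Rightarrow> 'a) hspace" where
  "cauchy_space H = \<lparr>hcarrier = {x. semi_inner_space.Cauchy_seq H x},
     hscale = \<lambda>c x n. hscale H c (x n), hinner = \<lambda>x y. lim (\<lambda>n. hinner H (x n) (y n))\<rparr>"

lemma vector_space_pointwise:
  assumes "vector_space s"
  shows "vector_space (\<lambda>c f i. s c (f i))"
proof -
  interpret vector_space s by fact
  show ?thesis
    by unfold_locales
      (auto simp: fun_eq_iff scale_right_distrib scale_left_distrib)
qed

context semi_inner_space
begin

abbreviation "CS \<equiv> cauchy_space H"

lemma cauchy_space_simps [simp]: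
  "hcarrier CS = {x. Cauchy_seq x}"
  "hscale CS = (\<lambda>c x n. hscale H c (x n))"
  "hinner CS x y = lim (\<lambda>n. hinner H (x n) (y n))"
  by (simp_all add: cauchy_space_def)

lemma Cauchy_seq_carrier: "Cauchy_seq x \<Longrightarrow> x n \<in> hcarrier H"
  by (simp add: Cauchy_seq_def)

lemma Cauchy_seq_const: "a \<in> hcarrier H \<Longrightarrow> Cauchy_seq (\<lambda>n. a)"
  by (auto simp: Cauchy_seq_def)

lemma Cauchy_seq_add:
  assumes "Cauchy_seq x" "Cauchy_seq y"
  shows "Cauchy_seq (x + y)"
  unfolding Cauchy_seq_def
proof (intro conjI allI impI)
  note c = assms[THEN Cauchy_seq_carrier]
  show "(x + y) n \<in> hcarrier H" for n using c by simp
  fix e :: real assume e: "e > 0"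
  obtain N1 where N1: "\<And>m n. N1 \<le> m \<Longrightarrow> N1 \<le> n \<Longrightarrow> hnorm H (x m - x n) < e / 2"
    using assms(1) half_gt_zero[OF e] unfolding Cauchy_seq_def by blast
  obtain N2 where N2: "\<And>m n. N2 \<le> m \<Longrightarrow> N2 \<le> n \<Longrightarrow> hnorm H (y m - y n) < e / 2"
    using assms(2) half_gt_zero[OF e] unfolding Cauchy_seq_def by blast
  show "\<exists>N. \<forall>m\<ge>N. \<forall>n\<ge>N. hnorm H ((x + y) m - (x + y) n) < e"
  proof (intro exI allI impI)
    fix m n assume "max N1 N2 \<le> m" "max N1 N2 \<le> n"
    then have "hnorm H (x m - x n) + hnorm H (y m - y n) < e"
      using N1[of m n] N2[of m n] by simp
    then show "hnorm H ((x + y) m - (x + y) n) < e"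
      using norm_triangle[of "x m - x n" "y m - y n"] c by (simp add: algebra_simps)
  qed
qed

lemma Cauchy_seq_scale:
  assumes "Cauchy_seq x"
  shows "Cauchy_seq (\<lambda>n. hscale H c (x n))"
  unfolding Cauchy_seq_def
proof (intro conjI allI impI)
  note xc = assms[THEN Cauchy_seq_carrier]
  show "hscale H c (x n) \<in> hcarrier H" for n using xc by simp
  fix e :: real assume e: "e > 0"
  then have "e / (cmod c + 1) > 0" by (simp add: add_nonneg_pos)
  then obtain N where N: "\<And>m n. N \<le> m \<Longrightarrow> N \<le> n \<Longrightarrow> hnorm H (x m - x n) < e / (cmod c + 1)"
    using assms unfolding Cauchy_seq_def by blast
  show "\<exists>N. \<forall>m\<ge>N. \<forall>n\<ge>N. hnorm H (hscale H c (x m) - hscale H c (x n)) < e"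
  proof (intro exI allI impI)
    fix m n assume "N \<le> m" "N \<le> n"
    then have "(cmod c + 1) * hnorm H (x m - x n) < e"
      using N[of m n] by (simp add: pos_less_divide_eq add_nonneg_pos mult.commute)
    moreover have "cmod c * hnorm H (x m - x n) \<le> (cmod c + 1) * hnorm H (x m - x n)"
      using xc by (intro mult_right_mono) auto
    ultimately show "hnorm H (hscale H c (x m) - hscale H c (x n)) < e"
      using norm_scale[of "x m - x n" c] xc by (simp add: vs.scale_right_diff_distrib)
  qed
qed

lemma Cauchy_seq_norm_Cauchy:
  assumes "Cauchy_seq x"
  shows "Cauchy (\<lambda>n. hnorm H (x n))"
  unfolding Cauchy_def dist_real_def
proof (intro allI impI)
  fix e :: real assume "e > 0"
  then obtain N where N: "\<And>m n. N \<le> m \<Longrightarrow> N \<le> n \<Longrightarrow> hnorm H (x m - x n) < e"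
    using assms unfolding Cauchy_seq_def by blast
  show "\<exists>M. \<forall>m\<ge>M. \<forall>n\<ge>M. \<bar>hnorm H (x m) - hnorm H (x n)\<bar> < e"
    using N norm_diff_ge[OF Cauchy_seq_carrier[OF assms] Cauchy_seq_carrier[OF assms]]
    by (meson le_less_trans)
qed

lemma Cauchy_seq_bounded:
  assumes "Cauchy_seq x"
  obtains B where "0 < B" "\<And>n. hnorm H (x n) \<le> B"
proof -
  obtain B where "0 < B" "\<forall>n. norm (hnorm H (x n)) \<le> B"
    using Cauchy_Bseq[OF Cauchy_seq_norm_Cauchy[OF assms]] by (auto elim: BseqE)
  then show ?thesis using that[of B] by (metis abs_le_D1 real_norm_def)
qed

text \<open>The inner product of \<open>CS\<close> is a \<open>lim\<close>, which is informative
  only once convergence is known. Both sequences are bounded, so the two error terms can each be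
  kept below e / 2.\<close>

lemma Cauchy_seq_inner_tendsto:
  assumes x: "Cauchy_seq x" and y: "Cauchy_seq y"
  shows "(\<lambda>n. hinner H (x n) (y n)) \<longlonglongrightarrow> hinner CS x y"
proof -
  note c = x[THEN Cauchy_seq_carrier] y[THEN Cauchy_seq_carrier]
  obtain A where A: "0 < A" "\<And>n. hnorm H (x n) \<le> A" using Cauchy_seq_bounded[OF x] by blast
  obtain B where B: "0 < B" "\<And>n. hnorm H (y n) \<le> B" using Cauchy_seq_bounded[OF y] by blast
  have "Cauchy (\<lambda>n. hinner H (x n) (y n))"
    unfolding Cauchy_def
  proof (intro allI impI)
    fix e :: real assume e: "e > 0"
    have e1: "e / (2 * B) > 0" and e2: "e / (2 * A) > 0" using A B e by simp_all
    obtain N1 where N1: "\<And>m n. N1 \<le> m \<Longrightarrow> N1 \<le> n \<Longrightarrow> hnorm H (x m - x n) < e / (2 * B)"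
      using x e1 unfolding Cauchy_seq_def by blast
    obtain N2 where N2: "\<And>m n. N2 \<le> m \<Longrightarrow> N2 \<le> n \<Longrightarrow> hnorm H (y m - y n) < e / (2 * A)"
      using y e2 unfolding Cauchy_seq_def by blast
    show "\<exists>M. \<forall>m\<ge>M. \<forall>n\<ge>M. dist (hinner H (x m) (y m)) (hinner H (x n) (y n)) < e"
    proof (intro exI allI impI)
      fix m n assume mn: "max N1 N2 \<le> m" "max N1 N2 \<le> n"
      have "hnorm H (x m - x n) * hnorm H (y m) \<le> hnorm H (x m - x n) * B"
        using B c by (intro mult_left_mono) auto
      moreover have "hnorm H (x m - x n) * B < e / 2"
        using N1[of m n] mn B by (simp add: field_simps)
      moreover have "hnorm H (x n) * hnorm H (y m - y n) \<le> A * hnorm H (y m - y n)"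
        using A c by (intro mult_right_mono) auto
      moreover have "A * hnorm H (y m - y n) < e / 2"
        using N2[of m n] mn A by (simp add: field_simps)
      ultimately show "dist (hinner H (x m) (y m)) (hinner H (x n) (y n)) < e"
        using inner_diff_bound[of "x m" "x n" "y m" "y n"] c by (simp add: dist_norm)
    qed
  qed
  then show ?thesis
    by (simp add: Cauchy_convergent_iff convergent_LIMSEQ_iff)
qed

lemma Cauchy_seq_norm_tendsto:
  assumes x: "Cauchy_seq x"
  shows "(\<lambda>n. hnorm H (x n)) \<longlonglongrightarrow> hnorm CS x"
  unfolding hnorm_def
  by (intro tendsto_intros Cauchy_seq_inner_tendsto x)

interpretation CS: semi_inner_space CS
proof (rule semi_inner_space.intro)
  show "vector_space (hscale CS)"
    using vector_space_pointwise[OF vector_space] by simp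
  then interpret v: vector_space "hscale CS" .
  show "v.subspace (hcarrier CS)"
  proof (rule v.subspaceI)
    show "0 \<in> hcarrier CS" using Cauchy_seq_const[OF carrier_0] by (simp add: zero_fun_def)
  qed (use Cauchy_seq_add Cauchy_seq_scale in auto)
next
  fix x y z c assume "x \<in> hcarrier CS" "y \<in> hcarrier CS"
  then have x: "Cauchy_seq x" and y: "Cauchy_seq y" by simp_all
  note c = x[THEN Cauchy_seq_carrier] y[THEN Cauchy_seq_carrier]
  note l = Cauchy_seq_inner_tendsto
  show "hinner CS (hscale CS c x) y = c * hinner CS x y"
    using tendsto_mult[OF tendsto_const l[OF x y], of c] l[OF Cauchy_seq_scale[OF x, of c] y]
      LIMSEQ_unique c by (fastforce simp: inner_scale)
  have "(\<lambda>n. cnj (hinner H (x n) (y n))) = (\<lambda>n. hinner H (y n) (x n))"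
    using inner_cnj[OF c] by simp
  then show "hinner CS y x = cnj (hinner CS x y)"
    using tendsto_cnj[OF l[OF x y]] l[OF y x] LIMSEQ_unique by fastforce
  show "0 \<le> Re (hinner CS x x)"
    by (rule LIMSEQ_le_const[OF tendsto_Re[OF l[OF x x]]]) (use c inner_nonneg in auto)
  assume "z \<in> hcarrier CS"
  then have z: "Cauchy_seq z" by simp
  show "hinner CS (x + y) z = hinner CS x z + hinner CS y z"
    using tendsto_add[OF l[OF x z] l[OF y z]] l[OF Cauchy_seq_add[OF x y] z]
      LIMSEQ_unique c z[THEN Cauchy_seq_carrier] by (fastforce simp: inner_add)
qed

text \<open>Density of the constant sequences: a Cauchy sequence is approximated by the constant
  sequences built from its own terms.\<close>

lemma Cauchy_seq_norm_diff_const: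
  assumes x: "Cauchy_seq x"
  shows "(\<lambda>N. hnorm CS (x - (\<lambda>n. x N))) \<longlonglongrightarrow> 0"
  unfolding LIMSEQ_def
proof (intro allI impI)
  note c = x[THEN Cauchy_seq_carrier]
  fix e :: real assume e: "e > 0"
  obtain N where N: "\<And>m n. N \<le> m \<Longrightarrow> N \<le> n \<Longrightarrow> hnorm H (x m - x n) < e / 2"
    using x half_gt_zero[OF e] unfolding Cauchy_seq_def by blast
  show "\<exists>N. \<forall>M\<ge>N. dist (hnorm CS (x - (\<lambda>n. x M))) 0 < e"
  proof (intro exI allI impI)
    fix M assume M: "M \<ge> N"
    have cm: "x - (\<lambda>n. x M) \<in> hcarrier CS"
      using x Cauchy_seq_const[OF c, of M] by (intro CS.carrier_diff) simp_all
    then have "(\<lambda>n. hnorm H ((x - (\<lambda>n. x M)) n)) \<longlonglongrightarrow> hnorm CS (x - (\<lambda>n. x M))"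
      by (intro Cauchy_seq_norm_tendsto) (simp only: cauchy_space_simps mem_Collect_eq)
    then have "hnorm CS (x - (\<lambda>n. x M)) \<le> e / 2"
      by (rule LIMSEQ_le_const2) (use N M in \<open>auto intro!: exI[of _ N] less_imp_le\<close>)
    then show "dist (hnorm CS (x - (\<lambda>n. x M))) 0 < e"
      using e CS.norm_nonneg[OF cm] by simp
  qed
qed

lemma hnorm_CS_const: "a \<in> hcarrier H \<Longrightarrow> hnorm CS (\<lambda>n. a) = hnorm H a"
  by (simp add: hnorm_def)

lemma semi_inner_space_CS: "semi_inner_space CS"
  by (rule CS.semi_inner_space_axioms)

text \<open>The diagonal argument: replace each Cauchy sequence by a constant one close to it.\<close>

lemma cauchy_space_complete:
  assumes X: "CS.Cauchy_seq X"
  obtains z where "z \<in> hcarrier CS" "(\<lambda>n. hnorm CS (X n - z)) \<longlonglongrightarrow> 0"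
proof -
  have Xc: "X n \<in> hcarrier CS" for n using X by (simp add: CS.Cauchy_seq_def)
  have "\<exists>a\<in>hcarrier H. hnorm CS (X n - (\<lambda>_. a)) < 1 / real (Suc n)" for n
  proof -
    have x: "Cauchy_seq (X n)" using Xc[of n] by simp
    have "1 / real (Suc n) > 0" by simp
    then obtain N where "hnorm CS (X n - (\<lambda>_. X n N)) < 1 / real (Suc n)"
      using LIMSEQ_D[OF Cauchy_seq_norm_diff_const[OF x]] by (metis abs_less_iff diff_zero order_refl real_norm_def)
    then show ?thesis using Cauchy_seq_carrier[OF x] by blast
  qed
  then obtain z where z: "\<And>n. z n \<in> hcarrier H" "\<And>n. hnorm CS (X n - (\<lambda>_. z n)) < 1 / real (Suc n)"
    by metis
  have kc: "(\<lambda>_. z n) \<in> hcarrier CS" for n using Cauchy_seq_const z by simp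
  have "Cauchy_seq z"
    unfolding Cauchy_seq_def
  proof (intro conjI allI impI z)
    fix e :: real assume e: "e > 0"
    obtain N1 where N1: "\<And>m n. N1 \<le> m \<Longrightarrow> N1 \<le> n \<Longrightarrow> hnorm CS (X m - X n) < e / 3"
      using X e unfolding CS.Cauchy_seq_def by (metis zero_less_divide_iff zero_less_numeral)
    obtain N2 where N2: "1 / real (Suc N2) < e / 3"
      using e by (metis nat_approx_posE zero_less_divide_iff zero_less_numeral)
    have small: "hnorm CS (X n - (\<lambda>_. z n)) < e / 3" if "n \<ge> N2" for n
    proof -
      have "1 / real (Suc n) \<le> 1 / real (Suc N2)" using that by (auto intro!: divide_left_mono)
      then show ?thesis using z(2)[of n] N2 by linarith
    qed
    show "\<exists>N. \<forall>m\<ge>N. \<forall>n\<ge>N. hnorm H (z m - z n) < e"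
    proof (intro exI allI impI)
      fix m n assume mn: "max N1 N2 \<le> m" "max N1 N2 \<le> n"
      have "hnorm H (z m - z n) = hnorm CS ((\<lambda>_. z m) - (\<lambda>_. z n))"
        using hnorm_CS_const[of "z m - z n"] z(1) by (simp add: fun_diff_def)
      also have "\<dots> \<le> hnorm CS ((\<lambda>_. z m) - X m) + hnorm CS (X m - (\<lambda>_. z n))"
        by (rule CS.norm_triangle_diff[OF kc Xc kc])
      also have "\<dots> \<le> hnorm CS ((\<lambda>_. z m) - X m) + (hnorm CS (X m - X n) + hnorm CS (X n - (\<lambda>_. z n)))"
        using CS.norm_triangle_diff[OF Xc Xc kc, of m n n] by simp
      also have "\<dots> < e / 3 + (e / 3 + e / 3)"
        using small[of m] small[of n] N1[of m n] mn CS.norm_minus_commute[OF kc Xc, of m m] by simp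
      finally show "hnorm H (z m - z n) < e" by simp
    qed
  qed
  then have zc: "z \<in> hcarrier CS" by simp
  have t: "(\<lambda>n. 1 / real (Suc n) + hnorm CS (z - (\<lambda>_. z n))) \<longlonglongrightarrow> 0"
    using tendsto_add[OF LIMSEQ_Suc[OF lim_1_over_n] Cauchy_seq_norm_diff_const[OF \<open>Cauchy_seq z\<close>]]
    by (simp del: of_nat_Suc)
  have "(\<lambda>n. hnorm CS (X n - z)) \<longlonglongrightarrow> 0"
  proof (rule tendsto_0_le_seq[OF _ t])
    show "norm (hnorm CS (X n - z)) \<le> 1 / real (Suc n) + hnorm CS (z - (\<lambda>_. z n))" for n
      using CS.norm_triangle_diff[OF Xc kc zc, of n n] CS.norm_minus_commute[OF kc zc, of n]
        z(2)[of n] CS.norm_nonneg[OF CS.carrier_diff[OF Xc zc], of n] by simp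
  qed
  with zc that show ?thesis by blast
qed

text \<open>Subtracting a constant sequence does not change the inner product with x, and suitable
  constants come arbitrarily close to x. This turns orthogonality to the given space into nullity in
  its completion.\<close>

lemma cauchy_space_null:
  assumes x: "x \<in> hcarrier CS" and o: "\<And>a. a \<in> hcarrier H \<Longrightarrow> hinner CS (\<lambda>_. a) x = 0"
  shows "hinner CS x x = 0"
proof -
  have xs: "Cauchy_seq x" using x by simp
  have kc: "(\<lambda>_. x n) \<in> hcarrier CS" for n using Cauchy_seq_const Cauchy_seq_carrier[OF xs] by simp
  have "(\<lambda>N. hinner CS x x) \<longlonglongrightarrow> 0"
  proof (rule tendsto_0_le_seq)
    show "cmod (hinner CS x x) \<le> hnorm CS (x - (\<lambda>_. x N)) * hnorm CS x" for N
    proof -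
      have "hinner CS x x = hinner CS (x - (\<lambda>_. x N)) x"
        unfolding CS.inner_diff[OF x kc x] using o Cauchy_seq_carrier[OF xs] by simp
      then show ?thesis using CS.Cauchy_Schwarz[OF CS.carrier_diff[OF x kc] x, of N] by simp
    qed
    show "(\<lambda>N. hnorm CS (x - (\<lambda>_. x N)) * hnorm CS x) \<longlonglongrightarrow> 0"
      using tendsto_mult[OF Cauchy_seq_norm_diff_const[OF xs] tendsto_const] by simp
  qed
  then show ?thesis by (simp only: LIMSEQ_const_iff)
qed

lemma null_orthogonal:
  assumes "x \<in> hcarrier H" "y \<in> hcarrier H" "hinner H x x = 0"
  shows "hinner H x y = 0" "hinner H y x = 0"
proof -
  have "hnorm H x = 0" using assms(3) by (simp add: hnorm_def)
  then show "hinner H x y = 0" "hinner H y x = 0"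
    using Cauchy_Schwarz[OF assms(1,2)] Cauchy_Schwarz[OF assms(2,1)] by simp_all
qed

end

text \<open>The quotient by null vectors, carried by the image of a map \<open>F\<close> instead of
  a type of cosets. \<open>inv_into\<close> merely picks a representative; the locale below assumes
  that \<open>F\<close> is linear and vanishes exactly on the null vectors.\<close>

definition quotient_hspace ::
  "'a::ab_group_add hspace \<Rightarrow> (complex \<Rightarrow> 'b \<Rightarrow> 'b) \<Rightarrow> ('a \<Rightarrow> 'b::ab_group_add) \<Rightarrow> 'b hspace" where
  "quotient_hspace C s F = \<lparr>hcarrier = F ` hcarrier C, hscale = s,
     hinner = \<lambda>f g. hinner C (inv_into (hcarrier C) F f) (inv_into (hcarrier C) F g)\<rparr>"

locale null_quotient = C: semi_inner_space C
  for C :: "'a::ab_group_add hspace" and s :: "complex \<Rightarrow> 'b \<Rightarrow> 'b::ab_group_add" and F :: "'a \<Rightarrow> 'b" +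
  assumes s: "vector_space s"
    and F_add: "\<And>x y. x \<in> hcarrier C \<Longrightarrow> y \<in> hcarrier C \<Longrightarrow> F (x + y) = F x + F y"
    and F_scale: "\<And>c x. x \<in> hcarrier C \<Longrightarrow> F (hscale C c x) = s c (F x)"
    and F_null: "\<And>x. x \<in> hcarrier C \<Longrightarrow> F x = 0 \<longleftrightarrow> hinner C x x = 0"
begin

abbreviation "Q \<equiv> quotient_hspace C s F"

lemma quotient_simps [simp]: "hcarrier Q = F ` hcarrier C" "hscale Q = s"
  by (simp_all add: quotient_hspace_def)

lemma F_diff: "x \<in> hcarrier C \<Longrightarrow> y \<in> hcarrier C \<Longrightarrow> F (x - y) = F x - F y"
  using F_add[of "x - y" y] by simp

text \<open>The chosen representative differs from the given vector by a null vector, which by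
  Cauchy-Schwarz is orthogonal to everything.\<close>

lemma inner_quotient:
  assumes x: "x \<in> hcarrier C" and y: "y \<in> hcarrier C"
  shows "hinner Q (F x) (F y) = hinner C x y"
proof -
  define r where "r z = inv_into (hcarrier C) F (F z)" for z
  have r: "r z \<in> hcarrier C" "hinner C (r z - z) (r z - z) = 0" if "z \<in> hcarrier C" for z
  proof -
    show rc: "r z \<in> hcarrier C" unfolding r_def using that by (intro inv_into_into) auto
    have "F (r z) = F z" unfolding r_def using that by (intro f_inv_into_f) auto
    then show "hinner C (r z - z) (r z - z) = 0" using rc that F_null[of "r z - z"] F_diff by simp
  qed
  have "hinner C (r x) (r y) = hinner C x (r y)"
    using C.null_orthogonal(1)[of "r x - x" "r y"] r[OF x] r[OF y] x by (simp add: C.inner_diff)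
  also have "\<dots> = hinner C x y"
    using C.null_orthogonal(2)[of "r y - y" x] r[OF y] x y by (simp add: C.inner_diff_right)
  finally show ?thesis by (simp add: quotient_hspace_def r_def)
qed

lemma hnorm_quotient: "x \<in> hcarrier C \<Longrightarrow> hnorm Q (F x) = hnorm C x"
  by (simp add: hnorm_def inner_quotient)

sublocale Q: pre_hilbert_space Q
proof (intro pre_hilbert_space.intro semi_inner_space.intro pre_hilbert_space_axioms.intro)
  show "vector_space (hscale Q)" using s by simp
  then interpret v: vector_space "hscale Q" .
  have F0: "F 0 = 0" using F_diff[of 0 0] by simp
  show "v.subspace (hcarrier Q)"
  proof (rule v.subspaceI)
    show "0 \<in> hcarrier Q" using F0 by (simp add: image_iff) (metis C.carrier_0)
    show "x + y \<in> hcarrier Q" if "x \<in> hcarrier Q" "y \<in> hcarrier Q" for x y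
      using that F_add by (auto simp: image_iff) (metis C.carrier_add)
    show "hscale Q c x \<in> hcarrier Q" if "x \<in> hcarrier Q" for c x
      using that F_scale by (auto simp: image_iff) (metis C.carrier_scale)
  qed
  show "hinner Q (x + y) z = hinner Q x z + hinner Q y z"
    if "x \<in> hcarrier Q" "y \<in> hcarrier Q" "z \<in> hcarrier Q" for x y z
    using that by (auto simp: inner_quotient F_add[symmetric] C.inner_add)
  show "hinner Q (hscale Q c x) y = c * hinner Q x y" if "x \<in> hcarrier Q" "y \<in> hcarrier Q" for c x y
    using that by (auto simp: inner_quotient F_scale[symmetric] C.inner_scale)
  show "hinner Q y x = cnj (hinner Q x y)" if "x \<in> hcarrier Q" "y \<in> hcarrier Q" for x y
    using that by (auto simp: inner_quotient intro: C.inner_cnj)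
  show "0 \<le> Re (hinner Q x x)" if "x \<in> hcarrier Q" for x
    using that by (auto simp: inner_quotient C.inner_nonneg)
  show "x = 0" if "x \<in> hcarrier Q" "hinner Q x x = 0" for x
    using that by (auto simp: inner_quotient F_null)
qed

text \<open>\<open>F\<close> preserves seminorms, so representatives of a Cauchy sequence form a
  Cauchy sequence, and the limit can be taken before passing to the quotient.\<close>

lemma complete_quotient:
  assumes complete: "\<And>X. C.Cauchy_seq X \<Longrightarrow> \<exists>z\<in>hcarrier C. (\<lambda>n. hnorm C (X n - z)) \<longlonglongrightarrow> 0"
  shows "complex_hilbert_space Q"
proof (rule Q.complex_hilbert_spaceI)
  fix Y assume Y: "Q.Cauchy_seq Y"
  have "\<forall>n. \<exists>x\<in>hcarrier C. Y n = F x" using Y unfolding Q.Cauchy_seq_def by auto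
  then obtain X where X: "\<And>n. X n \<in> hcarrier C" "\<And>n. Y n = F (X n)" by metis
  have "C.Cauchy_seq X"
    using Y X unfolding C.Cauchy_seq_def Q.Cauchy_seq_def
    by (simp add: F_diff[symmetric] hnorm_quotient)
  then obtain z where z: "z \<in> hcarrier C" "(\<lambda>n. hnorm C (X n - z)) \<longlonglongrightarrow> 0"
    using complete by blast
  then have "(\<lambda>n. hnorm Q (Y n - F z)) \<longlonglongrightarrow> 0"
    using X by (simp add: F_diff[symmetric] hnorm_quotient)
  with z show "\<exists>a\<in>hcarrier Q. (\<lambda>n. hnorm Q (Y n - a)) \<longlonglongrightarrow> 0" by auto
qed

end

theorem completion:
  assumes H: "semi_inner_space H" and nq: "null_quotient (cauchy_space H) s F"
  defines "K \<equiv> quotient_hspace (cauchy_space H) s F"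
    and "j \<equiv> \<lambda>a. F (\<lambda>_. a)"
  shows "complex_hilbert_space K" "hscale K = s" "linear_op H K j"
    "\<And>x y. x \<in> hcarrier H \<Longrightarrow> y \<in> hcarrier H \<Longrightarrow> hinner K (j x) (j y) = hinner H x y"
    "closed_span K (j ` hcarrier H) = hcarrier K"
proof -
  interpret H: semi_inner_space H by fact
  interpret N: null_quotient "cauchy_space H" s F by fact
  show K: "complex_hilbert_space K"
    unfolding K_def by (rule N.complete_quotient) (use H.cauchy_space_complete in metis)
  interpret K: complex_hilbert_space K by fact
  show s: "hscale K = s" by (simp add: K_def)
  have kc: "(\<lambda>_. a) \<in> hcarrier (cauchy_space H)" if "a \<in> hcarrier H" for a
    using H.Cauchy_seq_const[OF that] by simp
  show "hinner K (j x) (j y) = hinner H x y" if "x \<in> hcarrier H" "y \<in> hcarrier H" for x y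
    using N.inner_quotient[OF kc kc, of x y] that by (simp add: K_def j_def)
  show L: "linear_op H K j"
    unfolding linear_op_def
  proof (intro conjI ballI allI)
    show "j \<in> hcarrier H \<rightarrow> hcarrier K" using kc by (auto simp: K_def j_def simp del: H.cauchy_space_simps)
    show "j (x + y) = j x + j y" if "x \<in> hcarrier H" "y \<in> hcarrier H" for x y
      using N.F_add[OF kc kc, of x y] that by (simp add: j_def plus_fun_def)
    show "j (hscale H c x) = hscale K c (j x)" if "x \<in> hcarrier H" for c x
      using N.F_scale[OF kc, of x c] that by (simp add: j_def s)
  qed
  have jc: "j ` hcarrier H \<subseteq> hcarrier K" using linear_op_carrier[OF L] by auto
  show "closed_span K (j ` hcarrier H) = hcarrier K"
  proof
    show "hcarrier K \<subseteq> closed_span K (j ` hcarrier H)"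
    proof
      fix f assume "f \<in> hcarrier K"
      then obtain x where x: "x \<in> hcarrier (cauchy_space H)" "f = F x"
        by (auto simp: K_def simp del: H.cauchy_space_simps)
      have xs: "H.Cauchy_seq x" using x by simp
      note xc = H.Cauchy_seq_carrier[OF xs]
      show "f \<in> closed_span K (j ` hcarrier H)"
      proof (rule K.closed_spanI_seq[OF jc \<open>f \<in> hcarrier K\<close>])
        show "j (x n) \<in> closed_span K (j ` hcarrier H)" for n
          using K.closed_span_base[OF jc] xc by blast
        have "hnorm K (j (x n) - f) = hnorm (cauchy_space H) (x - (\<lambda>_. x n))" for n
          using N.hnorm_quotient[of "(\<lambda>_. x n) - x"] N.F_diff[OF kc[OF xc] x(1)]
            N.C.carrier_diff[OF kc[OF xc] x(1)] N.C.norm_minus_commute[OF kc[OF xc] x(1)]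
          by (simp add: K_def j_def x(2))
        then show "(\<lambda>n. hnorm K (j (x n) - f)) \<longlonglongrightarrow> 0"
          using H.Cauchy_seq_norm_diff_const[OF xs] by simp
      qed
    qed
  qed (rule K.closed_span_carrier[OF jc])
qed

section \<open>Ordered products up to phases\<close>

definition twist :: "nat \<Rightarrow> (nat \<Rightarrow> nat \<Rightarrow> complex) \<Rightarrow> (nat \<Rightarrow> int) \<Rightarrow> (nat \<Rightarrow> int) \<Rightarrow> complex" where
  "twist k lam m n = (\<Prod>i\<in>{1..k}. \<Prod>j\<in>{1..<i}. lam i j powi (m i * n j))"

definition single :: "nat \<Rightarrow> int \<Rightarrow> nat \<Rightarrow> int" where
  "single i t = (\<lambda>j. if j = i then t else 0)"

text \<open>Multi-indices are functions on all naturals, but an ordered product over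
  \<open>[1..<Suc k]\<close> applies only the exponents in {1..k}; \<open>cut\<close> clears the
  others.\<close>

definition cut :: "nat \<Rightarrow> (nat \<Rightarrow> int) \<Rightarrow> nat \<Rightarrow> int" where
  "cut k m = (\<lambda>i. if i \<in> {1..k} then m i else 0)"

lemma single_simps [simp]: "single i t i = t" "j \<noteq> i \<Longrightarrow> single i t j = 0"
  by (simp_all add: single_def)

lemma single_add: "single i (s + t) = single i s + single i t"
  by (auto simp: single_def fun_eq_iff)

lemma single_uminus: "single i (- t) = - single i t"
  by (auto simp: single_def fun_eq_iff)

lemma single_0 [simp]: "single i 0 = 0"
  by (auto simp: single_def fun_eq_iff)

text \<open>The common shape of \<open>ordered_monomial\<close>, \<open>word_op\<close> and
  \<open>zword_op\<close>, so that reordering of factors is treated once.\<close>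

definition fprod :: "('i \<Rightarrow> 'a \<Rightarrow> 'a) \<Rightarrow> 'i list \<Rightarrow> 'a \<Rightarrow> 'a" where
  "fprod P l = foldr (\<lambda>i F. P i \<circ> F) l id"

lemma fprod_simps [simp]:
  "fprod P [] x = x" "fprod P (i # l) x = P i (fprod P l x)" "fprod P (l @ l') x = fprod P l (fprod P l' x)"
proof -
  show "fprod P [] x = x" for x by (simp add: fprod_def)
  show *: "fprod P (i # l) x = P i (fprod P l x)" for i l x by (simp add: fprod_def)
  show "fprod P (l @ l') x = fprod P l (fprod P l' x)"
    by (induction l) (use * in \<open>simp_all add: fprod_def\<close>)
qed

lemma fprod_cong: "(\<And>i x. i \<in> set l \<Longrightarrow> P i x = P' i x) \<Longrightarrow> fprod P l x = fprod P' l x"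
  by (induction l) auto

lemma fprod_in: "(\<And>i x. i \<in> set l \<Longrightarrow> x \<in> V \<Longrightarrow> P i x \<in> V) \<Longrightarrow> x \<in> V \<Longrightarrow> fprod P l x \<in> V"
  by (induction l) auto

lemma fprod_map: "fprod P (map f l) x = fprod (\<lambda>i. P (f i)) l x"
  by (induction l) auto

lemma ordered_monomial_fprod: "ordered_monomial k A a = fprod (\<lambda>i. A i ^^ a i) [1..<Suc k]"
  by (simp add: ordered_monomial_def fprod_def)

lemma word_op_fprod: "word_op A w = fprod (\<lambda>(i, p). A i ^^ p) w"
  by (induction w) (auto simp: word_op_def fprod_def)

lemma zword_op_fprod: "zword_op K A w = fprod (\<lambda>(i, p). zpower K (A i) p) w"
  by (induction w) (auto simp: zword_op_def fprod_def)

locale twisting =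
  fixes k :: nat and lam :: "nat \<Rightarrow> nat \<Rightarrow> complex"
  assumes cmod_lam: "\<lbrakk>i \<in> {1..k}; j \<in> {1..k}; i \<noteq> j\<rbrakk> \<Longrightarrow> cmod (lam i j) = 1"
    and lam_swap: "\<lbrakk>i \<in> {1..k}; j \<in> {1..k}; i \<noteq> j\<rbrakk> \<Longrightarrow> lam j i = cnj (lam i j)"
begin

abbreviation "c \<equiv> twist k lam"

lemma lam_nonzero: "i \<in> {1..k} \<Longrightarrow> j \<in> {1..<i} \<Longrightarrow> lam i j \<noteq> 0"
  using cmod_lam[of i j] by force

text \<open>Together with \<open>twist_add_right\<close> this says that \<open>c\<close> is a
  bicharacter. Phase identities then reduce to field arithmetic through
  \<open>twist_simps\<close>.\<close>

lemma twist_add_left: "c (m + m') n = c m n * c m' n"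
  unfolding twist_def prod.distrib[symmetric]
  by (intro prod.cong refl) (simp add: lam_nonzero power_int_add ring_distribs)

lemma twist_add_right: "c m (n + n') = c m n * c m n'"
  unfolding twist_def prod.distrib[symmetric]
  by (intro prod.cong refl) (simp add: lam_nonzero power_int_add ring_distribs)

lemma twist_0_left [simp]: "c 0 n = 1"
  by (simp add: twist_def)

lemma twist_0_right [simp]: "c n 0 = 1"
  by (simp add: twist_def)

lemma twist_const_0 [simp]: "c (\<lambda>_. 0) n = 1" "c n (\<lambda>_. 0) = 1"
  by (simp_all add: twist_def)

lemma cmod_twist [simp]: "cmod (c m n) = 1"
proof -
  have "norm (lam i j powi (m i * n j)) = 1" if "i \<in> {1..k}" "j \<in> {1..<i}" for i j
    using that cmod_lam[of i j] by (simp add: norm_power_int)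
  then show ?thesis
    unfolding twist_def prod_norm[symmetric] by (intro prod.neutral ballI) auto
qed

lemma twist_nonzero [simp]: "c m n \<noteq> 0"
  using cmod_twist[of m n] by force

lemma cnj_twist: "cnj (c m n) = inverse (c m n)"
  using complex_norm_square[of "c m n"] by (simp add: field_simps)

lemma twist_uminus_left: "c (- m) n = inverse (c m n)"
  using twist_add_left[of m "- m" n] by (simp add: field_simps)

lemma twist_uminus_right: "c m (- n) = inverse (c m n)"
  using twist_add_right[of m n "- n"] by (simp add: field_simps)

lemma twist_diff_left: "c (m - m') n = c m n / c m' n"
  using twist_add_left[of "m - m'" m' n] by (simp add: field_simps)

lemma twist_diff_right: "c m (n - n') = c m n / c m n'"
  using twist_add_right[of m "n - n'" n'] by (simp add: field_simps)

lemmas twist_simps = twist_add_left twist_add_right twist_uminus_left twist_uminus_right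
  twist_diff_left twist_diff_right cnj_twist

lemma twist_cong:
  assumes "\<And>i. i \<in> {1..k} \<Longrightarrow> m i = m' i" "\<And>i. i \<in> {1..k} \<Longrightarrow> n i = n' i"
  shows "c m n = c m' n'"
  unfolding twist_def by (intro prod.cong refl) (use assms in auto)

lemma twist_single_left:
  assumes "i \<in> {1..k}"
  shows "c (single i t) n = (\<Prod>j\<in>{1..<i}. lam i j powi (t * n j))"
proof -
  have "c (single i t) n = (\<Prod>l\<in>{1..k}. if l = i then \<Prod>j\<in>{1..<i}. lam i j powi (t * n j) else 1)"
    unfolding twist_def by (intro prod.cong refl) (auto simp: single_def)
  then show ?thesis using assms by simp
qed

lemma twist_single_single:
  assumes "i \<in> {1..k}" "j \<in> {1..k}"
  shows "c (single i s) (single j t) = (if j < i then lam i j powi (s * t) else 1)"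
proof -
  have "c (single i s) (single j t) = (\<Prod>l\<in>{1..<i}. if l = j then lam i j powi (s * t) else 1)"
    unfolding twist_single_left[OF assms(1)] by (intro prod.cong refl) (auto simp: single_def)
  then show ?thesis using assms by simp
qed

lemma twist_single_below:
  assumes "i \<in> {1..k}" "\<And>j. j \<in> {1..<i} \<Longrightarrow> n j = 0"
  shows "c (single i t) n = 1"
  unfolding twist_single_left[OF assms(1)] by (intro prod.neutral ballI) (use assms in auto)

text \<open>The phases add up because \<open>c\<close> only sees pairs of indices in decreasing order.\<close>

lemma fprod_shift:
  assumes vs: "vector_space s" and m: "m \<in> M"
    and scale: "\<And>i m d. i \<in> {1..k} \<Longrightarrow> m \<in> M \<Longrightarrow> P i (s d (E m)) = s d (P i (E m))"
    and step: "\<And>i m. i \<in> {1..k} \<Longrightarrow> m \<in> M \<Longrightarrow> P i (E m) = s (c (single i (a i)) m) (E (m + single i (a i)))"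
    and closed: "\<And>i m. i \<in> {1..k} \<Longrightarrow> m \<in> M \<Longrightarrow> m + single i (a i) \<in> M"
  shows "fprod P [1..<Suc k] (E m) = s (c a m) (E (m + cut k a))"
    and "m + cut k a \<in> M"
proof -
  interpret vector_space s by fact
  \<comment> \<open>\<open>b j\<close> collects the exponents already applied when the factor j has
    acted, since the product acts from its right end; hence the downward induction from
    \<open>Suc k\<close>. All indices in \<open>b (Suc j)\<close> exceed j, so the next factor sees
    no phase from them.\<close>
  define b where "b j = (\<lambda>i. if j \<le> i \<and> i \<in> {1..k} then a i else 0)" for j
  define Q where "Q j \<longleftrightarrow> m + b j \<in> M \<and> fprod P [j..<Suc k] (E m) = s (c (b j) m) (E (m + b j))" for j
  have "Q j" if "j \<le> Suc k" "1 \<le> j" for j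
    using that
  proof (induction rule: inc_induct)
    case base
    have b0: "b (Suc k) = 0" by (auto simp: b_def fun_eq_iff)
    show ?case unfolding Q_def b0 twist_0_left using m by simp
  next
    case (step j)
    have j: "j \<in> {1..k}" using step by auto
    have bj: "b j = b (Suc j) + single j (a j)" using j by (auto simp: b_def fun_eq_iff single_def)
    have IH: "m + b (Suc j) \<in> M"
      "fprod P [Suc j..<Suc k] (E m) = s (c (b (Suc j)) m) (E (m + b (Suc j)))"
      using step.IH by (simp_all add: Q_def)
    have "[j..<Suc k] = j # [Suc j..<Suc k]" using step by (simp add: upt_rec del: upt_Suc)
    then have "fprod P [j..<Suc k] (E m) = P j (s (c (b (Suc j)) m) (E (m + b (Suc j))))"
      using IH(2) by (simp del: upt_Suc)
    also have "\<dots> = s (c (b (Suc j)) m * c (single j (a j)) (m + b (Suc j))) (E (m + b (Suc j) + single j (a j)))"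
      using scale[OF j IH(1)] assms(4)[OF j IH(1)] by simp
    also have "c (single j (a j)) (m + b (Suc j)) = c (single j (a j)) m"
      using twist_single_below[OF j, of "b (Suc j)"] by (simp add: twist_add_right b_def)
    also have "c (b (Suc j)) m * c (single j (a j)) m = c (b j) m"
      by (simp add: bj twist_add_left)
    also have "m + b (Suc j) + single j (a j) = m + b j" by (simp add: bj add.assoc)
    finally show ?case using closed[OF j IH(1)] by (simp add: Q_def bj add.assoc plus_fun_def del: upt_Suc)
  qed
  from this[of 1] have "m + b 1 \<in> M"
    "fprod P [1..<Suc k] (E m) = s (c (b 1) m) (E (m + b 1))" by (simp_all add: Q_def del: upt_Suc)
  moreover have "b 1 = cut k a" by (auto simp: b_def cut_def fun_eq_iff)
  moreover have "c (cut k a) m = c a m" by (rule twist_cong) (auto simp: cut_def)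
  ultimately show "fprod P [1..<Suc k] (E m) = s (c a m) (E (m + cut k a))"
    and "m + cut k a \<in> M" by simp_all
qed

text \<open>\<open>A\<close> moves inward past the factors with index j < i, picks up
  \<open>lam i j powi m j\<close> from each, and merges with the i-th factor. The collected phases
  are the product that defines \<open>c (single i 1) m\<close>. The set \<open>V\<close> confines
  the commutation rules to a carrier.\<close>

lemma fprod_insert:
  assumes vs: "vector_space s" and i: "i \<in> {1..k}" and x: "x \<in> V"
    and Vs: "\<And>d x. x \<in> V \<Longrightarrow> s d x \<in> V"
    and P: "\<And>j x. j \<in> {1..k} \<Longrightarrow> x \<in> V \<Longrightarrow> P j x \<in> V"
    and Pscale: "\<And>j x d. j \<in> {1..k} \<Longrightarrow> x \<in> V \<Longrightarrow> P j (s d x) = s d (P j x)"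
    and A: "\<And>x. x \<in> V \<Longrightarrow> A x \<in> V"
    and comm: "\<And>j x. j \<in> {1..<i} \<Longrightarrow> x \<in> V \<Longrightarrow> A (P j x) = s (lam i j powi m j) (P j (A x))"
  shows "A (fprod P [1..<Suc k] x)
    = s (c (single i 1) m) (fprod (P(i := A \<circ> P i)) [1..<Suc k] x)"
proof -
  interpret vector_space s by fact
  have V: "fprod P l x \<in> V" if "set l \<subseteq> {1..k}" "x \<in> V" for l x
    using that by (induction l) (auto intro: P)
  have sc: "fprod P l (s d x) = s d (fprod P l x)" if "set l \<subseteq> {1..k}" "x \<in> V" for l x d
    using that by (induction l) (auto simp: Pscale V)
  have move: "A (fprod P l z) = s (\<Prod>j\<leftarrow>l. lam i j powi m j) (fprod P l (A z))"
    if "set l \<subseteq> {1..<i}" "z \<in> V" for l z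
    using that
  proof (induction l)
    case (Cons j l)
    then have j: "j \<in> {1..k}" and l: "set l \<subseteq> {1..k}" using i by auto
    have "A (P j (fprod P l z)) = s (lam i j powi m j) (P j (A (fprod P l z)))"
      using Cons.prems by (intro comm V l) auto
    also have "A (fprod P l z) = s (\<Prod>j\<leftarrow>l. lam i j powi m j) (fprod P l (A z))" using Cons by auto
    also have "P j (s (\<Prod>j\<leftarrow>l. lam i j powi m j) (fprod P l (A z)))
        = s (\<Prod>j\<leftarrow>l. lam i j powi m j) (P j (fprod P l (A z)))"
      by (intro Pscale j V l A Cons.prems)
    finally show ?case by simp
  qed simp
  have split: "[1..<Suc k] = [1..<i] @ i # [Suc i..<Suc k]"
    using i by (metis atLeastAtMost_iff le_imp_less_Suc less_imp_le upt_add_eq_append upt_conv_Cons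
        le_add_diff_inverse)
  have upd: "fprod (P(i := A \<circ> P i)) l x = fprod P l x" if "i \<notin> set l" for l x
    using that by (induction l) auto
  have z: "fprod P (i # [Suc i..<Suc k]) x \<in> V" by (rule V) (use i x in auto)
  have "A (fprod P [1..<Suc k] x) = s (\<Prod>j\<leftarrow>[1..<i]. lam i j powi m j) (fprod P [1..<i] (A (fprod P (i # [Suc i..<Suc k]) x)))"
    unfolding split fprod_simps(3) by (rule move[OF _ z]) auto
  also have "(\<Prod>j\<leftarrow>[1..<i]. lam i j powi m j) = c (single i 1) m"
    unfolding twist_single_left[OF i] by (simp add: prod.distinct_set_conv_list[symmetric])
  also have "fprod P [1..<i] (A (fprod P (i # [Suc i..<Suc k]) x)) = fprod (P(i := A \<circ> P i)) [1..<Suc k] x"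
    unfolding split fprod_simps(3) by (simp add: upd del: upt_Suc)
  finally show ?thesis .
qed

end

section \<open>The kernel of a twisted commuting family\<close>

lemma linear_op_compose:
  "linear_op K L A \<Longrightarrow> linear_op H K B \<Longrightarrow> linear_op H L (\<lambda>x. A (B x))"
  unfolding linear_op_def by (simp add: Pi_iff)

lemma contraction_op_id: "contraction_op H H (\<lambda>x. x)"
  by (simp add: contraction_op_def linear_op_def)

lemma contraction_op_funpow: "contraction_op H H A \<Longrightarrow> contraction_op H H (A ^^ n)"
  by (induction n) (simp_all add: contraction_op_id contraction_op_compose comp_def id_def)

lemma contraction_op_fprod:
  "(\<And>i. i \<in> set l \<Longrightarrow> contraction_op H H (P i)) \<Longrightarrow> contraction_op H H (fprod P l)"
proof (induction l)
  case Nil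
  have "fprod P [] = (\<lambda>x. x)" by auto
  then show ?case by (simp only: contraction_op_id)
next
  case (Cons i l)
  have "fprod P (i # l) = (\<lambda>x. P i (fprod P l x))" by auto
  then show ?case
    using contraction_op_compose[of H H "P i" H "fprod P l"] Cons by simp
qed

text \<open>Used twice: for the adjoints of \<open>T\<close>, and for their multiples by r < 1,
  whose kernel is the one approximated by box sums.\<close>

locale twisted_family = twisting k lam + H: complex_hilbert_space H
  for k lam and H :: "'a::ab_group_add hspace" +
  fixes S :: "nat \<Rightarrow> 'a \<Rightarrow> 'a"
  assumes contraction: "i \<in> {1..k} \<Longrightarrow> contraction_op H H (S i)"
    and commute: "\<lbrakk>i \<in> {1..k}; j \<in> {1..k}; i \<noteq> j; x \<in> hcarrier H\<rbrakk>
      \<Longrightarrow> S i (S j x) = hscale H (lam i j) (S j (S i x))"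
begin

text \<open>Integer exponents allow differences such as \<open>p - m\<close> to be formed without
  side conditions; \<open>nat\<close> reads a negative exponent as 0, so the product rules assume
  nonnegative ones.\<close>

definition mon :: "(nat \<Rightarrow> int) \<Rightarrow> 'a \<Rightarrow> 'a" where
  "mon a = ordered_monomial k S (\<lambda>i. nat (a i))"

lemma mon_fprod: "mon a = fprod (\<lambda>i. S i ^^ nat (a i)) [1..<Suc k]"
  by (simp add: mon_def ordered_monomial_fprod)

lemma S_carrier [simp]: "i \<in> {1..k} \<Longrightarrow> x \<in> hcarrier H \<Longrightarrow> S i x \<in> hcarrier H"
  by (rule contraction_op_carrier[OF contraction])

lemma funpow_carrier [simp]: "i \<in> {1..k} \<Longrightarrow> x \<in> hcarrier H \<Longrightarrow> (S i ^^ n) x \<in> hcarrier H"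
  by (rule contraction_op_carrier[OF contraction_op_funpow[OF contraction]])

lemma contraction_mon: "contraction_op H H (mon a)"
  unfolding mon_fprod by (intro contraction_op_fprod contraction_op_funpow contraction) auto

lemmas mon_linear = contraction_op_linear[OF contraction_mon]
  and mon_carrier [simp] = contraction_op_carrier[OF contraction_mon]

lemma mon_cong: "(\<And>i. i \<in> {1..k} \<Longrightarrow> a i = b i) \<Longrightarrow> mon a x = mon b x"
  unfolding mon_fprod by (rule fprod_cong) auto

lemma mon_0 [simp]: "mon 0 x = x"
proof -
  have "fprod (\<lambda>i. S i ^^ nat (0 i)) l x = x" for l by (induction l) auto
  then show ?thesis unfolding mon_fprod .
qed

lemma funpow_scale:
  "i \<in> {1..k} \<Longrightarrow> x \<in> hcarrier H \<Longrightarrow> (S i ^^ n) (hscale H d x) = hscale H d ((S i ^^ n) x)"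
  by (rule linear_op_scale[OF contraction_op_linear[OF contraction_op_funpow[OF contraction]]])

lemma commute_funpow:
  assumes i: "i \<in> {1..k}" and j: "j \<in> {1..k}" and ij: "i \<noteq> j" and x: "x \<in> hcarrier H"
  shows "S i ((S j ^^ n) x) = hscale H (lam i j ^ n) ((S j ^^ n) (S i x))"
proof (induction n)
  case (Suc n)
  have "S i ((S j ^^ Suc n) x) = hscale H (lam i j) (S j (S i ((S j ^^ n) x)))"
    using commute[OF i j ij, of "(S j ^^ n) x"] j x by simp
  also have "\<dots> = hscale H (lam i j ^ Suc n) ((S j ^^ Suc n) (S i x))"
    unfolding Suc.IH
    using linear_op_scale[OF contraction_op_linear[OF contraction[OF j]], of "(S j ^^ n) (S i x)" "lam i j ^ n"] i j x
    by simp
  finally show ?case .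
qed simp

lemma S_mon:
  assumes i: "i \<in> {1..k}" and a: "\<And>j. j \<in> {1..k} \<Longrightarrow> 0 \<le> a j" and x: "x \<in> hcarrier H"
  shows "S i (mon a x) = hscale H (c (single i 1) a) (mon (a + single i 1) x)"
proof -
  have "S i (mon a x) = hscale H (c (single i 1) a)
      (fprod ((\<lambda>i. S i ^^ nat (a i))(i := S i \<circ> S i ^^ nat (a i))) [1..<Suc k] x)"
    unfolding mon_fprod
  proof (rule fprod_insert[where V = "hcarrier H"])
    fix j x assume j: "j \<in> {1..<i}" and x: "x \<in> hcarrier H"
    have "S i ((S j ^^ nat (a j)) x) = hscale H (lam i j ^ nat (a j)) ((S j ^^ nat (a j)) (S i x))"
      using i j by (intro commute_funpow x) auto
    moreover have "lam i j powi a j = lam i j ^ nat (a j)"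
      using a[of j] i j by (simp add: power_int_def)
    ultimately show "S i ((S j ^^ nat (a j)) x) = hscale H (lam i j powi a j) ((S j ^^ nat (a j)) (S i x))"
      by simp
  qed (use i x H.vector_space funpow_scale in auto)
  also have "fprod ((\<lambda>i. S i ^^ nat (a i))(i := S i \<circ> S i ^^ nat (a i))) [1..<Suc k] x = mon (a + single i 1) x"
    unfolding mon_fprod
  proof (rule fprod_cong)
    fix j x
    have "nat (a i + 1) = Suc (nat (a i))" using a[OF i] by simp
    then show "((\<lambda>i. S i ^^ nat (a i))(i := S i \<circ> S i ^^ nat (a i))) j x = (S j ^^ nat ((a + single i 1) j)) x"
      by (cases "j = i") auto
  qed
  finally show ?thesis .
qed

lemma funpow_mon:
  assumes i: "i \<in> {1..k}" and a: "\<And>j. j \<in> {1..k} \<Longrightarrow> 0 \<le> a j" and x: "x \<in> hcarrier H"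
  shows "(S i ^^ n) (mon a x) = hscale H (c (single i (int n)) a) (mon (a + single i (int n)) x)"
proof (induction n)
  case (Suc n)
  have 0: "0 \<le> (a + single i (int n)) j" if "j \<in> {1..k}" for j
    using a[OF that] by (simp add: single_def)
  have e: "int (Suc n) = int n + 1" by simp
  have "(S i ^^ Suc n) (mon a x) = hscale H (c (single i (int n)) a) (S i (mon (a + single i (int n)) x))"
    using linear_op_scale[OF contraction_op_linear[OF contraction[OF i]]] x Suc
    by (simp add: plus_fun_def)
  also have "\<dots> = hscale H (c (single i (int n)) a * c (single i 1) (a + single i (int n)))
      (mon (a + single i (int n) + single i 1) x)"
    using x by (subst S_mon[OF i 0 x]) simp_all
  also have "c (single i (int n)) a * c (single i 1) (a + single i (int n)) = c (single i (int (Suc n))) a"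
    unfolding e single_add by (simp add: twist_simps twist_single_single[OF i i])
  also have "a + single i (int n) + single i 1 = a + single i (int (Suc n))"
    unfolding e single_add by (simp only: add.assoc)
  finally show ?case .
qed simp

lemma mon_mon:
  assumes a: "\<And>j. j \<in> {1..k} \<Longrightarrow> 0 \<le> a j" and b: "\<And>j. j \<in> {1..k} \<Longrightarrow> 0 \<le> b j" and x: "x \<in> hcarrier H"
  shows "mon a (mon b x) = hscale H (c a b) (mon (a + b) x)"
proof -
  have "mon a (mon b x) = fprod (\<lambda>i. S i ^^ nat (a i)) [1..<Suc k] (mon b x)"
    by (simp only: mon_fprod[of a])
  also have "\<dots> = hscale H (c a b) (mon (b + cut k a) x)"
  proof (rule fprod_shift[where M = "{b. \<forall>j\<in>{1..k}. 0 \<le> b j}" and E = "\<lambda>b. mon b x"])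
    fix i and m :: "nat \<Rightarrow> int" assume i: "i \<in> {1..k}" and m: "m \<in> {b. \<forall>j\<in>{1..k}. 0 \<le> b j}"
    show "(S i ^^ nat (a i)) (hscale H d (mon m x)) = hscale H d ((S i ^^ nat (a i)) (mon m x))" for d
      by (rule funpow_scale[OF i]) (use x in simp)
    show "(S i ^^ nat (a i)) (mon m x) = hscale H (c (single i (a i)) m) (mon (m + single i (a i)) x)"
      using funpow_mon[OF i _ x, of m "nat (a i)"] m a[OF i] by simp
    show "m + single i (a i) \<in> {b. \<forall>j\<in>{1..k}. 0 \<le> b j}"
      using m a[OF i] by (auto simp: single_def)
  qed (use H.vector_space b in auto)
  also have "mon (b + cut k a) x = mon (a + b) x"
    by (rule mon_cong) (simp add: cut_def)
  finally show ?thesis .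
qed

text \<open>\<open>\<lambda>p. D p m h\<close> plays the role of the coordinate family of
  \<open>E m h\<close> in a model indexed by all multi-indices p, with the defect form as inner
  product at each p. Coordinates that are not above m vanish.\<close>

definition D :: "(nat \<Rightarrow> int) \<Rightarrow> (nat \<Rightarrow> int) \<Rightarrow> 'a \<Rightarrow> 'a" where
  "D p m h = (if \<forall>i\<in>{1..k}. m i \<le> p i then hscale H (cnj (c p m)) (mon (p - m) h) else 0)"

lemma D_le: "(\<And>i. i \<in> {1..k} \<Longrightarrow> m i \<le> p i) \<Longrightarrow> D p m h = hscale H (cnj (c p m)) (mon (p - m) h)"
  by (simp add: D_def)

lemma D_carrier [simp]: "h \<in> hcarrier H \<Longrightarrow> D p m h \<in> hcarrier H"
  by (simp add: D_def)

lemma D_linear: "linear_op H H (D p m)"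
  unfolding linear_op_def D_def
  by (auto simp: linear_op_add[OF mon_linear] linear_op_scale[OF mon_linear] H.vs.scale_right_distrib
      H.vs.scale_left_commute)

text \<open>The phase does not depend on \<open>m\<close>: this is what makes \<open>D\<close> usable as a Poisson kernel.\<close>

lemma D_add:
  assumes a: "\<And>i. i \<in> {1..k} \<Longrightarrow> 0 \<le> a i" and m: "\<And>i. i \<in> {1..k} \<Longrightarrow> m i \<le> s i"
    and h: "h \<in> hcarrier H"
  shows "D (s + a) m h = hscale H (cnj (c a s)) (mon a (D s m h))"
proof -
  have "mon a (D s m h) = hscale H (cnj (c s m) * c a (s - m)) (mon (a + (s - m)) h)"
  proof -
    have "D s m h = hscale H (cnj (c s m)) (mon (s - m) h)" by (rule D_le) (rule m)
    moreover have "mon a (mon (s - m) h) = hscale H (c a (s - m)) (mon (a + (s - m)) h)"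
      by (rule mon_mon[OF a _ h]) (simp_all add: m)
    ultimately show ?thesis using h by (simp add: linear_op_scale[OF mon_linear])
  qed
  moreover have "D (s + a) m h = hscale H (cnj (c (s + a) m)) (mon (s + a - m) h)"
    using a m by (intro D_le) (simp add: add_increasing2)
  moreover have "mon (s + a - m) h = mon (a + (s - m)) h" by (rule mon_cong) simp
  ultimately show ?thesis by (simp add: twist_simps field_simps)
qed

text \<open>With \<open>s = sup m n\<close>, the exponents \<open>s - m\<close> and
  \<open>s - n\<close> are the positive and the negative part of \<open>n - m\<close>. Up to phases
  the entry is therefore the one that (ii) prescribes.\<close>

definition ker :: "(nat \<Rightarrow> int) \<Rightarrow> 'a \<Rightarrow> (nat \<Rightarrow> int) \<Rightarrow> 'a \<Rightarrow> complex" where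
  "ker m h n g = hinner H (D (sup m n) m h) (D (sup m n) n g)"

lemma ker_cnj: "h \<in> hcarrier H \<Longrightarrow> g \<in> hcarrier H \<Longrightarrow> ker n g m h = cnj (ker m h n g)"
  unfolding ker_def sup_commute[of n m] by (rule H.inner_cnj) simp_all

lemma ker_cong:
  assumes "\<And>i. i \<in> {1..k} \<Longrightarrow> m i = m' i" "\<And>i. i \<in> {1..k} \<Longrightarrow> n i = n' i"
  shows "ker m h n g = ker m' h n' g"
proof -
  have D: "D p m x = D p' m' x" if "\<And>i. i \<in> {1..k} \<Longrightarrow> m i = m' i" "\<And>i. i \<in> {1..k} \<Longrightarrow> p i = p' i"
    for p m p' m' x
  proof -
    have "mon (p - m) x = mon (p' - m') x" by (rule mon_cong) (simp add: that)
    moreover have "c p m = c p' m'" by (rule twist_cong) (use that in auto)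
    ultimately show ?thesis unfolding D_def using that by simp
  qed
  have "D (sup m n) m h = D (sup m' n') m' h" "D (sup m n) n g = D (sup m' n') n' g"
    by (rule D, auto simp: assms)+
  then show ?thesis by (simp add: ker_def)
qed

lemma ker_same:
  assumes "h \<in> hcarrier H" "g \<in> hcarrier H"
  shows "ker m h m g = hinner H h g"
  using assms by (simp add: ker_def D_le H.inner_scale H.inner_scale_right cnj_twist)

text \<open>Translation leaves \<open>s - m\<close> and \<open>s - n\<close> unchanged, so only
  phases appear. For b = \<open>single i 1\<close> they are exactly compensated by the factors in E
  m h \<mapsto> c(e_i, m) E (m + e_i) h, which makes this map isometric.\<close>

lemma ker_shift:
  assumes "h \<in> hcarrier H" "g \<in> hcarrier H"
  shows "ker (m + b) h (n + b) g = cnj (c b m) * c b n * ker m h n g"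
proof -
  have D: "D (p + b) (m + b) h = hscale H (cnj (c p b * c b m * c b b)) (D p m h)"
    if "\<And>i. i \<in> {1..k} \<Longrightarrow> m i \<le> p i" "h \<in> hcarrier H" for p m h
  proof -
    have "D (p + b) (m + b) h = hscale H (cnj (c (p + b) (m + b))) (mon (p + b - (m + b)) h)"
      by (rule D_le) (use that in simp)
    moreover have "mon (p + b - (m + b)) h = mon (p - m) h" by (rule mon_cong) simp
    moreover have "cnj (c (p + b) (m + b)) = cnj (c p b * c b m * c b b) * cnj (c p m)"
      by (simp add: twist_simps)
    ultimately show ?thesis using D_le[of m p h] that by simp
  qed
  have s: "sup (m + b) (n + b) = sup m n + b" by (auto simp: fun_eq_iff sup_int_def)
  have "D (sup m n + b) (m + b) h = hscale H (cnj (c (sup m n) b * c b m * c b b)) (D (sup m n) m h)"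
    "D (sup m n + b) (n + b) g = hscale H (cnj (c (sup m n) b * c b n * c b b)) (D (sup m n) n g)"
    by (rule D, simp, rule assms)+
  then show ?thesis
    unfolding ker_def s
    using assms by (simp add: H.inner_scale H.inner_scale_right cnj_twist) (simp add: field_simps)
qed

text \<open>If \<open>m i \<le> n i\<close>, raising n at i raises the supremum at i as well: the
  monomial on g stays the same and the one on h gains a factor S_i. With m i = 0 this yields the
  adjoint of \<open>V i\<close> on \<open>E m h\<close>.\<close>

lemma ker_raise:
  assumes i: "i \<in> {1..k}" and mn: "m i \<le> n i" and h: "h \<in> hcarrier H" and g: "g \<in> hcarrier H"
  shows "ker (n + single i 1) g m h
    = cnj (c (single i 1) n) * c (single i 1) m * cnj (c m (single i 1)) * ker n g m (S i h)"
proof -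
  let ?e = "single i 1" and ?s = "sup n m"
  have s: "sup (n + ?e) m = ?s + ?e"
    using mn by (auto simp: fun_eq_iff sup_int_def single_def)
  have 1: "D (?s + ?e) (n + ?e) g = hscale H (cnj (c ?s ?e * c ?e n)) (D ?s n g)"
  proof -
    have "mon (?s + ?e - (n + ?e)) g = mon (?s - n) g" by (rule mon_cong) simp
    then show ?thesis using g by (simp add: D_le twist_simps twist_single_single[OF i i] field_simps)
  qed
  \<comment> \<open>The new factor is placed at the right end, next to h, where
    \<open>mon_mon\<close> supplies its phase.\<close>
  have 2: "D (?s + ?e) m h = hscale H (cnj (c ?e m * c (?s - m) ?e)) (D ?s m (S i h))"
  proof -
    have "mon (?s - m) (S i h) = mon (?s - m) (mon ?e h)"
      using S_mon[OF i _ h, of 0] by simp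
    also have "\<dots> = hscale H (c (?s - m) ?e) (mon (?s - m + ?e) h)"
      by (rule mon_mon[OF _ _ h]) (auto simp: single_def)
    finally have 3: "mon (?s - m) (S i h) = hscale H (c (?s - m) ?e) (mon (?s - m + ?e) h)" .
    have 4: "mon (?s + ?e - m) h = mon (?s - m + ?e) h" by (rule mon_cong) simp
    have "D (?s + ?e) m h = hscale H (cnj (c (?s + ?e) m)) (mon (?s + ?e - m) h)"
      by (rule D_le) (simp add: single_def sup_int_def max_def)
    moreover have "D ?s m (S i h) = hscale H (cnj (c ?s m)) (mon (?s - m) (S i h))"
      by (rule D_le) simp
    ultimately show ?thesis unfolding 3 4 by (simp add: twist_simps field_simps)
  qed
  show ?thesis
    unfolding ker_def s 1 2 using i h g
    by (simp add: H.inner_scale H.inner_scale_right twist_simps field_simps)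
qed

lemma ker_add_left:
  assumes "h \<in> hcarrier H" "h' \<in> hcarrier H" "g \<in> hcarrier H"
  shows "ker m (h + h') n g = ker m h n g + ker m h' n g"
  using assms by (simp add: ker_def linear_op_add[OF D_linear] H.inner_add)

lemma ker_scale_left:
  assumes "h \<in> hcarrier H" "g \<in> hcarrier H"
  shows "ker m (hscale H d h) n g = d * ker m h n g"
  using assms by (simp add: ker_def linear_op_scale[OF D_linear] H.inner_scale)

end

section \<open>Positivity of the kernel\<close>

text \<open>The form \<open>(h, g) \<mapsto> \<langle>(id - \<Phi>\<^bsub>i\<^sub>1\<^esub>) \<circ> \<cdots> \<circ> (id - \<Phi>\<^bsub>i\<^sub>n\<^esub>)(I) h, g\<rangle>\<close> written in terms
  of the adjoints \<open>R i\<close>.\<close>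

primrec defect_form ::
  "'a::ab_group_add hspace \<Rightarrow> (nat \<Rightarrow> 'a \<Rightarrow> 'a) \<Rightarrow> nat list \<Rightarrow> 'a \<Rightarrow> 'a \<Rightarrow> complex" where
  "defect_form H R [] h g = hinner H h g"
| "defect_form H R (i # l) h g = defect_form H R l h g - defect_form H R l (R i h) (R i g)"

lemma sum_PiE_insert:
  assumes "i \<notin> I"
  shows "(\<Sum>a\<in>Pi\<^sub>E (insert i I) B. f a) = (\<Sum>t\<in>B i. \<Sum>a\<in>Pi\<^sub>E I B. f (a(i := t)))"
proof -
  have "(\<Sum>a\<in>Pi\<^sub>E (insert i I) B. f a) = (\<Sum>(t, a)\<in>B i \<times> Pi\<^sub>E I B. f (a(i := t)))"
    unfolding PiE_insert_eq
    by (subst sum.reindex[OF inj_combinator[OF assms]]) (simp add: case_prod_unfold comp_def)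
  then show ?thesis by (simp add: sum.cartesian_product)
qed

section \<open>Sesquilinearity of the defect form\<close>

context complex_hilbert_space
begin

lemma defect_form_scale:
  assumes R: "\<And>i. i \<in> set l \<Longrightarrow> linear_op H H (R i)" and "h \<in> hcarrier H" "g \<in> hcarrier H"
  shows "defect_form H R l (hscale H d h) (hscale H e g) = d * cnj e * defect_form H R l h g"
  using assms
proof (induction l arbitrary: h g)
  case (Cons i l)
  then have "R i h \<in> hcarrier H" "R i g \<in> hcarrier H"
    by (meson linear_op_carrier list.set_intros(1))+
  with Cons show ?case
    by (simp add: linear_op_scale[of H H "R i"] algebra_simps)
qed (simp add: inner_scale inner_scale_right)

text \<open>Turns a double sum of values of the form into its value at one vector, where positivity
  can be used.\<close>

lemma defect_form_sum:
  assumes R: "\<And>i. i \<in> set l \<Longrightarrow> linear_op H H (R i)"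
    and "\<And>m. m \<in> A \<Longrightarrow> u m \<in> hcarrier H" "\<And>n. n \<in> B \<Longrightarrow> v n \<in> hcarrier H"
  shows "defect_form H R l (sum u A) (sum v B) = (\<Sum>m\<in>A. \<Sum>n\<in>B. defect_form H R l (u m) (v n))"
  using assms
proof (induction l arbitrary: u v)
  case Nil
  then show ?case by (simp add: inner_sum inner_sum_right carrier_sum) (rule sum.swap)
next
  case (Cons i l)
  have i: "linear_op H H (R i)" using Cons.prems by simp
  have "defect_form H R l (sum u A) (sum v B) = (\<Sum>m\<in>A. \<Sum>n\<in>B. defect_form H R l (u m) (v n))"
    using Cons by simp
  moreover have "defect_form H R l (\<Sum>m\<in>A. R i (u m)) (\<Sum>n\<in>B. R i (v n))
      = (\<Sum>m\<in>A. \<Sum>n\<in>B. defect_form H R l (R i (u m)) (R i (v n)))"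
    using Cons.prems linear_op_carrier[OF i] by (intro Cons.IH) auto
  ultimately show ?case
    using linear_op_sum[OF i semi_inner_space_axioms, of A u]
      linear_op_sum[OF i semi_inner_space_axioms, of B v] Cons.prems
    by (simp add: sum_subtractf)
qed

lemma defect_form_0:
  assumes R: "\<And>i. i \<in> set l \<Longrightarrow> linear_op H H (R i)" and "u \<in> hcarrier H"
  shows "defect_form H R l 0 u = 0" "defect_form H R l u 0 = 0"
  using defect_form_scale[where d = 0 and e = 1 and h = 0 and g = u, OF R carrier_0 assms(2)]
    defect_form_scale[where d = 1 and e = 0 and h = u and g = 0, OF R assms(2) carrier_0]
  by simp_all

end

text \<open>The uniform factor r < 1 makes the powers of each single operator decay, which is what
  removes the remainder of the telescoping sums.\<close>

locale strict_contractions = complex_hilbert_space H for H :: "'a::ab_group_add hspace" +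
  fixes R :: "nat \<Rightarrow> 'a \<Rightarrow> 'a" and r :: real and I :: "nat set"
  assumes r: "0 \<le> r" "r < 1"
    and R_linear: "i \<in> I \<Longrightarrow> linear_op H H (R i)"
    and R_norm: "i \<in> I \<Longrightarrow> x \<in> hcarrier H \<Longrightarrow> hnorm H (R i x) \<le> r * hnorm H x"
begin

lemma R_carrier [simp]: "i \<in> I \<Longrightarrow> x \<in> hcarrier H \<Longrightarrow> R i x \<in> hcarrier H"
  by (rule linear_op_carrier[OF R_linear])

lemma R_contraction: "i \<in> I \<Longrightarrow> x \<in> hcarrier H \<Longrightarrow> hnorm H (R i x) \<le> hnorm H x"
  using R_norm[of i x] mult_right_mono[of r 1 "hnorm H x"] r by fastforce

lemma funpow_carrier [simp]: "i \<in> I \<Longrightarrow> x \<in> hcarrier H \<Longrightarrow> (R i ^^ t) x \<in> hcarrier H"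
  by (induction t) auto

lemma fprod_carrier [simp]:
  "set l \<subseteq> I \<Longrightarrow> x \<in> hcarrier H \<Longrightarrow> fprod (\<lambda>i. R i ^^ a i) l x \<in> hcarrier H"
  by (induction l) auto

lemma funpow_norm: "i \<in> I \<Longrightarrow> x \<in> hcarrier H \<Longrightarrow> hnorm H ((R i ^^ t) x) \<le> r ^ t * hnorm H x"
proof (induction t)
  case (Suc t)
  then have "hnorm H (R i ((R i ^^ t) x)) \<le> r * hnorm H ((R i ^^ t) x)" by (intro R_norm) auto
  also have "\<dots> \<le> r * (r ^ t * hnorm H x)" using Suc r by (intro mult_left_mono) auto
  finally show ?case by (simp add: mult.assoc)
qed simp

text \<open>The expanded form has \<open>2 ^ length l\<close> terms, each controlled by
  Cauchy-Schwarz and contractivity.\<close>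

lemma defect_form_bound:
  assumes "set l \<subseteq> I" "h \<in> hcarrier H" "g \<in> hcarrier H"
  shows "cmod (defect_form H R l h g) \<le> 2 ^ length l * (hnorm H h * hnorm H g)"
  using assms
proof (induction l arbitrary: h g)
  case Nil
  then show ?case by (simp add: Cauchy_Schwarz)
next
  case (Cons i l)
  have i: "i \<in> I" using Cons.prems by simp
  let ?B = "2 ^ length l * (hnorm H h * hnorm H g)"
  have "cmod (defect_form H R l (R i h) (R i g)) \<le> 2 ^ length l * (hnorm H (R i h) * hnorm H (R i g))"
    using Cons by auto
  also have "\<dots> \<le> ?B"
    using Cons.prems i by (intro mult_left_mono mult_mono R_contraction) auto
  finally have "cmod (defect_form H R l (R i h) (R i g)) \<le> ?B" .
  moreover have "cmod (defect_form H R l h g) \<le> ?B" using Cons by auto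
  ultimately show ?case
    using norm_triangle_ineq4[of "defect_form H R l h g" "defect_form H R l (R i h) (R i g)"] by simp
qed

lemma fprod_upd:
  "i \<notin> set l \<Longrightarrow> fprod (\<lambda>j. R j ^^ (a(i := t)) j) l x = fprod (\<lambda>j. R j ^^ a j) l x"
  by (rule fprod_cong) auto

text \<open>One geometric series of ratio r^2 for each index, since both norms decay. The bound does
  not involve the side lengths \<open>M\<close>, so it survives when the box grows.\<close>

lemma box_norm_sum:
  assumes "distinct l" "set l \<subseteq> I" "h \<in> hcarrier H" "g \<in> hcarrier H"
  shows "(\<Sum>a\<in>Pi\<^sub>E (set l) (\<lambda>i. {..<M i}). hnorm H (fprod (\<lambda>i. R i ^^ a i) l h) * hnorm H (fprod (\<lambda>i. R i ^^ a i) l g))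
    \<le> (1 / (1 - r\<^sup>2)) ^ length l * (hnorm H h * hnorm H g)"
  using assms
proof (induction l)
  case (Cons i l)
  let ?f = "\<lambda>a x. fprod (\<lambda>i. R i ^^ a i) l x"
  let ?S = "\<Sum>a\<in>Pi\<^sub>E (set l) (\<lambda>i. {..<M i}). hnorm H (?f a h) * hnorm H (?f a g)"
  let ?B = "(1 / (1 - r\<^sup>2)) ^ length l * (hnorm H h * hnorm H g)"
  have i: "i \<in> I" "i \<notin> set l" and l: "set l \<subseteq> I" using Cons.prems by auto
  have IH: "?S \<le> ?B" using Cons by simp
  have r2: "0 \<le> r\<^sup>2" "r\<^sup>2 < 1" using r by (auto simp: power_less_one_iff abs_square_less_1)
  have B: "0 \<le> ?B" using r2 Cons.prems by simp
  have geo: "(\<Sum>t<n. (r\<^sup>2) ^ t) \<le> 1 / (1 - r\<^sup>2)" for n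
    using r2 by (simp add: sum_gp_strict divide_right_mono)
  have "(\<Sum>a\<in>Pi\<^sub>E (set (i # l)) (\<lambda>i. {..<M i}).
      hnorm H (fprod (\<lambda>i. R i ^^ a i) (i # l) h) * hnorm H (fprod (\<lambda>i. R i ^^ a i) (i # l) g))
    = (\<Sum>t<M i. \<Sum>a\<in>Pi\<^sub>E (set l) (\<lambda>i. {..<M i}). hnorm H ((R i ^^ t) (?f a h)) * hnorm H ((R i ^^ t) (?f a g)))"
    unfolding list.set(2) sum_PiE_insert[OF i(2)]
    by (simp add: fprod_upd[OF i(2)] del: fun_upd_apply) (simp)
  also have "\<dots> \<le> (\<Sum>t<M i. \<Sum>a\<in>Pi\<^sub>E (set l) (\<lambda>i. {..<M i}). (r\<^sup>2) ^ t * (hnorm H (?f a h) * hnorm H (?f a g)))"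
  proof (intro sum_mono)
    fix t a
    have "hnorm H ((R i ^^ t) (?f a h)) * hnorm H ((R i ^^ t) (?f a g))
      \<le> (r ^ t * hnorm H (?f a h)) * (r ^ t * hnorm H (?f a g))"
      using i l Cons.prems r by (intro mult_mono funpow_norm) auto
    then show "hnorm H ((R i ^^ t) (?f a h)) * hnorm H ((R i ^^ t) (?f a g))
      \<le> (r\<^sup>2) ^ t * (hnorm H (?f a h) * hnorm H (?f a g))"
      by (simp add: power_mult[symmetric] power2_eq_square power_mult_distrib algebra_simps)
  qed
  also have "\<dots> = (\<Sum>t<M i. (r\<^sup>2) ^ t) * ?S"
    by (simp only: sum_distrib_left[symmetric] sum_distrib_right[symmetric])
  also have "\<dots> \<le> (\<Sum>t<M i. (r\<^sup>2) ^ t) * ?B"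
    using IH r2 by (intro mult_left_mono sum_nonneg) auto
  also have "\<dots> \<le> 1 / (1 - r\<^sup>2) * ?B"
    using geo B by (intro mult_right_mono) auto
  finally show ?case by (simp add: algebra_simps)
qed simp

text \<open>The recursive clause of \<open>defect_form\<close> for \<open>i # l\<close> is precisely
  a difference of consecutive terms.\<close>

lemma defect_form_telescope:
  assumes i: "i \<in> I" and l: "set l \<subseteq> I" and u: "u \<in> hcarrier H" "v \<in> hcarrier H"
  shows "(\<Sum>t<n. defect_form H R (i # l) ((R i ^^ t) u) ((R i ^^ t) v))
    = defect_form H R l u v - defect_form H R l ((R i ^^ n) u) ((R i ^^ n) v)"
  by (induction n) simp_all

text \<open>Telescoping in direction i leaves the sum for the remaining indices minus a boundary
  term. The sides may differ with i, because the boxes are later obtained from a common one by a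
  translation by \<open>sup m n\<close>.\<close>

lemma defect_form_box_tendsto:
  assumes "distinct l" "set l \<subseteq> I" "h \<in> hcarrier H" "g \<in> hcarrier H"
    and M: "\<And>i. i \<in> set l \<Longrightarrow> filterlim (M i) at_top sequentially"
  shows "(\<lambda>N. \<Sum>a\<in>Pi\<^sub>E (set l) (\<lambda>i. {..<M i N}).
      defect_form H R l (fprod (\<lambda>i. R i ^^ a i) l h) (fprod (\<lambda>i. R i ^^ a i) l g)) \<longlonglongrightarrow> hinner H h g"
  using assms
proof (induction l)
  case (Cons i l)
  let ?f = "\<lambda>a x. fprod (\<lambda>i. R i ^^ a i) l x"
  let ?P = "\<lambda>N. Pi\<^sub>E (set l) (\<lambda>i. {..<M i N})"
  have i: "i \<in> I" "i \<notin> set l" and l: "set l \<subseteq> I" using Cons.prems by auto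
  \<comment> \<open>The boundary face at exponent \<open>M i N\<close>: it carries the factor (r^2)
    ^ M i N, and \<open>box_norm_sum\<close> bounds what is left.\<close>
  let ?rest = "\<lambda>N. \<Sum>a\<in>?P N. defect_form H R l ((R i ^^ M i N) (?f a h)) ((R i ^^ M i N) (?f a g))"
  have eq: "(\<Sum>a\<in>Pi\<^sub>E (set (i # l)) (\<lambda>i. {..<M i N}).
      defect_form H R (i # l) (fprod (\<lambda>i. R i ^^ a i) (i # l) h) (fprod (\<lambda>i. R i ^^ a i) (i # l) g))
    = (\<Sum>a\<in>?P N. defect_form H R l (?f a h) (?f a g)) - ?rest N" for N
  proof -
    have "(\<Sum>a\<in>Pi\<^sub>E (set (i # l)) (\<lambda>i. {..<M i N}).
        defect_form H R (i # l) (fprod (\<lambda>i. R i ^^ a i) (i # l) h) (fprod (\<lambda>i. R i ^^ a i) (i # l) g))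
      = (\<Sum>t<M i N. \<Sum>a\<in>?P N. defect_form H R (i # l) ((R i ^^ t) (?f a h)) ((R i ^^ t) (?f a g)))"
      unfolding list.set(2) sum_PiE_insert[OF i(2)] fprod_simps(2) fprod_upd[OF i(2)]
      by (simp only: fun_upd_same)
    also have "\<dots> = (\<Sum>a\<in>?P N. \<Sum>t<M i N. defect_form H R (i # l) ((R i ^^ t) (?f a h)) ((R i ^^ t) (?f a g)))"
      by (rule sum.swap)
    also have "\<dots> = (\<Sum>a\<in>?P N. defect_form H R l (?f a h) (?f a g)
        - defect_form H R l ((R i ^^ M i N) (?f a h)) ((R i ^^ M i N) (?f a g)))"
      using i l Cons.prems by (intro sum.cong refl defect_form_telescope) auto
    finally show ?thesis by (simp add: sum_subtractf)
  qed
  have r2: "0 \<le> r\<^sup>2" "r\<^sup>2 < 1" using r by (auto simp: power_less_one_iff abs_square_less_1)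
  let ?C = "2 ^ length l * ((1 / (1 - r\<^sup>2)) ^ length l * (hnorm H h * hnorm H g))"
  have "?rest \<longlonglongrightarrow> 0"
  proof (rule tendsto_0_le_seq)
    fix N
    have "cmod (?rest N) \<le> (\<Sum>a\<in>?P N. 2 ^ length l * ((r\<^sup>2) ^ M i N * (hnorm H (?f a h) * hnorm H (?f a g))))"
    proof (rule order_trans[OF norm_sum], rule sum_mono)
      fix a
      have "cmod (defect_form H R l ((R i ^^ M i N) (?f a h)) ((R i ^^ M i N) (?f a g)))
        \<le> 2 ^ length l * (hnorm H ((R i ^^ M i N) (?f a h)) * hnorm H ((R i ^^ M i N) (?f a g)))"
        using i l Cons.prems by (intro defect_form_bound) auto
      also have "\<dots> \<le> 2 ^ length l * ((r ^ M i N * hnorm H (?f a h)) * (r ^ M i N * hnorm H (?f a g)))"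
        using i l Cons.prems r by (intro mult_left_mono mult_mono funpow_norm) auto
      also have "\<dots> = 2 ^ length l * ((r\<^sup>2) ^ M i N * (hnorm H (?f a h) * hnorm H (?f a g)))"
        by (simp add: power_mult[symmetric] power2_eq_square power_mult_distrib algebra_simps)
      finally show "cmod (defect_form H R l ((R i ^^ M i N) (?f a h)) ((R i ^^ M i N) (?f a g))) \<le> \<dots>" .
    qed
    also have "\<dots> = 2 ^ length l * ((r\<^sup>2) ^ M i N * (\<Sum>a\<in>?P N. hnorm H (?f a h) * hnorm H (?f a g)))"
      by (simp add: sum_distrib_left)
    also have "\<dots> \<le> 2 ^ length l * ((r\<^sup>2) ^ M i N * ((1 / (1 - r\<^sup>2)) ^ length l * (hnorm H h * hnorm H g)))"
      using Cons.prems l r2 by (intro mult_left_mono box_norm_sum) auto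
    finally show "cmod (?rest N) \<le> ?C * (r\<^sup>2) ^ M i N" by (simp add: algebra_simps)
  next
    have "(\<lambda>N. (r\<^sup>2) ^ M i N) \<longlonglongrightarrow> 0"
      using Cons.prems r2 by (intro filterlim_compose[OF LIMSEQ_power_zero, of _ "M i"]) auto
    then show "(\<lambda>N. ?C * (r\<^sup>2) ^ M i N) \<longlonglongrightarrow> 0"
      using tendsto_mult[OF tendsto_const] by fastforce
  qed
  moreover have "(\<lambda>N. \<Sum>a\<in>?P N. defect_form H R l (?f a h) (?f a g)) \<longlonglongrightarrow> hinner H h g"
    using Cons by simp
  ultimately show ?case
    unfolding eq using tendsto_diff by fastforce
qed simp

end

text \<open>The kernel is a limit of sums over \<open>p\<close> of Gram matrices of the \<open>D p m\<close> in the positive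
  defect form.\<close>

lemma (in twisted_family) ker_positive_strict:
  assumes r: "0 \<le> r" "r < 1"
    and S_norm: "\<And>i x. i \<in> {1..k} \<Longrightarrow> x \<in> hcarrier H \<Longrightarrow> hnorm H (S i x) \<le> r * hnorm H x"
    and pos: "\<And>x. x \<in> hcarrier H \<Longrightarrow> 0 \<le> Re (defect_form H S [1..<Suc k] x x)"
    and A: "finite A" and x: "\<And>m. m \<in> A \<Longrightarrow> x m \<in> hcarrier H"
  shows "0 \<le> Re (\<Sum>m\<in>A. \<Sum>n\<in>A. ker m (x m) n (x n))"
proof -
  interpret R: strict_contractions H S r "{1..k}"
    by (intro strict_contractions.intro strict_contractions_axioms.intro H.complex_hilbert_space_axioms
        r S_norm contraction_op_linear[OF contraction])
  let ?l = "[1..<Suc k]"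
  have l: "distinct ?l" "set ?l = {1..k}" "set ?l \<subseteq> {1..k}" by auto
  have lin: "linear_op H H (S i)" if "i \<in> set ?l" for i
    using that by (intro contraction_op_linear[OF contraction]) auto
  \<comment> \<open>The box does not depend on m and n; only so can the sums over m and n later be
    pulled inside the sum over p.\<close>
  define box :: "nat \<Rightarrow> (nat \<Rightarrow> int) set" where "box N = Pi\<^sub>E {1..k} (\<lambda>_. {- int N..<int N})" for N
  define F where "F N m n = (\<Sum>p\<in>box N. defect_form H S ?l (D p m (x m)) (D p n (x n)))" for N m n
  have lim: "(\<lambda>N. F N m n) \<longlonglongrightarrow> ker m (x m) n (x n)" if m: "m \<in> A" and n: "n \<in> A" for m n
  proof -
    define s where "s = sup m n"
    \<comment> \<open>Under p = s + a the bound p i < N becomes a i < N - s i.\<close>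
    define M where "M i N = nat (int N - s i)" for i N
    let ?f = "\<lambda>a. fprod (\<lambda>i. S i ^^ a i) ?l"
    let ?G = "\<lambda>N. \<Sum>a\<in>Pi\<^sub>E (set ?l) (\<lambda>i. {..<M i N}). defect_form H S ?l (?f a (D s m (x m))) (?f a (D s n (x n)))"
    have "?G \<longlonglongrightarrow> hinner H (D s m (x m)) (D s n (x n))"
    proof (rule R.defect_form_box_tendsto[OF l(1,3)])
      show "filterlim (M i) at_top sequentially" for i
        unfolding M_def filterlim_at_top
      proof
        fix Z
        show "\<forall>\<^sub>F N in sequentially. Z \<le> nat (int N - s i)"
          unfolding eventually_sequentially by (rule exI[of _ "Z + nat (s i)"]) auto
      qed
    qed (use x m n in auto)
    moreover have "\<forall>\<^sub>F N in sequentially. ?G N = F N m n"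
      unfolding eventually_sequentially
    proof (intro exI allI impI)
      \<comment> \<open>The sum is a crude bound for all - s i at once. From there on the box
        reaches below s, so its part above s is exactly the translate of the box for a.\<close>
      fix N assume N: "(\<Sum>i\<in>{1..k}. nat (- s i)) \<le> N"
      have sN: "- int N \<le> s i" if "i \<in> {1..k}" for i
      proof -
        have "nat (- s i) \<le> (\<Sum>i\<in>{1..k}. nat (- s i))" using that by (intro member_le_sum) auto
        then show ?thesis using N by linarith
      qed
      \<comment> \<open>Elements of \<open>Pi\<^sub>E\<close> are \<open>undefined\<close> outside
        {1..k}, hence the restriction; \<open>D\<close> reads only the indices in {1..k}.\<close>
      define up where "up a = restrict (\<lambda>i. s i + int (a i)) {1..k}" for a
      define dn where "dn p = restrict (\<lambda>i. nat (p i - s i)) {1..k}" for p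
      have fin: "finite (box N)" "finite (Pi\<^sub>E (set ?l) (\<lambda>i. {..<M i N}))"
        unfolding box_def by (auto intro!: finite_PiE)
      show "?G N = F N m n"
        unfolding F_def
      \<comment> \<open>The points p of the box that are not above s contribute 0, since then p
        fails to dominate m or n and one argument of the form vanishes.\<close>
      proof (rule sum.reindex_bij_witness_not_neutral[where i = dn and j = up
            and S' = "{}" and T' = "{p \<in> box N. \<not> (\<forall>i\<in>{1..k}. s i \<le> p i)}"])
        fix a assume "a \<in> Pi\<^sub>E (set ?l) (\<lambda>i. {..<M i N}) - {}"
        then have a: "a \<in> Pi\<^sub>E {1..k} (\<lambda>i. {..<M i N})" unfolding l(2) by simp
        show "dn (up a) = a"
          using a by (auto simp: dn_def up_def restrict_def PiE_def extensional_def fun_eq_iff)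
        have "up a i \<in> {- int N..<int N}" "s i \<le> up a i" if i: "i \<in> {1..k}" for i
        proof -
          have "a i < M i N" using a i by auto
          then show "up a i \<in> {- int N..<int N}" "s i \<le> up a i"
            using sN[OF i] i by (auto simp: up_def M_def)
        qed
        then show "up a \<in> box N - {p \<in> box N. \<not> (\<forall>i\<in>{1..k}. s i \<le> p i)}"
          by (auto simp: box_def PiE_def up_def)
      next
        fix a assume "a \<in> Pi\<^sub>E (set ?l) (\<lambda>i. {..<M i N})"
        have e: "D (up a) m' y = hscale H (cnj (c (int \<circ> a) s)) (?f a (D s m' y))"
          if "\<And>i. i \<in> {1..k} \<Longrightarrow> m' i \<le> s i" "y \<in> hcarrier H" for m' y
        proof -
          have "D (up a) m' y = D (s + (int \<circ> a)) m' y"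
          proof -
            have "c (up a) m' = c (s + (int \<circ> a)) m'" by (rule twist_cong) (auto simp: up_def)
            moreover have "mon (up a - m') y = mon (s + (int \<circ> a) - m') y"
              by (rule mon_cong) (auto simp: up_def)
            moreover have "(\<forall>i\<in>{1..k}. m' i \<le> up a i) = (\<forall>i\<in>{1..k}. m' i \<le> (s + (int \<circ> a)) i)"
              by (auto simp: up_def)
            ultimately show ?thesis unfolding D_def by simp
          qed
          also have "\<dots> = hscale H (cnj (c (int \<circ> a) s)) (mon (int \<circ> a) (D s m' y))"
            by (rule D_add) (use that in auto)
          also have "mon (int \<circ> a) (D s m' y) = ?f a (D s m' y)"
            by (simp add: mon_fprod del: upt_Suc)
          finally show ?thesis .
        qed
        \<comment> \<open>The phase from \<open>D_add\<close> depends on a and s but not on m or n,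
          so it meets its own conjugate in the sesquilinear form.\<close>
        have c1: "cnj (c (int \<circ> a) s) * cnj (cnj (c (int \<circ> a) s)) = 1"
          by (simp add: cnj_twist)
        have "D (up a) m (x m) = hscale H (cnj (c (int \<circ> a) s)) (?f a (D s m (x m)))"
          "D (up a) n (x n) = hscale H (cnj (c (int \<circ> a) s)) (?f a (D s n (x n)))"
          by (rule e; use x m n in \<open>simp add: s_def\<close>)+
        then show "defect_form H S ?l (D (up a) m (x m)) (D (up a) n (x n))
          = defect_form H S ?l (?f a (D s m (x m))) (?f a (D s n (x n)))"
          using H.defect_form_scale[where l = ?l and R = S and d = "cnj (c (int \<circ> a) s)" and
              e = "cnj (c (int \<circ> a) s)" and h = "?f a (D s m (x m))" and g = "?f a (D s n (x n))", OF lin]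
            x m n l(3) by (simp only: c1 mult_1 R.fprod_carrier D_carrier simp_thms)
      next
        fix p assume "p \<in> box N - {p \<in> box N. \<not> (\<forall>i\<in>{1..k}. s i \<le> p i)}"
        then have p: "p \<in> Pi\<^sub>E {1..k} (\<lambda>_. {- int N..<int N})" "\<And>i. i \<in> {1..k} \<Longrightarrow> s i \<le> p i"
          by (auto simp: box_def)
        show "up (dn p) = p"
          using p by (auto simp: dn_def up_def restrict_def PiE_def extensional_def fun_eq_iff)
        have "nat (p i - s i) < M i N" if "i \<in> {1..k}" for i
        proof -
          have "p i < int N" using p(1) that by auto
          then show ?thesis using p(2)[OF that] by (simp add: M_def)
        qed
        then show "dn p \<in> Pi\<^sub>E (set ?l) (\<lambda>i. {..<M i N}) - {}"
          unfolding l(2) by (auto simp: dn_def)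
      next
        fix p assume "p \<in> {p \<in> box N. \<not> (\<forall>i\<in>{1..k}. s i \<le> p i)}"
        then obtain i where i: "i \<in> {1..k}" "\<not> s i \<le> p i" by auto
        then have "\<not> m i \<le> p i \<or> \<not> n i \<le> p i" by (simp add: s_def)
        then have "D p m (x m) = 0 \<or> D p n (x n) = 0"
          using i(1) unfolding D_def by (meson bexI)
        moreover have "D p m (x m) \<in> hcarrier H" "D p n (x n) \<in> hcarrier H"
          using x m n by simp_all
        ultimately show "defect_form H S ?l (D p m (x m)) (D p n (x n)) = 0"
          using H.defect_form_0[where R = S and l = ?l, OF lin] by (elim disjE) (simp_all only:)
      qed (use fin in auto)
    qed
    ultimately show ?thesis
      unfolding ker_def s_def[symmetric] by (rule Lim_transform_eventually)
  qed
  have "(\<lambda>N. Re (\<Sum>m\<in>A. \<Sum>n\<in>A. F N m n)) \<longlonglongrightarrow> Re (\<Sum>m\<in>A. \<Sum>n\<in>A. ker m (x m) n (x n))"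
    by (intro tendsto_Re tendsto_sum lim)
  \<comment> \<open>For fixed p the double sum is the defect form at the single vector obtained by
    summing \<open>D p m (x m)\<close> over m.\<close>
  moreover have "0 \<le> Re (\<Sum>m\<in>A. \<Sum>n\<in>A. F N m n)" for N
  proof -
    have "(\<Sum>m\<in>A. \<Sum>n\<in>A. F N m n) = (\<Sum>m\<in>A. \<Sum>p\<in>box N. \<Sum>n\<in>A. defect_form H S ?l (D p m (x m)) (D p n (x n)))"
      unfolding F_def by (intro sum.cong refl sum.swap)
    also have "\<dots> = (\<Sum>p\<in>box N. \<Sum>m\<in>A. \<Sum>n\<in>A. defect_form H S ?l (D p m (x m)) (D p n (x n)))"
      by (rule sum.swap)
    also have "\<dots> = (\<Sum>p\<in>box N. defect_form H S ?l (\<Sum>m\<in>A. D p m (x m)) (\<Sum>m\<in>A. D p m (x m)))"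
      using x by (intro sum.cong refl H.defect_form_sum[symmetric] lin) auto
    also have "Re \<dots> = (\<Sum>p\<in>box N. Re (defect_form H S ?l (\<Sum>m\<in>A. D p m (x m)) (\<Sum>m\<in>A. D p m (x m))))"
      by simp
    also have "\<dots> \<ge> 0"
      using x by (intro sum_nonneg pos H.carrier_sum) auto
    finally show ?thesis .
  qed
  ultimately show ?thesis by (intro LIMSEQ_le_const) auto
qed

section \<open>The space of the kernel\<close>

locale polyball = twisting k lam + H: complex_hilbert_space H
  for k lam and H :: "'a::ab_group_add hspace" +
  fixes T :: "nat \<Rightarrow> 'a \<Rightarrow> 'a"
  assumes T: "T \<in> regular_polyball k lam H"
begin

definition S :: "nat \<Rightarrow> 'a \<Rightarrow> 'a" where
  "S i = adj H (T i)"

lemma T_contraction: "i \<in> {1..k} \<Longrightarrow> contraction_op H H (T i)"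
  and T_commute: "\<lbrakk>i \<in> {1..k}; j \<in> {1..k}; i \<noteq> j; x \<in> hcarrier H\<rbrakk>
    \<Longrightarrow> T i (T j x) = hscale H (lam i j) (T j (T i x))"
  and T_positive: "0 \<le> r \<Longrightarrow> r < 1 \<Longrightarrow> positive_op H (defect k H T r)"
  using T unfolding regular_polyball_def mem_Collect_eq by blast+

lemma T_carrier [simp]: "i \<in> {1..k} \<Longrightarrow> x \<in> hcarrier H \<Longrightarrow> T i x \<in> hcarrier H"
  by (rule contraction_op_carrier[OF T_contraction])

lemma T_inner: "i \<in> {1..k} \<Longrightarrow> x \<in> hcarrier H \<Longrightarrow> z \<in> hcarrier H \<Longrightarrow>
    hinner H (T i z) x = hinner H z (S i x)"
  unfolding S_def by (rule H.adj_exists(2)[OF T_contraction])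

lemma S_contraction: "i \<in> {1..k} \<Longrightarrow> contraction_op H H (S i)"
  unfolding S_def by (rule H.contraction_op_adj[OF T_contraction])

lemma S_carrier: "i \<in> {1..k} \<Longrightarrow> x \<in> hcarrier H \<Longrightarrow> S i x \<in> hcarrier H"
  by (rule contraction_op_carrier[OF S_contraction])

text \<open>Taking adjoints reverses the products and conjugates the phase; the two effects cancel,
  so the adjoints obey the same relation as \<open>T\<close>.\<close>

lemma S_commute:
  assumes ij: "i \<in> {1..k}" "j \<in> {1..k}" "i \<noteq> j" and x: "x \<in> hcarrier H"
  shows "S i (S j x) = hscale H (lam i j) (S j (S i x))"
proof (rule H.eqI_inner)
  fix z assume z: "z \<in> hcarrier H"
  have "hinner H z (S i (S j x)) = hinner H (T j (T i z)) x"
    using ij x z by (simp add: T_inner S_carrier)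
  also have "T j (T i z) = hscale H (lam j i) (T i (T j z))"
    using ij z by (intro T_commute) auto
  also have "hinner H (hscale H (lam j i) (T i (T j z))) x = lam j i * hinner H z (S j (S i x))"
    using ij x z by (simp add: H.inner_scale T_inner S_carrier)
  also have "\<dots> = hinner H z (hscale H (lam i j) (S j (S i x)))"
    using ij x z lam_swap[OF ij] by (simp add: H.inner_scale_right S_carrier)
  finally show "hinner H z (S i (S j x)) = hinner H z (hscale H (lam i j) (S j (S i x)))" .
qed (use ij x S_carrier in auto)

sublocale S: twisted_family k lam H S
  by (intro twisted_family.intro twisted_family_axioms.intro twisting_axioms
      H.complex_hilbert_space_axioms S_contraction S_commute)

section \<open>Positivity of the kernel of \<open>T\<close> by scaling its adjoints\<close>

definition R :: "real \<Rightarrow> nat \<Rightarrow> 'a \<Rightarrow> 'a" where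
  "R r i x = hscale H (of_real r) (S i x)"

lemma R_linear: "i \<in> {1..k} \<Longrightarrow> linear_op H H (R r i)"
  using contraction_op_linear[OF S_contraction, of i]
  unfolding linear_op_def R_def
  by (auto simp: H.vs.scale_right_distrib H.vs.scale_left_commute Pi_iff)

lemma R_norm: "0 \<le> r \<Longrightarrow> i \<in> {1..k} \<Longrightarrow> x \<in> hcarrier H \<Longrightarrow> hnorm H (R r i x) \<le> r * hnorm H x"
  using contraction_op_norm[OF S_contraction, of i x]
  by (simp add: R_def H.norm_scale S_carrier mult_left_mono)

lemma twisted_family_R:
  assumes r: "0 \<le> r" "r < 1"
  shows "twisted_family k lam H (R r)"
proof (intro twisted_family.intro twisted_family_axioms.intro twisting_axioms H.complex_hilbert_space_axioms)
  show "contraction_op H H (R r i)" if i: "i \<in> {1..k}" for i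
    unfolding contraction_op_def
  proof (intro conjI ballI R_linear[OF i])
    show "hnorm H (R r i x) \<le> hnorm H x" if "x \<in> hcarrier H" for x
      using R_norm[OF r(1) i that] mult_right_mono[of r 1 "hnorm H x"] r that by fastforce
  qed
  show "R r i (R r j x) = hscale H (lam i j) (R r j (R r i x))"
    if "i \<in> {1..k}" "j \<in> {1..k}" "i \<noteq> j" "x \<in> hcarrier H" for i j x
    using that S_commute[OF that] linear_op_scale[OF contraction_op_linear[OF S_contraction]]
    by (simp add: R_def S_carrier mult_ac)
qed

text \<open>In an inner product, T_i moves to the other side as S_i, and r^2 splits into one factor
  r for each argument. Linearity is proved alongside because it keeps the values of the partial
  defect in the carrier.\<close>

lemma defect_form_eq:
  "set l \<subseteq> {1..k} \<Longrightarrow>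
    linear_op H H (foldr (\<lambda>i X x. X x - Phi H r (T i) X x) l (\<lambda>x. x)) \<and>
    (\<forall>h\<in>hcarrier H. \<forall>g\<in>hcarrier H.
      hinner H (foldr (\<lambda>i X x. X x - Phi H r (T i) X x) l (\<lambda>x. x) h) g = defect_form H (R r) l h g)"
proof (induction l)
  case Nil
  show ?case by (simp add: linear_op_def)
next
  case (Cons i l)
  let ?X = "foldr (\<lambda>i X x. X x - Phi H r (T i) X x) l (\<lambda>x. x)"
  let ?Y = "\<lambda>x. ?X x - Phi H r (T i) ?X x"
  have i: "i \<in> {1..k}" using Cons.prems by simp
  have X: "linear_op H H ?X"
    and IH: "\<And>h g. h \<in> hcarrier H \<Longrightarrow> g \<in> hcarrier H \<Longrightarrow> hinner H (?X h) g = defect_form H (R r) l h g"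
    using Cons by auto
  note Xc = linear_op_carrier[OF X] and Xa = linear_op_add[OF X] and Xs = linear_op_scale[OF X]
  note TL = contraction_op_linear[OF T_contraction[OF i]] and SL = contraction_op_linear[OF S_contraction[OF i]]
  have Phi: "Phi H r (T i) ?X x = hscale H (of_real (r\<^sup>2)) (T i (?X (S i x)))" for x
    by (simp add: Phi_def S_def)
  have "linear_op H H ?Y"
    unfolding linear_op_def Phi
    using Xc i S_carrier
    by (auto simp: Xa Xs linear_op_add[OF TL] linear_op_add[OF SL] linear_op_scale[OF TL] linear_op_scale[OF SL]
        H.vs.scale_right_distrib H.vs.scale_right_diff_distrib mult_ac)
  moreover have "hinner H (?Y h) g = defect_form H (R r) (i # l) h g"
    if h: "h \<in> hcarrier H" and g: "g \<in> hcarrier H" for h g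
  proof -
    have "hinner H (?Y h) g = hinner H (?X h) g - of_real (r\<^sup>2) * hinner H (?X (S i h)) (S i g)"
      unfolding Phi using h g i Xc S_carrier by (simp add: H.inner_diff H.inner_scale T_inner)
    also have "hinner H (?X (S i h)) (S i g) = defect_form H (R r) l (S i h) (S i g)"
      by (rule IH) (use h g i S_carrier in auto)
    also have "of_real (r\<^sup>2) * defect_form H (R r) l (S i h) (S i g) = defect_form H (R r) l (R r i h) (R r i g)"
      unfolding R_def[of r i]
      by (subst H.defect_form_scale) (use Cons.prems h g i S_carrier in \<open>auto intro!: R_linear simp: power2_eq_square\<close>)
    finally show ?thesis using h g by (simp add: IH)
  qed
  ultimately show ?case by simp
qed

lemma defect_form_positive:
  assumes "0 \<le> r" "r < 1" "x \<in> hcarrier H"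
  shows "0 \<le> Re (defect_form H (R r) [1..<Suc k] x x)"
proof -
  have "set [1..<Suc k] \<subseteq> {1..k}" by auto
  then have "hinner H (defect k H T r x) x = defect_form H (R r) [1..<Suc k] x x"
    using defect_form_eq[of "[1..<Suc k]" r] assms(3) unfolding defect_def by blast
  then show ?thesis using T_positive[OF assms(1,2)] assms(3) unfolding positive_op_def by metis
qed

lemma mon_R:
  assumes r: "0 \<le> r" "r < 1" and x: "x \<in> hcarrier H"
  shows "twisted_family.mon k (R r) a x = hscale H (of_real (r ^ (\<Sum>i\<in>{1..k}. nat (a i)))) (S.mon a x)"
proof -
  interpret R: twisted_family k lam H "R r" by (rule twisted_family_R[OF r])
  have pow: "(R r i ^^ n) (hscale H d x) = hscale H (of_real (r ^ n) * d) ((S i ^^ n) x)"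
    if "i \<in> {1..k}" "x \<in> hcarrier H" for i n d x
  proof (induction n)
    case (Suc n)
    have "(R r i ^^ Suc n) (hscale H d x) = R r i (hscale H (of_real (r ^ n) * d) ((S i ^^ n) x))"
      using Suc by simp
    also have "\<dots> = hscale H (of_real (r ^ Suc n) * d) ((S i ^^ Suc n) x)"
      using linear_op_scale[OF contraction_op_linear[OF S_contraction[OF that(1)]], of "(S i ^^ n) x"] that
      by (simp add: R_def mult_ac)
    finally show ?case .
  qed simp
  have "fprod (\<lambda>i. R r i ^^ nat (a i)) l x
      = hscale H (of_real (r ^ (\<Sum>i\<leftarrow>l. nat (a i)))) (fprod (\<lambda>i. S i ^^ nat (a i)) l x)"
    if "set l \<subseteq> {1..k}" for l
    using that
  proof (induction l)
    case (Cons i l)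
    have "fprod (\<lambda>i. S i ^^ nat (a i)) l x \<in> hcarrier H"
      by (rule fprod_in) (use Cons.prems x in auto)
    then show ?case using Cons by (simp add: pow power_add)
  qed simp
  from this[of "[1..<Suc k]"] show ?thesis
    unfolding R.mon_fprod S.mon_fprod
    by (simp add: interv_sum_list_conv_sum_set_nat atLeastLessThanSuc_atLeastAtMost del: upt_Suc)
qed

text \<open>Scaling the adjoints by r multiplies each entry by a power of r. A finite quadratic sum
  is thus continuous in r, and nonnegativity for r < 1 is inherited at r = 1.\<close>

lemma ker_positive:
  assumes A: "finite A" and x: "\<And>m. m \<in> A \<Longrightarrow> x m \<in> hcarrier H"
  shows "0 \<le> Re (\<Sum>m\<in>A. \<Sum>n\<in>A. S.ker m (x m) n (x n))"
proof -
  \<comment> \<open>The total degree of the two monomials in the entry at (m, n).\<close>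
  define w where "w m n = (\<Sum>i\<in>{1..k}. nat ((sup m n - m) i)) + (\<Sum>i\<in>{1..k}. nat ((sup m n - n) i))"
    for m n :: "nat \<Rightarrow> int"
  define rr where "rr j = 1 - 1 / real (Suc j)" for j
  have rr: "0 \<le> rr j" "rr j < 1" for j by (auto simp: rr_def)
  have ker_R: "twisted_family.ker k lam H (R r) m h n g = of_real (r ^ w m n) * S.ker m h n g"
    if r: "0 \<le> r" "r < 1" and h: "h \<in> hcarrier H" and g: "g \<in> hcarrier H" for r m h n g
  proof -
    interpret R: twisted_family k lam H "R r" by (rule twisted_family_R[OF r])
    have D: "R.D p m h = hscale H (of_real (r ^ (\<Sum>i\<in>{1..k}. nat ((p - m) i)))) (S.D p m h)"
      if "h \<in> hcarrier H" for p m h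
      unfolding R.D_def S.D_def mon_R[OF r that] by (simp add: mult_ac)
    show ?thesis
      unfolding R.ker_def S.ker_def D[OF h] D[OF g]
      using h g by (simp add: H.inner_scale H.inner_scale_right w_def power_add)
  qed
  have "(\<lambda>j. Re (\<Sum>m\<in>A. \<Sum>n\<in>A. of_real (rr j ^ w m n) * S.ker m (x m) n (x n)))
      \<longlonglongrightarrow> Re (\<Sum>m\<in>A. \<Sum>n\<in>A. of_real (1 ^ w m n) * S.ker m (x m) n (x n))"
  proof (intro tendsto_Re tendsto_sum tendsto_mult tendsto_const tendsto_of_real tendsto_power)
    show "rr \<longlonglongrightarrow> 1"
      using tendsto_diff[OF tendsto_const LIMSEQ_Suc[OF lim_1_over_n], of 1] unfolding rr_def by simp
  qed
  moreover have "0 \<le> Re (\<Sum>m\<in>A. \<Sum>n\<in>A. of_real (rr j ^ w m n) * S.ker m (x m) n (x n))" for j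
  proof -
    have "0 \<le> Re (\<Sum>m\<in>A. \<Sum>n\<in>A. twisted_family.ker k lam H (R (rr j)) m (x m) n (x n))"
      by (rule twisted_family.ker_positive_strict[OF twisted_family_R[OF rr] rr])
         (use R_norm rr defect_form_positive A x in auto)
    then show ?thesis using x by (simp add: ker_R[OF rr])
  qed
  ultimately show ?thesis using LIMSEQ_le_const by fastforce
qed

section \<open>Finitely supported families with the kernel as semi-inner product\<close>

definition finite_space :: "((nat \<Rightarrow> int) \<Rightarrow> 'a) hspace" where
  "finite_space = \<lparr>hcarrier = {x. finite {m. x m \<noteq> 0} \<and> (\<forall>m. x m \<in> hcarrier H)},
     hscale = \<lambda>d x m. hscale H d (x m),
     hinner = \<lambda>x y. \<Sum>m | x m \<noteq> 0. \<Sum>n | y n \<noteq> 0. S.ker m (x m) n (y n)\<rparr>"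

lemma ker_0 [simp]: "h \<in> hcarrier H \<Longrightarrow> S.ker m 0 n h = 0" "h \<in> hcarrier H \<Longrightarrow> S.ker m h n 0 = 0"
proof -
  show 0: "S.ker m 0 n h = 0" if "h \<in> hcarrier H" for m n h
    using S.ker_scale_left[of 0 h m 0 n] that by simp
  show "h \<in> hcarrier H \<Longrightarrow> S.ker m h n 0 = 0"
    using S.ker_cnj[of 0 h m n] 0[of h n m] by simp
qed

lemma finite_space_simps:
  "x \<in> hcarrier finite_space \<longleftrightarrow> finite {m. x m \<noteq> 0} \<and> (\<forall>m. x m \<in> hcarrier H)"
  "hscale finite_space = (\<lambda>d x m. hscale H d (x m))"
  by (simp_all add: finite_space_def)

text \<open>Entries at the zero vector vanish, so supports may be enlarged; linearity is then
  checked over one index set common to several vectors.\<close>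

lemma finite_space_inner:
  assumes x: "x \<in> hcarrier finite_space" and y: "y \<in> hcarrier finite_space"
    and A: "finite A" "{m. x m \<noteq> 0} \<subseteq> A" and B: "finite B" "{m. y m \<noteq> 0} \<subseteq> B"
  shows "hinner finite_space x y = (\<Sum>m\<in>A. \<Sum>n\<in>B. S.ker m (x m) n (y n))"
proof -
  have "hinner finite_space x y = (\<Sum>m | x m \<noteq> 0. \<Sum>n\<in>B. S.ker m (x m) n (y n))"
    unfolding finite_space_def hspace.simps
    using x y by (intro sum.cong refl sum.mono_neutral_left B) (auto simp: finite_space_simps)
  also have "\<dots> = (\<Sum>m\<in>A. \<Sum>n\<in>B. S.ker m (x m) n (y n))"
    using x y by (intro sum.mono_neutral_left A) (auto simp: finite_space_simps intro!: sum.neutral)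
  finally show ?thesis .
qed

lemma finite_space_inner_UN:
  assumes x: "x \<in> hcarrier finite_space" and y: "y \<in> hcarrier finite_space"
    and "finite A" "{m. x m \<noteq> 0} \<subseteq> A" "{m. y m \<noteq> 0} \<subseteq> A"
  shows "hinner finite_space x y = (\<Sum>m\<in>A. \<Sum>n\<in>A. S.ker m (x m) n (y n))"
  by (rule finite_space_inner) (use assms in auto)

sublocale FS: semi_inner_space finite_space
proof (rule semi_inner_space.intro)
  show "vector_space (hscale finite_space)"
    unfolding finite_space_simps by (rule vector_space_pointwise[OF H.vector_space])
  then interpret v: vector_space "hscale finite_space" .
  have add: "x + y \<in> hcarrier finite_space" if "x \<in> hcarrier finite_space" "y \<in> hcarrier finite_space" for x y
  proof -
    have "{m. x m + y m \<noteq> 0} \<subseteq> {m. x m \<noteq> 0} \<union> {m. y m \<noteq> 0}" by auto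
    then show ?thesis
      using that by (auto simp: finite_space_simps intro: finite_subset)
  qed
  have scale: "hscale finite_space d x \<in> hcarrier finite_space" if "x \<in> hcarrier finite_space" for d x
  proof -
    have "{m. hscale H d (x m) \<noteq> 0} \<subseteq> {m. x m \<noteq> 0}" by auto
    then show ?thesis using that by (auto simp: finite_space_simps intro: finite_subset)
  qed
  show "v.subspace (hcarrier finite_space)"
    by (rule v.subspaceI) (use add scale in \<open>auto simp: finite_space_simps(1)\<close>)
  fix x y z :: "(nat \<Rightarrow> int) \<Rightarrow> 'a" and d
  assume x: "x \<in> hcarrier finite_space" and y: "y \<in> hcarrier finite_space"
  have xc: "x m \<in> hcarrier H" "y m \<in> hcarrier H" for m using x y by (auto simp: finite_space_simps)
  have fin: "finite ({m. x m \<noteq> 0} \<union> {m. y m \<noteq> 0})" using x y by (simp add: finite_space_simps)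
  note xy = finite_space_inner_UN[OF x y fin] finite_space_inner_UN[OF y x fin]
  show "hinner finite_space (hscale finite_space d x) y = d * hinner finite_space x y"
  proof -
    have "{m. hscale finite_space d x m \<noteq> 0} \<subseteq> {m. x m \<noteq> 0} \<union> {m. y m \<noteq> 0}"
      by (auto simp: finite_space_simps)
    from finite_space_inner_UN[OF scale[OF x] y fin this] xy(1) xc show ?thesis
      by (simp add: finite_space_simps(2) S.ker_scale_left sum_distrib_left)
  qed
  show "hinner finite_space y x = cnj (hinner finite_space x y)"
  proof -
    let ?A = "{m. x m \<noteq> 0} \<union> {m. y m \<noteq> 0}"
    have "hinner finite_space y x = (\<Sum>m\<in>?A. \<Sum>n\<in>?A. S.ker m (y m) n (x n))"
      by (rule xy(2)) auto
    also have "\<dots> = (\<Sum>n\<in>?A. \<Sum>m\<in>?A. S.ker m (y m) n (x n))" by (rule sum.swap)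
    also have "\<dots> = (\<Sum>n\<in>?A. \<Sum>m\<in>?A. cnj (S.ker n (x n) m (y m)))"
      by (intro sum.cong refl S.ker_cnj xc)
    also have "\<dots> = cnj (\<Sum>n\<in>?A. \<Sum>m\<in>?A. S.ker n (x n) m (y m))" by (simp only: cnj_sum)
    also have "(\<Sum>n\<in>?A. \<Sum>m\<in>?A. S.ker n (x n) m (y m)) = hinner finite_space x y"
      by (rule xy(1)[symmetric]) auto
    finally show ?thesis .
  qed
  show "0 \<le> Re (hinner finite_space x x)"
    using ker_positive[of "{m. x m \<noteq> 0}" x] x
      finite_space_inner_UN[OF x x, of "{m. x m \<noteq> 0}"] by (simp add: finite_space_simps)
  assume z: "z \<in> hcarrier finite_space"
  have zc: "z m \<in> hcarrier H" for m using z by (auto simp: finite_space_simps)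
  let ?A = "{m. x m \<noteq> 0} \<union> {m. y m \<noteq> 0} \<union> {m. z m \<noteq> 0}"
  have fin: "finite ?A" using x y z by (simp add: finite_space_simps)
  have "hinner finite_space (x + y) z = (\<Sum>m\<in>?A. \<Sum>n\<in>?A. S.ker m ((x + y) m) n (z n))"
    by (rule finite_space_inner_UN[OF add[OF x y] z fin]) auto
  also have "\<dots> = (\<Sum>m\<in>?A. \<Sum>n\<in>?A. S.ker m (x m) n (z n)) + (\<Sum>m\<in>?A. \<Sum>n\<in>?A. S.ker m (y m) n (z n))"
    using xc zc by (simp add: S.ker_add_left sum.distrib)
  also have "(\<Sum>m\<in>?A. \<Sum>n\<in>?A. S.ker m (x m) n (z n)) = hinner finite_space x z"
    by (rule finite_space_inner_UN[OF x z fin, symmetric]) auto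
  also have "(\<Sum>m\<in>?A. \<Sum>n\<in>?A. S.ker m (y m) n (z n)) = hinner finite_space y z"
    by (rule finite_space_inner_UN[OF y z fin, symmetric]) auto
  finally show "hinner finite_space (x + y) z = hinner finite_space x z + hinner finite_space y z" .
qed

definition delta :: "(nat \<Rightarrow> int) \<Rightarrow> 'a \<Rightarrow> (nat \<Rightarrow> int) \<Rightarrow> 'a" where
  "delta m h = (\<lambda>n. if n = m then h else 0)"

lemma delta_carrier: "h \<in> hcarrier H \<Longrightarrow> delta m h \<in> hcarrier finite_space"
  by (auto simp: finite_space_simps delta_def)

lemma delta_linear: "linear_op H finite_space (delta m)"
  unfolding linear_op_def
  by (auto simp: delta_carrier) (auto simp: delta_def finite_space_simps fun_eq_iff)

lemma inner_delta:
  assumes "h \<in> hcarrier H" "g \<in> hcarrier H"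
  shows "hinner finite_space (delta m h) (delta n g) = S.ker m h n g"
proof -
  have "hinner finite_space (delta m h) (delta n g) = (\<Sum>m'\<in>{m}. \<Sum>n'\<in>{n}. S.ker m' (delta m h m') n' (delta n g n'))"
    by (rule finite_space_inner[OF delta_carrier[OF assms(1)] delta_carrier[OF assms(2)]])
       (auto simp: delta_def)
  then show ?thesis by (simp add: delta_def)
qed

lemma finite_space_sum_delta:
  assumes "x \<in> hcarrier finite_space"
  shows "x = (\<Sum>m | x m \<noteq> 0. delta m (x m))"
proof
  fix n
  have fin: "finite {m. x m \<noteq> 0}" using assms by (simp add: finite_space_simps)
  have "(\<Sum>m\<in>A. delta m (x m)) n = (\<Sum>m\<in>A. delta m (x m) n)" for A
    by (induction A rule: infinite_finite_induct) auto
  then have "(\<Sum>m | x m \<noteq> 0. delta m (x m)) n = (\<Sum>m | x m \<noteq> 0. if n = m then x m else 0)"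
    by (simp add: delta_def)
  also have "\<dots> = x n" using fin by (simp add: sum.delta')
  finally show "x n = (\<Sum>m | x m \<noteq> 0. delta m (x m)) n" by simp
qed

text \<open>A Cauchy sequence \<open>x\<close> is represented by the function whose value at \<open>m\<close> is the vector of \<open>H\<close>
  that represents \<open>h \<mapsto> \<langle>delta m h, x\<rangle>\<close>.\<close>

theorem kernel_space:
  obtains K :: "((nat \<Rightarrow> int) \<Rightarrow> 'a) hspace" and E where
    "complex_hilbert_space K" "\<And>m. linear_op H K (E m)"
    "\<And>m n h g. h \<in> hcarrier H \<Longrightarrow> g \<in> hcarrier H \<Longrightarrow> hinner K (E m h) (E n g) = S.ker m h n g"
    "closed_span K (case_prod E ` (UNIV \<times> hcarrier H)) = hcarrier K"
proof -
  let ?C = "cauchy_space finite_space"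
  interpret C: semi_inner_space ?C by (rule FS.semi_inner_space_CS)
  define s :: "complex \<Rightarrow> ((nat \<Rightarrow> int) \<Rightarrow> 'a) \<Rightarrow> (nat \<Rightarrow> int) \<Rightarrow> 'a" where "s d f = (\<lambda>m. hscale H d (f m))" for d f
  have kc: "(\<lambda>_. delta m h) \<in> hcarrier ?C" if "h \<in> hcarrier H" for m h
    using FS.Cauchy_seq_const[OF delta_carrier[OF that]] by simp
  \<comment> \<open>Since h \<mapsto> delta m h is isometric, the functional below is bounded by the
    norm of x, as Riesz representation requires.\<close>
  have knorm: "hnorm ?C (\<lambda>_. delta m h) = hnorm H h" if h: "h \<in> hcarrier H" for m h
    using FS.hnorm_CS_const[OF delta_carrier[OF h, of m]] inner_delta[OF h h, of m m] S.ker_same[OF h h, of m]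
    by (simp add: hnorm_def)
  have "\<exists>y\<in>hcarrier H. \<forall>h\<in>hcarrier H. hinner ?C (\<lambda>_. delta m h) x = hinner H h y"
    if x: "x \<in> hcarrier ?C" for x m
  proof -
    obtain y where "y \<in> hcarrier H" "\<And>h. h \<in> hcarrier H \<Longrightarrow> hinner ?C (\<lambda>_. delta m h) x = hinner H h y"
    proof (rule H.Riesz_representation[of "\<lambda>h. hinner ?C (\<lambda>_. delta m h) x" "hnorm ?C x"])
      show "hinner ?C (\<lambda>_. delta m (h + g)) x = hinner ?C (\<lambda>_. delta m h) x + hinner ?C (\<lambda>_. delta m g) x"
        if "h \<in> hcarrier H" "g \<in> hcarrier H" for h g
        using C.inner_add[OF kc[OF that(1)] kc[OF that(2)] x] linear_op_add[OF delta_linear that]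
        by (simp only: plus_fun_def)
      show "hinner ?C (\<lambda>_. delta m (hscale H d h)) x = d * hinner ?C (\<lambda>_. delta m h) x"
        if "h \<in> hcarrier H" for d h
        using C.inner_scale[OF kc[OF that] x] linear_op_scale[OF delta_linear that]
        by (simp only: FS.cauchy_space_simps(2))
      show "cmod (hinner ?C (\<lambda>_. delta m h) x) \<le> hnorm ?C x * hnorm H h" if "h \<in> hcarrier H" for h
        using C.Cauchy_Schwarz[OF kc[OF that] x] knorm[OF that] by (simp add: mult.commute)
    qed (rule that)
    then show ?thesis by blast
  qed
  then obtain F where F: "\<And>x m. x \<in> hcarrier ?C \<Longrightarrow> F x m \<in> hcarrier H"
    "\<And>x m h. x \<in> hcarrier ?C \<Longrightarrow> h \<in> hcarrier H \<Longrightarrow> hinner ?C (\<lambda>_. delta m h) x = hinner H h (F x m)"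
    by metis
  have nq: "null_quotient ?C s F"
  proof (intro null_quotient.intro null_quotient_axioms.intro C.semi_inner_space_axioms)
    show "vector_space s"
      unfolding s_def[abs_def] by (rule vector_space_pointwise[OF H.vector_space])
    show "F (x + y) = F x + F y" if x: "x \<in> hcarrier ?C" and y: "y \<in> hcarrier ?C" for x y
    proof
      fix m
      show "F (x + y) m = (F x + F y) m"
        by (rule H.eqI_inner)
           (use F(1) x y C.carrier_add[OF x y] in
            \<open>simp_all add: F(2)[symmetric] H.inner_add_right C.inner_add_right[OF x y kc] del: FS.cauchy_space_simps\<close>)
    qed
    show "F (hscale ?C d x) = s d (F x)" if x: "x \<in> hcarrier ?C" for d x
    proof
      fix m
      show "F (hscale ?C d x) m = s d (F x) m"
        by (rule H.eqI_inner)
           (use F(1) x C.carrier_scale[OF x] in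
            \<open>simp_all add: s_def F(2)[symmetric] H.inner_scale_right C.inner_scale_right[OF x kc] del: FS.cauchy_space_simps\<close>)
    qed
    show "F x = 0 \<longleftrightarrow> hinner ?C x x = 0" if x: "x \<in> hcarrier ?C" for x
    proof
      assume "hinner ?C x x = 0"
      then have "hinner H h (F x m) = 0" if "h \<in> hcarrier H" for h m
        using C.null_orthogonal(2)[OF x kc[OF that]] F(2)[OF x that] by metis
      then show "F x = 0"
        using F(1)[OF x] H.inner_definite by (auto simp: fun_eq_iff)
    next
      \<comment> \<open>Vanishing of \<open>F x\<close> means orthogonality to every
        \<open>delta m h\<close>, hence to every constant sequence, as each vector of the finite
        space is a finite sum of such families.\<close>
      assume F0: "F x = 0"
      show "hinner ?C x x = 0"
      proof (rule FS.cauchy_space_null[OF x])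
        fix a assume a: "a \<in> hcarrier finite_space"
        let ?A = "{m. a m \<noteq> 0}"
        have ac: "a m \<in> hcarrier H" for m using a by (simp add: finite_space_simps)
        have "(\<lambda>_::nat. a) = (\<Sum>m\<in>?A. (\<lambda>_. delta m (a m)))"
        proof -
          have "(\<Sum>m\<in>B. (\<lambda>_::nat. delta m (a m))) = (\<lambda>_. \<Sum>m\<in>B. delta m (a m))" for B
            by (induction B rule: infinite_finite_induct) (auto simp: fun_eq_iff)
          then show ?thesis using finite_space_sum_delta[OF a] by simp
        qed
        then have "hinner ?C (\<lambda>_. a) x = (\<Sum>m\<in>?A. hinner ?C (\<lambda>_. delta m (a m)) x)"
          using C.inner_sum[of ?A "\<lambda>m _. delta m (a m)" x] kc[OF ac] x by metis
        also have "\<dots> = 0" using F(2)[OF x ac] F0 ac by (simp del: FS.cauchy_space_simps)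
        finally show "hinner ?C (\<lambda>_. a) x = 0" .
      qed
    qed
  qed
  note comp = completion[OF FS.semi_inner_space_axioms nq]
  let ?K = "quotient_hspace ?C s F"
  let ?j = "\<lambda>a. F (\<lambda>_. a)"
  interpret K: complex_hilbert_space ?K by (rule comp(1))
  define E where "E m h = ?j (delta m h)" for m h
  have E: "linear_op H ?K (E m)" for m
    unfolding E_def[abs_def] by (rule linear_op_compose[OF comp(3) delta_linear])
  let ?G = "case_prod E ` (UNIV \<times> hcarrier H)"
  have G: "?G \<subseteq> hcarrier ?K" using linear_op_carrier[OF E] by auto
  have jG: "?j ` hcarrier finite_space \<subseteq> closed_span ?K ?G"
  proof
    fix y assume "y \<in> ?j ` hcarrier finite_space"
    then obtain x where x: "x \<in> hcarrier finite_space" "y = ?j x" by auto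
    have xc: "x m \<in> hcarrier H" for m using x(1) by (simp add: finite_space_simps)
    have "y = (\<Sum>m | x m \<noteq> 0. ?j (delta m (x m)))"
      using linear_op_sum[OF comp(3) FS.semi_inner_space_axioms, of "{m. x m \<noteq> 0}" "\<lambda>m. delta m (x m)"]
        finite_space_sum_delta[OF x(1)] delta_carrier[OF xc] x(2) by simp
    also have "\<dots> \<in> K.vs.span ?G"
      by (intro K.vs.span_sum K.vs.span_base) (use xc in \<open>auto simp: E_def intro!: image_eqI[of _ _ "(_, _)"]\<close>)
    finally show "y \<in> closed_span ?K ?G" using K.span_closed_span[OF G] by blast
  qed
  show ?thesis
  proof (rule that[OF comp(1) E])
    show "hinner ?K (E m h) (E n g) = S.ker m h n g" if "h \<in> hcarrier H" "g \<in> hcarrier H" for m n h g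
      using comp(4)[OF delta_carrier delta_carrier, of h g m n] inner_delta that by (simp add: E_def)
    show "closed_span ?K ?G = hcarrier ?K"
      using K.closed_span_minimal[OF G jG] K.closed_span_carrier[OF G] comp(5) by auto
  qed
qed

end

section \<open>Families shifted by unitaries\<close>

text \<open>Covers the constructed dilation as well as any competing one, so that the formulas for
  words, mixed monomials and Gram entries are available for both. \<open>X\<close> is a bare set
  because h only serves as a label.\<close>

locale shift_system = twisting k lam + K: complex_hilbert_space K
  for k lam and K :: "'b::ab_group_add hspace" +
  fixes U :: "nat \<Rightarrow> 'b \<Rightarrow> 'b" and E :: "(nat \<Rightarrow> int) \<Rightarrow> 'h::ab_group_add \<Rightarrow> 'b" and X :: "'h set"
  assumes unitary: "i \<in> {1..k} \<Longrightarrow> unitary_op K K (U i)"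
    and E_carrier: "h \<in> X \<Longrightarrow> E m h \<in> hcarrier K"
    and E_shift: "i \<in> {1..k} \<Longrightarrow> h \<in> X \<Longrightarrow>
      U i (E m h) = hscale K (c (single i 1) m) (E (m + single i 1) h)"
    and E_cong: "h \<in> X \<Longrightarrow> (\<And>i. i \<in> {1..k} \<Longrightarrow> m i = n i) \<Longrightarrow> E m h = E n h"
begin

lemma U_contraction: "i \<in> {1..k} \<Longrightarrow> contraction_op K K (U i)"
  by (rule unitary_op_contraction[OF unitary])

lemma adj_contraction: "i \<in> {1..k} \<Longrightarrow> contraction_op K K (adj K (U i))"
  by (rule K.contraction_op_adj[OF U_contraction])

lemma adj_shift:
  assumes i: "i \<in> {1..k}" and h: "h \<in> X"
  shows "adj K (U i) (E m h) = hscale K (c (single i (- 1)) m) (E (m - single i 1) h)"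
proof -
  let ?e = "single i 1"
  have "c ?e (m - ?e) = c ?e m"
    by (simp add: twist_diff_right twist_single_single[OF i i])
  then have "U i (E (m - ?e) h) = hscale K (c ?e m) (E m h)"
    by (simp only: E_shift[OF i h] diff_add_cancel)
  then have "hscale K (c (- ?e) m) (U i (E (m - ?e) h)) = E m h"
    by (simp only: K.vs.scale_scale twist_uminus_left left_inverse[OF twist_nonzero] K.vs.scale_one)
  then have "E m h = U i (hscale K (c (- ?e) m) (E (m - ?e) h))"
    using linear_op_scale[OF contraction_op_linear[OF U_contraction[OF i]] E_carrier[OF h]] by simp
  then show ?thesis
    using K.adj_unitary_left[OF unitary[OF i]] E_carrier[OF h]
    by (simp add: single_uminus)
qed

lemma zpower_contraction: "i \<in> {1..k} \<Longrightarrow> contraction_op K K (zpower K (U i) z)"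
  unfolding zpower_def by (simp add: contraction_op_funpow U_contraction adj_contraction)

lemma zpower_shift:
  assumes i: "i \<in> {1..k}" and h: "h \<in> X"
  shows "zpower K (U i) z (E m h) = hscale K (c (single i z) m) (E (m + single i z) h)"
proof -
  \<comment> \<open>One induction for both signs: d = 1 for \<open>U i\<close> and d = - 1 for its
    adjoint.\<close>
  have step: "(A ^^ n) (E m h) = hscale K (c (single i (d * int n)) m) (E (m + single i (d * int n)) h)"
    if A: "contraction_op K K A"
      and s: "\<And>m. A (E m h) = hscale K (c (single i d) m) (E (m + single i d) h)" for A d n
  proof (induction n)
    case (Suc n)
    have e: "d * int (Suc n) = d * int n + d" by (simp add: algebra_simps)
    have "(A ^^ Suc n) (E m h) = A (hscale K (c (single i (d * int n)) m) (E (m + single i (d * int n)) h))"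
      using Suc by (simp add: plus_fun_def)
    also have "\<dots> = hscale K (c (single i (d * int n)) m * c (single i d) (m + single i (d * int n)))
        (E (m + single i (d * int n) + single i d) h)"
      using linear_op_scale[OF contraction_op_linear[OF A] E_carrier[OF h]] s by simp
    also have "c (single i (d * int n)) m * c (single i d) (m + single i (d * int n)) = c (single i (d * int (Suc n))) m"
      unfolding e single_add by (simp add: twist_simps twist_single_single[OF i i])
    also have "m + single i (d * int n) + single i d = m + single i (d * int (Suc n))"
      unfolding e single_add by (simp only: add.assoc)
    finally show ?case .
  qed simp
  show ?thesis
  proof (cases "0 \<le> z")
    case True
    then show ?thesis
      using step[OF U_contraction[OF i], of 1 "nat z"] E_shift[OF i h] by (simp add: zpower_def)
  next
    case False
    have "adj K (U i) (E m h) = hscale K (c (single i (- 1)) m) (E (m + single i (- 1)) h)" for m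
      using adj_shift[OF i h, of m] by (simp add: single_uminus)
    then show ?thesis
      using False step[OF adj_contraction[OF i], of "- 1" "nat (- z)"] by (simp add: zpower_def)
  qed
qed

lemma zpower_isometry:
  assumes i: "i \<in> {1..k}" and x: "x \<in> hcarrier K"
  shows "hnorm K (zpower K (U i) z x) = hnorm K x"
proof -
  have pow: "hnorm K ((A ^^ n) x) = hnorm K x"
    if "contraction_op K K A" "\<And>x. x \<in> hcarrier K \<Longrightarrow> hnorm K (A x) = hnorm K x" for A n
    by (induction n) (use that x contraction_op_carrier[OF contraction_op_funpow[OF that(1)]] in auto)
  have U: "hnorm K (U i x) = hnorm K x" if "x \<in> hcarrier K" for x
    using unitary[OF i] that by (simp add: unitary_op_def isometry_op_def)
  have "hnorm K (adj K (U i) x) = hnorm K x" if "x \<in> hcarrier K" for x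
    using U[OF contraction_op_carrier[OF adj_contraction[OF i] that]] K.adj_unitary_right[OF unitary[OF i] that]
    by simp
  then show ?thesis
    using pow[OF U_contraction[OF i] U] pow[OF adj_contraction[OF i]] by (simp add: zpower_def)
qed

lemma fprod_zpower:
  assumes h: "h \<in> X"
  shows "fprod (\<lambda>i. zpower K (U i) (a i)) [1..<Suc k] (E m h) = hscale K (c a m) (E (m + a) h)"
proof -
  have "fprod (\<lambda>i. zpower K (U i) (a i)) [1..<Suc k] (E m h) = hscale K (c a m) (E (m + cut k a) h)"
    by (rule fprod_shift(1)[where M = UNIV and E = "\<lambda>m. E m h"])
       (use K.vector_space zpower_shift[OF _ h] E_carrier[OF h]
          linear_op_scale[OF contraction_op_linear[OF zpower_contraction]] in auto)
  also have "E (m + cut k a) h = E (m + a) h"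
    by (rule E_cong[OF h]) (simp add: cut_def)
  finally show ?thesis .
qed

lemma E_zword: "h \<in> X \<Longrightarrow> E m h = zword_op K U (map (\<lambda>i. (i, m i)) [1..<Suc k]) (E 0 h)"
  using fprod_zpower[of h m 0] by (simp add: zword_op_fprod fprod_map del: upt_Suc)

lemma zword_E:
  assumes w: "w \<in> lists ({1..k} \<times> UNIV)" and h: "h \<in> X"
  obtains d n where "cmod d = 1" "zword_op K U w (E m h) = hscale K d (E n h)"
proof -
  have "\<exists>d n. cmod d = 1 \<and> zword_op K U w (E m h) = hscale K d (E n h)"
    using w
  proof (induction w)
    case Nil
    show ?case by (rule exI[of _ 1], rule exI[of _ m]) (simp add: zword_op_fprod)
  next
    case (Cons p w)
    obtain i z where p: "p = (i, z)" "i \<in> {1..k}" using Cons by (cases p) auto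
    obtain d n where IH: "cmod d = 1" "zword_op K U w (E m h) = hscale K d (E n h)" using Cons by blast
    have "zword_op K U (p # w) (E m h) = hscale K (d * c (single i z) n) (E (n + single i z) h)"
      using IH(2) linear_op_scale[OF contraction_op_linear[OF zpower_contraction[OF p(2)]] E_carrier[OF h]]
        zpower_shift[OF p(2) h] by (simp add: zword_op_fprod p(1))
    moreover have "cmod (d * c (single i z) n) = 1" by (simp add: norm_mult IH)
    ultimately show ?case by blast
  qed
  with that show ?thesis by blast
qed

lemma word_zword:
  "word_op U w = zword_op K U (map (\<lambda>(i, p). (i, int p)) w)"
  by (induction w) (auto simp: word_op_def zword_op_def zpower_def)

text \<open>Positive entries of p are carried by adjoints, hence the index \<open>- p\<close>. The
  adjoint block starts at index 0, where every phase is 1, so only the second block contributes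
  one.\<close>

lemma mixed_monomial_E:
  assumes h: "h \<in> X"
  defines "a \<equiv> \<lambda>p i. max (- p i) 0" and "b \<equiv> \<lambda>p i. max (p i) 0"
  shows "mixed_monomial k K U p (E 0 h) = hscale K (c (a p) (- b p)) (E (- p) h)"
proof -
  have 1: "ordered_monomial k (\<lambda>i. adj K (U i)) (\<lambda>i. nat (b p i)) (E 0 h) = E (- b p) h"
  proof -
    have "adj K (U i) ^^ nat (b p i) = zpower K (U i) (- b p i)" for i
      by (auto simp: zpower_def b_def)
    then have "ordered_monomial k (\<lambda>i. adj K (U i)) (\<lambda>i. nat (b p i)) (E 0 h)
        = fprod (\<lambda>i. zpower K (U i) ((- b p) i)) [1..<Suc k] (E 0 h)"
      by (simp add: ordered_monomial_fprod del: upt_Suc)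
    also have "\<dots> = E (- b p) h" by (simp only: fprod_zpower[OF h] twist_0_right K.vs.scale_one add_0)
    finally show ?thesis .
  qed
  have 2: "ordered_monomial k U (\<lambda>i. nat (a p i)) (E (- b p) h) = hscale K (c (a p) (- b p)) (E (- p) h)"
  proof -
    have "U i ^^ nat (a p i) = zpower K (U i) (a p i)" for i
      by (auto simp: zpower_def a_def)
    then have "ordered_monomial k U (\<lambda>i. nat (a p i)) (E (- b p) h)
        = fprod (\<lambda>i. zpower K (U i) (a p i)) [1..<Suc k] (E (- b p) h)"
      by (simp add: ordered_monomial_fprod del: upt_Suc)
    also have "\<dots> = hscale K (c (a p) (- b p)) (E (- b p + a p) h)" by (rule fprod_zpower[OF h])
    also have "- b p + a p = - p" by (auto simp: a_def b_def fun_eq_iff)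
    finally show ?thesis .
  qed
  show ?thesis using 1 2 unfolding mixed_monomial_def a_def b_def by simp
qed

text \<open>The ordered product with exponents a is isometric and carries both vectors to phase
  multiples of their translates.\<close>

lemma inner_E_shift:
  assumes h: "h \<in> X" and g: "g \<in> X"
  shows "hinner K (E m h) (E n g) = c a m * cnj (c a n) * hinner K (E (m + a) h) (E (n + a) g)"
proof -
  let ?W = "fprod (\<lambda>i. zpower K (U i) (a i)) [1..<Suc k]"
  have W: "contraction_op K K ?W"
    by (rule contraction_op_fprod) (auto intro: zpower_contraction)
  have N: "hnorm K (fprod (\<lambda>i. zpower K (U i) (a i)) l x) = hnorm K x"
    if "set l \<subseteq> {1..k}" "x \<in> hcarrier K" for l x
    using that
  proof (induction l)
    case (Cons i l)
    have "fprod (\<lambda>i. zpower K (U i) (a i)) l x \<in> hcarrier K"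
      by (rule fprod_in) (use Cons.prems contraction_op_carrier[OF zpower_contraction] in auto)
    then show ?case using Cons zpower_isometry by simp
  qed simp
  have "set [1..<Suc k] \<subseteq> {1..k}" by auto
  then have "isometry_op K K ?W"
    using contraction_op_linear[OF W] N unfolding isometry_op_def by blast
  then have "hinner K (E m h) (E n g) = hinner K (?W (E m h)) (?W (E n g))"
    using isometry_op_inner[OF K.semi_inner_space_axioms K.semi_inner_space_axioms]
      E_carrier h g by metis
  then show ?thesis
    unfolding fprod_zpower[OF h] fprod_zpower[OF g]
    using E_carrier h g by (simp add: K.inner_scale K.inner_scale_right)
qed

text \<open>A word in any order of its factors sends \<open>E 0 h\<close> to a multiple of a single
  \<open>E n h\<close>, and every \<open>E m h\<close> is an ordered word. Minimality thus becomes
  totality of the family \<open>E\<close>.\<close>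

lemma span_E_zword:
  "closed_span K (case_prod E ` (UNIV \<times> X))
    = closed_span K {zword_op K U w (E 0 h) | w h. w \<in> lists ({1..k} \<times> UNIV) \<and> h \<in> X}"
  (is "closed_span K ?A = closed_span K ?B")
proof
  have A: "?A \<subseteq> hcarrier K" using E_carrier by auto
  have BA: "?B \<subseteq> closed_span K ?A"
  proof
    fix y assume "y \<in> ?B"
    then obtain w h where w: "w \<in> lists ({1..k} \<times> UNIV)" "h \<in> X" "y = zword_op K U w (E 0 h)" by blast
    obtain d n where "y = hscale K d (E n h)" using zword_E[OF w(1,2), of 0] w(3) by metis
    moreover have "E n h \<in> ?A" using w by (auto intro: image_eqI[of _ _ "(n, h)"])
    ultimately show "y \<in> closed_span K ?A"
      using K.span_closed_span[OF A K.vs.span_scale[OF K.vs.span_base]] by simp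
  qed
  then show "closed_span K ?B \<subseteq> closed_span K ?A" by (rule K.closed_span_minimal[OF A])
  have B: "?B \<subseteq> hcarrier K" using BA K.closed_span_carrier[OF A] by blast
  have "?A \<subseteq> ?B"
  proof
    fix y assume "y \<in> ?A"
    then obtain m h where y: "h \<in> X" "y = E m h" by auto
    have "map (\<lambda>i. (i, m i)) [1..<Suc k] \<in> lists ({1..k} \<times> UNIV)" by auto
    moreover have "y = zword_op K U (map (\<lambda>i. (i, m i)) [1..<Suc k]) (E 0 h)"
      unfolding y(2) by (rule E_zword[OF y(1)])
    ultimately show "y \<in> ?B" using y(1) by blast
  qed
  moreover have "?B \<subseteq> closed_span K ?B"
    by (rule subsetI) (rule K.closed_span_base[OF B])
  ultimately have "?A \<subseteq> closed_span K ?B" by (rule subset_trans)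
  then show "closed_span K ?A \<subseteq> closed_span K ?B"
    by (rule K.closed_span_minimal[OF B])
qed

end

text \<open>For the first relation, apply the hypothesis to U_i x and multiply by U_i, so that both
  adjoints cancel. The second is the hypothesis for (j, i) combined with the symmetry of
  \<open>lam\<close>.\<close>

lemma doubly_commuting_commute:
  assumes K: "complex_hilbert_space K" and U: "\<And>i. i \<in> {1..k} \<Longrightarrow> unitary_op K K (U i)"
    and tw: "twisting k lam" and dc: "doubly_commuting k lam K U"
    and ij: "i \<in> {1..k}" "j \<in> {1..k}" "i \<noteq> j" and x: "x \<in> hcarrier K"
  shows "U i (U j x) = hscale K (lam i j) (U j (U i x))"
    and "U i (adj K (U j) x) = hscale K (cnj (lam i j)) (adj K (U j) (U i x))"
proof -
  interpret K: complex_hilbert_space K by fact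
  interpret twisting k lam by fact
  have c1: "lam i j * cnj (lam i j) = 1"
    using complex_norm_square[of "lam i j"] cmod_lam[OF ij] by simp
  note Uc = unitary_op_carrier[OF U] and UL = unitary_op_linear[OF U]
  note Ac = contraction_op_carrier[OF K.contraction_op_adj[OF unitary_op_contraction[OF U]]]
  have dc': "adj K (U i) (U j y) = hscale K (cnj (lam i j)) (U j (adj K (U i) y))"
    if "i \<in> {1..k}" "j \<in> {1..k}" "i \<noteq> j" "y \<in> hcarrier K" for i j y
    using dc that unfolding doubly_commuting_def by blast
  have "U j (U i x) = U i (adj K (U i) (U j (U i x)))"
    using K.adj_unitary_right[OF U] ij x Uc by simp
  also have "\<dots> = U i (hscale K (cnj (lam i j)) (U j x))"
    using dc'[OF ij, of "U i x"] ij x Uc K.adj_unitary_left[OF U] by simp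
  also have "\<dots> = hscale K (cnj (lam i j)) (U i (U j x))"
    using linear_op_scale[OF UL] ij x Uc by simp
  finally show "U i (U j x) = hscale K (lam i j) (U j (U i x))"
    using c1 by (simp add: mult.commute)
  have "hscale K (cnj (lam j i)) (U i (adj K (U j) x)) = adj K (U j) (U i x)"
    using dc'[of j i x] ij x by simp
  then have "hscale K (lam i j) (U i (adj K (U j) x)) = adj K (U j) (U i x)"
    using lam_swap[OF ij] by simp
  then have "hscale K (cnj (lam i j)) (adj K (U j) (U i x)) = hscale K (cnj (lam i j) * lam i j) (U i (adj K (U j) x))"
    by (metis K.vs.scale_scale)
  then show "U i (adj K (U j) x) = hscale K (cnj (lam i j)) (adj K (U j) (U i x))"
    using c1 by (simp add: mult.commute)
qed

text \<open>Equips an arbitrary doubly commuting tuple with the family \<open>E\<close> used for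
  comparison. A factor U_i in front of an ordered product moves past the factors below i, also at
  negative powers, and joins the i-th.\<close>

lemma shift_system_of_unitaries:
  assumes K: "complex_hilbert_space K" and U: "\<And>i. i \<in> {1..k} \<Longrightarrow> unitary_op K K (U i)"
    and tw: "twisting k lam" and dc: "doubly_commuting k lam K U"
    and J: "\<And>h. h \<in> X \<Longrightarrow> J h \<in> hcarrier K"
  defines "E \<equiv> \<lambda>m h. zword_op K U (map (\<lambda>i. (i, m i)) [1..<Suc k]) (J h)"
  shows "shift_system k lam K U E X" and "E 0 = J"
proof -
  interpret K: complex_hilbert_space K by fact
  interpret twisting k lam by fact
  have E: "E m h = fprod (\<lambda>i. zpower K (U i) (m i)) [1..<Suc k] (J h)" for m h
    unfolding E_def zword_op_fprod fprod_map by simp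
  have Z: "contraction_op K K (zpower K (U i) z)" if "i \<in> {1..k}" for i z
    unfolding zpower_def
    using that by (simp add: contraction_op_funpow K.contraction_op_adj unitary_op_contraction[OF U])
  note Uc = unitary_op_carrier[OF U] and UL = unitary_op_linear[OF U]
  note Zc = contraction_op_carrier[OF Z] and ZL = contraction_op_linear[OF Z]
  have pow: "U i ((A ^^ n) x) = hscale K (d ^ n) ((A ^^ n) (U i x))"
    if i: "i \<in> {1..k}" and x: "x \<in> hcarrier K" and A: "contraction_op K K A"
      and s: "\<And>x. x \<in> hcarrier K \<Longrightarrow> U i (A x) = hscale K d (A (U i x))" for i A d n x
  proof (induction n)
    case (Suc n)
    note Ac = contraction_op_carrier[OF contraction_op_funpow[OF A]]
    have "U i ((A ^^ Suc n) x) = hscale K d (A (U i ((A ^^ n) x)))" using s[OF Ac[OF x]] by simp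
    then show ?case
      using Suc linear_op_scale[OF contraction_op_linear[OF A] Ac[OF Uc[OF i x]]] by simp
  qed simp
  have comm: "U i (zpower K (U j) z x) = hscale K (lam i j powi z) (zpower K (U j) z (U i x))"
    if i: "i \<in> {1..k}" and j: "j \<in> {1..k}" and ij: "i \<noteq> j" and x: "x \<in> hcarrier K" for i j z x
  proof (cases "0 \<le> z")
    case True
    then show ?thesis
      using pow[OF i x unitary_op_contraction[OF U[OF j]] doubly_commuting_commute(1)[OF K U tw dc i j ij]]
      by (simp add: zpower_def power_int_def)
  next
    case False
    have "cnj (lam i j) = inverse (lam i j)"
      using complex_norm_square[of "lam i j"] cmod_lam[OF i j ij] by (intro inverse_unique[symmetric]) simp
    then show ?thesis
      using False pow[OF i x K.contraction_op_adj[OF unitary_op_contraction[OF U[OF j]]]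
          doubly_commuting_commute(2)[OF K U tw dc i j ij]]
      by (simp add: zpower_def power_int_def power_inverse)
  qed
  show "shift_system k lam K U E X"
  proof (intro shift_system.intro shift_system_axioms.intro tw K U)
    show Ec: "E m h \<in> hcarrier K" if "h \<in> X" for m h
      unfolding E by (rule fprod_in) (use Zc J[OF that] in auto)
    show "E m h = E n h" if "h \<in> X" "\<And>i. i \<in> {1..k} \<Longrightarrow> m i = n i" for m n h
      unfolding E by (rule fprod_cong) (use that in auto)
    show "U i (E m h) = hscale K (c (single i 1) m) (E (m + single i 1) h)"
      if i: "i \<in> {1..k}" and h: "h \<in> X" for i m h
    proof -
      let ?P = "\<lambda>i. zpower K (U i) (m i)"
      have "U i (E m h) = hscale K (c (single i 1) m) (fprod (?P(i := U i \<circ> ?P i)) [1..<Suc k] (J h))"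
        unfolding E
        by (rule fprod_insert[where V = "hcarrier K"])
           (use i J[OF h] K.vector_space Zc Uc linear_op_scale[OF ZL] comm in auto)
      also have "fprod (?P(i := U i \<circ> ?P i)) [1..<Suc k] (J h) = E (m + single i 1) h"
      proof -
        have suc: "U i (zpower K (U i) z x) = zpower K (U i) (z + 1) x" if x: "x \<in> hcarrier K" for x z
        proof (cases "0 \<le> z")
          case True
          then have "nat (z + 1) = Suc (nat z)" by simp
          then show ?thesis using True by (simp add: zpower_def)
        next
          \<comment> \<open>For z = - (n + 1), U_i cancels one of the n + 1 adjoints.\<close>
          case False
          then obtain n where n: "nat (- z) = Suc n" by (cases "nat (- z)") auto
          then have z: "z = - int (Suc n)" by simp
          have "(adj K (U i) ^^ n) x \<in> hcarrier K"
            using contraction_op_carrier[OF contraction_op_funpow[OF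
                  K.contraction_op_adj[OF unitary_op_contraction[OF U[OF i]]]] x] .
          then have "U i (zpower K (U i) z x) = (adj K (U i) ^^ n) x"
            using K.adj_unitary_right[OF U[OF i]] n False by (simp add: zpower_def)
          also have "\<dots> = zpower K (U i) (z + 1) x"
            unfolding z by (cases n) (simp_all add: zpower_def nat_add_distrib)
          finally show ?thesis .
        qed
        have N: "fprod (?P(i := U i \<circ> ?P i)) l (J h) = fprod (\<lambda>j. zpower K (U j) ((m + single i 1) j)) l (J h)"
          if "set l \<subseteq> {1..k}" for l
          using that
        proof (induction l)
          case (Cons j l)
          have "fprod (\<lambda>j. zpower K (U j) ((m + single i 1) j)) l (J h) \<in> hcarrier K"
            by (rule fprod_in) (use Cons.prems Zc J[OF h] in auto)
          then show ?case using Cons suc by (cases "j = i") auto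
        qed simp
        have "set [1..<Suc k] \<subseteq> {1..k}" by auto
        then show ?thesis unfolding E by (rule N)
      qed
      finally show ?thesis .
    qed
  qed
  have "fprod (\<lambda>i. zpower K (U i) (0 i)) l x = x" for l x
    by (induction l) (auto simp: zpower_def)
  then show "E 0 = J" unfolding E[abs_def] by blast
qed

section \<open>The dilation\<close>

text \<open>Translates the compressions in (i) and (ii) into equalities of inner products against
  vectors of \<open>H\<close>, which are what the kernel computes.\<close>

lemma orth_proj_range_iff:
  assumes H: "complex_hilbert_space H" and K: "complex_hilbert_space K" and J: "isometry_op H K J"
    and x: "x \<in> hcarrier K" and y: "y \<in> hcarrier H"
  shows "orth_proj K (J ` hcarrier H) x = J y \<longleftrightarrow> (\<forall>g\<in>hcarrier H. hinner K x (J g) = hinner H y g)"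
proof -
  interpret H: complex_hilbert_space H by fact
  interpret K: complex_hilbert_space K by fact
  note JL = isometry_op_linear[OF J] and Jc = isometry_op_carrier[OF J]
    and Ji = isometry_op_inner[OF H.semi_inner_space_axioms K.semi_inner_space_axioms J]
  have M: "K.vs.subspace (J ` hcarrier H)"
  proof (rule K.vs.subspaceI)
    show "0 \<in> J ` hcarrier H"
      using linear_op_0[OF JL H.semi_inner_space_axioms] H.carrier_0 by (metis imageI)
    show "u + v \<in> J ` hcarrier H" if "u \<in> J ` hcarrier H" "v \<in> J ` hcarrier H" for u v
      using that linear_op_add[OF JL] by (metis (no_types, lifting) H.carrier_add image_iff)
    show "hscale K d u \<in> J ` hcarrier H" if "u \<in> J ` hcarrier H" for d u
      using that linear_op_scale[OF JL] by (metis (no_types, lifting) H.carrier_scale image_iff)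
  qed
  have Mc: "J ` hcarrier H \<subseteq> hcarrier K" using Jc by auto
  show ?thesis
  proof
    assume eq: "orth_proj K (J ` hcarrier H) x = J y"
    \<comment> \<open>The projection exists by Riesz representation in \<open>H\<close>; only then
      does the equation for \<open>orth_proj\<close> say something.\<close>
    obtain y' where y': "y' \<in> hcarrier H" "\<And>h. h \<in> hcarrier H \<Longrightarrow> hinner K (J h) x = hinner H h y'"
    proof (rule H.Riesz_representation[of "\<lambda>h. hinner K (J h) x" "hnorm K x"])
      fix h assume h: "h \<in> hcarrier H"
      then show "cmod (hinner K (J h) x) \<le> hnorm K x * hnorm H h"
        using K.Cauchy_Schwarz[OF Jc[OF h] x] J by (simp add: isometry_op_def mult.commute)
    qed (use x Jc in \<open>auto simp: linear_op_add[OF JL] linear_op_scale[OF JL] K.inner_add K.inner_scale\<close>)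
    have "hinner K x (J h) = hinner K (J y') (J h)" if "h \<in> hcarrier H" for h
      using y'(2)[OF that] Ji[OF y'(1) that] K.inner_cnj[OF Jc[OF that] x] H.inner_cnj[OF that y'(1)] by simp
    then have "\<exists>z\<in>J ` hcarrier H. \<forall>u\<in>J ` hcarrier H. hinner K x u = hinner K z u"
      using y'(1) by auto
    then have "hinner K x (J g) = hinner K (J y) (J g)" if "g \<in> hcarrier H" for g
      using K.orth_projD[OF M Mc x imageI[OF y] _ eq imageI[OF that]] by blast
    then show "\<forall>g\<in>hcarrier H. hinner K x (J g) = hinner H y g" using Ji y by simp
  next
    assume "\<forall>g\<in>hcarrier H. hinner K x (J g) = hinner H y g"
    then show "orth_proj K (J ` hcarrier H) x = J y"
      by (intro K.orth_proj_eqI[OF M Mc x]) (use y Ji in auto)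
  qed
qed

lemma contraction_op_closed_span:
  assumes K: "complex_hilbert_space K" and A: "contraction_op K K A" and S: "S \<subseteq> hcarrier K"
    and AS: "\<And>s. s \<in> S \<Longrightarrow> A s \<in> closed_span K S" and x: "x \<in> closed_span K S"
  shows "A x \<in> closed_span K S"
proof -
  interpret K: complex_hilbert_space K by fact
  note L = contraction_op_linear[OF A]
  note sub = K.subspace_closed_span[OF S]
  have sp: "y \<in> hcarrier K \<and> A y \<in> closed_span K S" if "y \<in> K.vs.span S" for y
    using that
  proof (induction rule: K.vs.span_induct_alt)
    case base
    show ?case using linear_op_0[OF L K.semi_inner_space_axioms] K.vs.subspace_0[OF sub] by simp
  next
    case (step c y z)
    then have "y \<in> hcarrier K" using S by auto
    then show ?case using step AS K.vs.subspace_add[OF sub] K.vs.subspace_scale[OF sub]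
      by (simp add: linear_op_add[OF L] linear_op_scale[OF L])
  qed
  obtain u where u: "\<And>n. u n \<in> K.vs.span S" "(\<lambda>n. hnorm K (u n - x)) \<longlonglongrightarrow> 0"
    using K.closed_span_seq[OF S x] by blast
  have xc: "x \<in> hcarrier K" using x K.closed_span_carrier[OF S] by blast
  show ?thesis
    by (rule K.closed_spanI_seq[OF S _ _ contraction_op_tendsto[OF K K A _ xc u(2)]])
       (use sp u xc contraction_op_carrier[OF A] in auto)
qed

lemma ordered_monomial_word: "ordered_monomial k A a = word_op A (map (\<lambda>i. (i, a i)) [1..<Suc k])"
proof
  show "ordered_monomial k A a x = word_op A (map (\<lambda>i. (i, a i)) [1..<Suc k]) x" for x
    by (simp add: ordered_monomial_fprod word_op_fprod fprod_map del: upt_Suc)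
qed

text \<open>\<open>c\<close> sees only decreasing index pairs, so one of the two values is 1; its
  asymmetry recovers \<open>lam\<close>.\<close>

lemma (in twisting) twist_single_swap:
  assumes "i \<in> {1..k}" "j \<in> {1..k}" "i \<noteq> j"
  shows "c (single i 1) (single j 1) = lam i j * c (single j 1) (single i 1)"
proof -
  have "lam i j * lam j i = 1"
    using lam_swap[OF assms] complex_norm_square[of "lam i j"] cmod_lam[OF assms] by simp
  then show ?thesis
    using assms by (auto simp: twist_single_single power_int_def)
qed

context polyball
begin

lemma T_monomial_carrier: "h \<in> hcarrier H \<Longrightarrow> ordered_monomial k T a h \<in> hcarrier H"
  unfolding ordered_monomial_fprod
  by (rule fprod_in) (use contraction_op_carrier[OF contraction_op_funpow[OF T_contraction]] in auto)

lemma mixed_monomial_T: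
  "mixed_monomial k H T p h = ordered_monomial k T (\<lambda>i. nat (max (- p i) 0)) (S.mon (\<lambda>i. max (p i) 0) h)"
proof -
  have "(\<lambda>i. adj H (T i)) = S" by (simp add: fun_eq_iff S_def)
  then show ?thesis by (simp add: mixed_monomial_def S.mon_def)
qed

lemma mixed_monomial_T_carrier: "h \<in> hcarrier H \<Longrightarrow> mixed_monomial k H T p h \<in> hcarrier H"
  unfolding mixed_monomial_T by (intro T_monomial_carrier S.mon_carrier)

end

text \<open>Translation by \<open>- n\<close> brings the second vector to index 0, where (ii)
  applies with the exponent \<open>n - m\<close>. The right-hand side depends on \<open>lam\<close>,
  \<open>H\<close> and \<open>T\<close> only, so it is the same for every regular dilation.\<close>

lemma (in shift_system) regular_gram:
  fixes m n :: "nat \<Rightarrow> int"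
  assumes pb: "polyball k lam H T" and X: "X = hcarrier H" and J: "isometry_op H K (E 0)"
    and reg: "regular_dilates k H T K (E 0) U"
    and h: "h \<in> hcarrier H" and g: "g \<in> hcarrier H"
  defines "a \<equiv> \<lambda>i. max (m i - n i) 0" and "b \<equiv> \<lambda>i. max (n i - m i) 0"
  shows "hinner K (E m h) (E n g) = c (- n) m * cnj (c (- n) n) * inverse (c a (- b))
    * hinner H (mixed_monomial k H T (n - m) h) g"
proof -
  interpret polyball k lam H T by fact
  have hX: "h \<in> X" "g \<in> X" using h g X by auto
  have ab: "(\<lambda>i. max (- (n - m) i) 0) = a" "(\<lambda>i. max ((n - m) i) 0) = b"
    by (auto simp: a_def b_def)
  have mm: "mixed_monomial k K U (n - m) (E 0 h) = hscale K (c a (- b)) (E (m - n) h)"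
    using mixed_monomial_E[OF hX(1), of "n - m"] unfolding ab by simp
  then have c: "mixed_monomial k K U (n - m) (E 0 h) \<in> hcarrier K"
    using E_carrier[OF hX(1)] by simp
  have "orth_proj K (E 0 ` hcarrier H) (mixed_monomial k K U (n - m) (E 0 h)) = E 0 (mixed_monomial k H T (n - m) h)"
    using reg h unfolding regular_dilates_def by blast
  then have "hinner K (mixed_monomial k K U (n - m) (E 0 h)) (E 0 g) = hinner H (mixed_monomial k H T (n - m) h) g"
    using orth_proj_range_iff[OF H.complex_hilbert_space_axioms K.complex_hilbert_space_axioms J c
        mixed_monomial_T_carrier[OF h]] g by blast
  then have "c a (- b) * hinner K (E (m - n) h) (E 0 g) = hinner H (mixed_monomial k H T (n - m) h) g"
    unfolding mm using E_carrier hX by (simp add: K.inner_scale)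
  then have "hinner K (E (m - n) h) (E 0 g) = inverse (c a (- b)) * hinner H (mixed_monomial k H T (n - m) h) g"
    using twist_nonzero[of a "- b"] by (simp add: field_simps)
  moreover have "hinner K (E m h) (E n g) = c (- n) m * cnj (c (- n) n) * hinner K (E (m - n) h) (E 0 g)"
    using inner_E_shift[OF hX, of m n "- n"] by simp
  ultimately show ?thesis by simp
qed

locale kernel_dilation = polyball k lam H T + shift_system k lam K U E "hcarrier H"
  for k lam and H :: "'a::ab_group_add hspace" and T and K :: "'b::ab_group_add hspace" and U E +
  assumes gram: "h \<in> hcarrier H \<Longrightarrow> g \<in> hcarrier H \<Longrightarrow> hinner K (E m h) (E n g) = S.ker m h n g"
    and dense: "closed_span K (case_prod E ` (UNIV \<times> hcarrier H)) = hcarrier K"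
    and E_linear: "linear_op H K (E m)"
begin

section \<open>The analytic part and the isometries on it\<close>

definition L :: "'b hspace" where
  "L = K\<lparr>hcarrier := analytic_part k H K (E 0) U\<rparr>"

definition V :: "nat \<Rightarrow> 'b \<Rightarrow> 'b" where
  "V i = restrict (U i) (hcarrier L)"

definition G :: "'b set" where
  "G = {word_op U w (E 0 h) | w h. w \<in> lists ({1..k} \<times> UNIV) \<and> h \<in> hcarrier H}"

definition N :: "(nat \<Rightarrow> int) set" where
  "N = {m. \<forall>i\<in>{1..k}. 0 \<le> m i}"

definition P :: "((nat \<Rightarrow> int) \<times> 'a) set" where
  "P = N \<times> hcarrier H"

lemma N_0 [simp]: "0 \<in> N"
  by (simp add: N_def)

lemma N_add_single: "m \<in> N \<Longrightarrow> 0 \<le> t \<Longrightarrow> m + single i t \<in> N"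
  by (auto simp: N_def single_def)

lemma N_diff_single: "m \<in> N \<Longrightarrow> i \<in> {1..k} \<Longrightarrow> m i \<noteq> 0 \<Longrightarrow> m - single i 1 \<in> N"
  by (force simp: N_def single_def)

lemma isometry_E0: "isometry_op H K (E 0)"
  using E_linear gram S.ker_same unfolding isometry_op_def by (simp add: hnorm_def)

lemma word_E:
  assumes w: "w \<in> lists ({1..k} \<times> UNIV)" and h: "h \<in> hcarrier H"
  obtains d n where "n \<in> N" "word_op U w (E 0 h) = hscale K d (E n h)"
proof -
  have "\<exists>d n. n \<in> N \<and> word_op U w (E 0 h) = hscale K d (E n h)"
    using w
  proof (induction w)
    case Nil
    have "0 \<in> N \<and> word_op U [] (E 0 h) = hscale K 1 (E 0 h)" by (simp add: word_op_fprod)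
    then show ?case by blast
  next
    case (Cons p w)
    obtain i z where p: "p = (i, z)" "i \<in> {1..k}" using Cons by (cases p) auto
    obtain d n where IH: "n \<in> N" "word_op U w (E 0 h) = hscale K d (E n h)" using Cons by blast
    have "U i ^^ z = zpower K (U i) (int z)" by (simp add: zpower_def)
    then have "word_op U (p # w) (E 0 h) = hscale K (d * c (single i (int z)) n) (E (n + single i (int z)) h)"
      using IH(2) linear_op_scale[OF contraction_op_linear[OF zpower_contraction[OF p(2)]] E_carrier[OF h]]
        zpower_shift[OF p(2) h] by (simp add: word_op_fprod p(1))
    moreover have "n + single i (int z) \<in> N" using IH(1) by (simp add: N_add_single)
    ultimately show ?case by blast
  qed
  with that show ?thesis by blast
qed

lemma E_word:
  assumes m: "m \<in> N" and h: "h \<in> hcarrier H"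
  shows "E m h = word_op U (map (\<lambda>i. (i, nat (m i))) [1..<Suc k]) (E 0 h)"
proof -
  have "word_op U (map (\<lambda>i. (i, nat (m i))) [1..<Suc k])
      = zword_op K U (map (\<lambda>(i, p). (i, int p)) (map (\<lambda>i. (i, nat (m i))) [1..<Suc k]))"
    by (rule word_zword)
  also have "map (\<lambda>(i, p). (i, int p)) (map (\<lambda>i. (i, nat (m i))) [1..<Suc k]) = map (\<lambda>i. (i, m i)) [1..<Suc k]"
    using m by (auto simp: N_def)
  finally show ?thesis using E_zword[OF h, of m] by metis
qed

lemma G_carrier: "G \<subseteq> hcarrier K"
proof
  fix y assume "y \<in> G"
  then obtain w h where "w \<in> lists ({1..k} \<times> UNIV)" "h \<in> hcarrier H" "y = word_op U w (E 0 h)"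
    by (auto simp: G_def)
  then show "y \<in> hcarrier K" using word_E E_carrier K.carrier_scale by metis
qed

lemma P_carrier: "case_prod E ` P \<subseteq> hcarrier K"
  using E_carrier by (auto simp: P_def)

lemma E_in_G: "case_prod E ` P \<subseteq> G"
proof
  fix y assume "y \<in> case_prod E ` P"
  then obtain m h where y: "y = E m h" "m \<in> N" "h \<in> hcarrier H"
    by (auto simp: P_def)
  have "map (\<lambda>i. (i, nat (m i))) [1..<Suc k] \<in> lists ({1..k} \<times> UNIV)" by auto
  then show "y \<in> G" using E_word[OF y(2,3)] y(1,3) unfolding G_def by blast
qed

lemma L_carrier: "hcarrier L = closed_span K G"
  by (simp add: L_def analytic_part_def G_def)

lemma L_eq: "L = K\<lparr>hcarrier := closed_span K G\<rparr>"
  by (simp add: L_def analytic_part_def G_def)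

lemma L_simps [simp]: "hscale L = hscale K" "hinner L = hinner K" "hnorm L = hnorm K"
  by (simp_all add: L_def K.hnorm_restrict)

sublocale L: complex_hilbert_space L
  unfolding L_eq by (rule K.complex_hilbert_space_closed_span[OF G_carrier])

text \<open>Replaces words of arbitrary order by the vectors \<open>E m h\<close> with nonnegative
  m, on which the adjoints of \<open>V\<close> have explicit formulas.\<close>

lemma L_span: "closed_span K (case_prod E ` P) = hcarrier L"
proof
  show "closed_span K (case_prod E ` P) \<subseteq> hcarrier L"
    unfolding L_carrier
    by (rule K.closed_span_minimal[OF G_carrier], rule subset_trans[OF E_in_G], rule subsetI,
        rule K.closed_span_base[OF G_carrier])
  show "hcarrier L \<subseteq> closed_span K (case_prod E ` P)"
    unfolding L_carrier
  proof (rule K.closed_span_minimal[OF P_carrier], rule subsetI)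
    fix y assume "y \<in> G"
    then obtain w h where y: "w \<in> lists ({1..k} \<times> UNIV)" "h \<in> hcarrier H" "y = word_op U w (E 0 h)"
      by (auto simp: G_def)
    obtain d n where n: "n \<in> N" "word_op U w (E 0 h) = hscale K d (E n h)"
      using word_E[OF y(1,2)] by blast
    have "E n h \<in> case_prod E ` P" using n(1) y(2) by (auto simp: P_def intro: image_eqI[of _ _ "(n, h)"])
    then show "y \<in> closed_span K (case_prod E ` P)"
      unfolding y(3) n(2) by (intro K.span_closed_span[OF P_carrier] K.vs.span_scale K.vs.span_base)
  qed
qed

lemma L_subset: "hcarrier L \<subseteq> hcarrier K"
  unfolding L_carrier by (rule K.closed_span_carrier[OF G_carrier])

lemma E_in_L: "m \<in> N \<Longrightarrow> h \<in> hcarrier H \<Longrightarrow> E m h \<in> hcarrier L"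
  unfolding L_span[symmetric]
  by (rule K.closed_span_base[OF P_carrier]) (auto simp: P_def intro: image_eqI[of _ _ "(m, h)"])

lemma U_L: "i \<in> {1..k} \<Longrightarrow> x \<in> hcarrier L \<Longrightarrow> U i x \<in> hcarrier L"
  unfolding L_span[symmetric]
proof (rule contraction_op_closed_span[OF K.complex_hilbert_space_axioms U_contraction P_carrier])
  fix s assume i: "i \<in> {1..k}" and "s \<in> case_prod E ` P"
  then obtain m h where s: "s = E m h" "m \<in> N" "h \<in> hcarrier H"
    by (auto simp: P_def)
  have "E (m + single i 1) h \<in> hcarrier L" by (rule E_in_L[OF N_add_single[OF s(2)] s(3)]) simp
  then show "U i s \<in> closed_span K (case_prod E ` P)"
    unfolding s(1) E_shift[OF i s(3)] L_span using L.carrier_scale by simp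
qed

lemma L_span_L: "closed_span L (case_prod E ` P) = hcarrier L"
  unfolding L_eq
  by (subst K.closed_span_restrict[OF G_carrier])
     (use L_span K.closed_span_base[OF P_carrier] in \<open>auto simp: L_carrier\<close>)

lemma P_L: "case_prod E ` P \<subseteq> hcarrier L"
  using E_in_L by (auto simp: P_def)

lemma V_eq: "x \<in> hcarrier L \<Longrightarrow> V i x = U i x"
  by (simp add: V_def)

lemma V_isometry: "i \<in> {1..k} \<Longrightarrow> isometry_op L L (V i)"
proof -
  assume i: "i \<in> {1..k}"
  note U = unitary_op_isometry[OF unitary[OF i]]
  have c: "x \<in> hcarrier K" if "x \<in> hcarrier L" for x using that L_subset by blast
  have s: "hscale K d x \<in> hcarrier L" if "x \<in> hcarrier L" for d x using L.carrier_scale[OF that] by simp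
  show ?thesis
    unfolding isometry_op_def linear_op_def
    using U U_L[OF i] by (auto simp: V_eq c s isometry_op_def linear_op_def)
qed

text \<open>If m i > 0, the adjoint of \<open>U i\<close> already maps \<open>E m h\<close> into
  \<open>L\<close>. If m i = 0, its value may leave \<open>L\<close>; testing against
  \<open>E n g\<close> with n i \<ge> 0 = m i then puts \<open>ker_raise\<close> to use.\<close>

lemma adj_V:
  assumes i: "i \<in> {1..k}" and m: "m \<in> N" and h: "h \<in> hcarrier H"
  shows "m i = 0 \<Longrightarrow> adj L (V i) (E m h)
      = hscale K (c (- single i 1) m * c m (single i 1)) (E m (S i h))"
    and "m i \<noteq> 0 \<Longrightarrow> adj L (V i) (E m h) = hscale K (c (- single i 1) m) (E (m - single i 1) h)"
proof -
  let ?e = "single i 1"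
  note V = isometry_op_contraction[OF V_isometry[OF i]]
  have Sh: "S i h \<in> hcarrier H" using S_carrier[OF i h] .
  {
    assume mi: "m i = 0"
    show "adj L (V i) (E m h) = hscale K (c (- ?e) m * c m ?e) (E m (S i h))"
    proof (rule L.adj_eqI_dense[OF V P_L L_span_L])
      show "E m h \<in> hcarrier L" by (rule E_in_L[OF m h])
      show "hscale K (c (- ?e) m * c m ?e) (E m (S i h)) \<in> hcarrier L"
        using L.carrier_scale[OF E_in_L[OF m Sh]] by simp
      fix z assume "z \<in> case_prod E ` P"
      then obtain n g where z: "z = E n g" "n \<in> N" "g \<in> hcarrier H"
        by (auto simp: P_def)
      have zL: "z \<in> hcarrier L" unfolding z(1) by (rule E_in_L[OF z(2,3)])
      have "hinner K (U i z) (E m h) = c ?e n * S.ker (n + ?e) g m h"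
        using z h E_carrier by (simp add: E_shift[OF i z(3)] K.inner_scale gram)
      also have "\<dots> = c ?e n * (cnj (c ?e n) * c ?e m * cnj (c m ?e) * S.ker n g m (S i h))"
        using S.ker_raise[OF i _ h z(3), of m n] z(2) i mi by (simp add: N_def)
      also have "\<dots> = cnj (c (- ?e) m * c m ?e) * S.ker n g m (S i h)"
        by (simp add: twist_simps)
      also have "\<dots> = hinner K z (hscale K (c (- ?e) m * c m ?e) (E m (S i h)))"
        using z h Sh E_carrier by (simp add: K.inner_scale_right gram)
      finally show "hinner L (V i z) (E m h) = hinner L z (hscale K (c (- ?e) m * c m ?e) (E m (S i h)))"
        by (simp add: V_eq[OF zL])
    qed
  next
    assume mi: "m i \<noteq> 0"
    have m': "m - ?e \<in> N" by (rule N_diff_single[OF m i mi])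
    show "adj L (V i) (E m h) = hscale K (c (- ?e) m) (E (m - ?e) h)"
    proof (rule L.adj_eqI)
      show "hscale K (c (- ?e) m) (E (m - ?e) h) \<in> hcarrier L"
        using L.carrier_scale[OF E_in_L[OF m' h]] by simp
      fix z assume z: "z \<in> hcarrier L"
      then have "hinner K (U i z) (E m h) = hinner K z (adj K (U i) (E m h))"
        using K.adj_exists(2)[OF U_contraction[OF i] E_carrier[OF h]] L_subset by blast
      then show "hinner L (V i z) (E m h) = hinner L z (hscale K (c (- ?e) m) (E (m - ?e) h))"
        unfolding adj_shift[OF i h] using z by (simp add: V_eq single_uminus)
    qed
  }
qed

lemma adj_V_E0: "i \<in> {1..k} \<Longrightarrow> h \<in> hcarrier H \<Longrightarrow> adj L (V i) (E 0 h) = E 0 (S i h)"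
  using adj_V(1)[OF _ N_0, of i h] by simp

text \<open>The discrepancy between the two orders of an adjoint step in i and a forward step in j;
  all phases involving m cancel.\<close>

lemma doubly_commuting_phase:
  assumes ij: "i \<in> {1..k}" "j \<in> {1..k}" "i \<noteq> j"
  shows "c (- single i 1) (single j 1) * c (single j 1) (single i 1) = cnj (lam i j)"
proof -
  have "cnj (lam i j) = inverse (lam i j)"
    using complex_norm_square[of "lam i j"] cmod_lam[OF ij] by (intro inverse_unique[symmetric]) simp
  then show ?thesis
    using twist_single_swap[OF ij] by (simp add: twist_simps)
qed

lemma doubly_commuting_K: "doubly_commuting k lam K U"
  unfolding doubly_commuting_def
proof (intro ballI impI)
  fix i j x assume i: "i \<in> {1..k}" and j: "j \<in> {1..k}" and ij: "i \<noteq> j" and x: "x \<in> hcarrier K"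
  have lam1: "cmod (cnj (lam i j)) = 1" using cmod_lam[OF i j ij] by simp
  note ph = doubly_commuting_phase[OF i j ij]
  show "adj K (U i) (U j x) = hscale K (cnj (lam i j)) (U j (adj K (U i) x))"
  proof (rule contraction_ops_agree[where x = x and A = "\<lambda>x. adj K (U i) (U j x)" and
        B = "\<lambda>x. hscale K (cnj (lam i j)) (U j (adj K (U i) x))", OF K.complex_hilbert_space_axioms K.complex_hilbert_space_axioms])
    show "case_prod E ` (UNIV \<times> hcarrier H) \<subseteq> hcarrier K" using E_carrier by auto
    show "x \<in> closed_span K (case_prod E ` (UNIV \<times> hcarrier H))" using x dense by simp
    fix y assume "y \<in> case_prod E ` (UNIV \<times> hcarrier H)"
    then obtain m h where y: "y = E m h" and h: "h \<in> hcarrier H" by auto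
    have e: "m + single j 1 - single i 1 = m - single i 1 + single j 1" by (simp add: fun_eq_iff)
    have "adj K (U i) (U j (E m h)) = hscale K (c (single j 1) m * c (- single i 1) (m + single j 1))
        (E (m - single i 1 + single j 1) h)"
      using linear_op_scale[OF contraction_op_linear[OF adj_contraction[OF i]] E_carrier[OF h]]
      by (simp add: E_shift[OF j h] adj_shift[OF i h] e single_uminus)
    also have "c (single j 1) m * c (- single i 1) (m + single j 1)
        = cnj (lam i j) * (c (- single i 1) m * c (single j 1) (m - single i 1))"
      unfolding ph[symmetric] by (simp add: twist_simps)
    also have "hscale K \<dots> (E (m - single i 1 + single j 1) h) = hscale K (cnj (lam i j)) (U j (adj K (U i) (E m h)))"
      using linear_op_scale[OF contraction_op_linear[OF U_contraction[OF j]] E_carrier[OF h]]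
      by (simp add: E_shift[OF j h] adj_shift[OF i h] single_uminus)
    finally show "adj K (U i) (U j y) = hscale K (cnj (lam i j)) (U j (adj K (U i) y))" unfolding y .
  qed (intro contraction_op_scale contraction_op_compose[OF adj_contraction[OF i] U_contraction[OF j]]
      contraction_op_compose[OF U_contraction[OF j] adj_contraction[OF i]] lam1 K.complex_hilbert_space_axioms)+
qed

text \<open>The relation is not simply inherited from \<open>K\<close>, since
  \<open>adj L (V i)\<close> need not be the restriction of \<open>adj K (U i)\<close>. A step in
  direction j \<noteq> i does not affect whether m i = 0, so both sides use the same formula of
  \<open>adj_V\<close>.\<close>

lemma doubly_commuting_L: "doubly_commuting k lam L V"
  unfolding doubly_commuting_def
proof (intro ballI impI)
  fix i j x assume i: "i \<in> {1..k}" and j: "j \<in> {1..k}" and ij: "i \<noteq> j" and x: "x \<in> hcarrier L"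
  have lam1: "cmod (cnj (lam i j)) = 1" using cmod_lam[OF i j ij] by simp
  note ph = doubly_commuting_phase[OF i j ij]
  note V = isometry_op_contraction[OF V_isometry]
  note A = L.contraction_op_adj[OF V]
  note Vs = linear_op_scale[OF contraction_op_linear[OF V], unfolded L_simps]
    and As = linear_op_scale[OF contraction_op_linear[OF A], unfolded L_simps]
  show "adj L (V i) (V j x) = hscale L (cnj (lam i j)) (V j (adj L (V i) x))"
  proof (rule contraction_ops_agree[where x = x and A = "\<lambda>x. adj L (V i) (V j x)" and
        B = "\<lambda>x. hscale L (cnj (lam i j)) (V j (adj L (V i) x))", OF L.complex_hilbert_space_axioms L.complex_hilbert_space_axioms])
    show "case_prod E ` P \<subseteq> hcarrier L" by (rule P_L)
    show "x \<in> closed_span L (case_prod E ` P)" using x L_span_L by simp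
    fix y assume "y \<in> case_prod E ` P"
    then obtain m h where y: "y = E m h" and m: "m \<in> N" and h: "h \<in> hcarrier H"
      by (auto simp: P_def)
    note Sh = S_carrier[OF i h]
    have mj: "m + single j 1 \<in> N" using m by (simp add: N_add_single)
    have VE: "V j (E m' h') = hscale K (c (single j 1) m') (E (m' + single j 1) h')"
      if "m' \<in> N" "h' \<in> hcarrier H" for m' h'
      using V_eq[OF E_in_L[OF that], of j] E_shift[OF j that(2)] by simp
    have 1: "adj L (V i) (V j (E m h)) = hscale K (c (single j 1) m) (adj L (V i) (E (m + single j 1) h))"
      unfolding VE[OF m h] by (rule As[OF i E_in_L[OF mj h]])
    show "adj L (V i) (V j y) = hscale L (cnj (lam i j)) (V j (adj L (V i) y))"
    proof (cases "m i = 0")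
      case True
      have "adj L (V i) (V j (E m h)) = hscale K (c (single j 1) m * (c (- single i 1) (m + single j 1)
          * c (m + single j 1) (single i 1))) (E (m + single j 1) (S i h))"
        unfolding 1 using adj_V(1)[OF i mj h] True ij by simp
      also have "c (single j 1) m * (c (- single i 1) (m + single j 1) * c (m + single j 1) (single i 1))
          = cnj (lam i j) * (c (- single i 1) m * c m (single i 1) * c (single j 1) m)"
        unfolding ph[symmetric] by (simp add: twist_simps)
      also have "hscale K \<dots> (E (m + single j 1) (S i h)) = hscale K (cnj (lam i j)) (V j (adj L (V i) (E m h)))"
        unfolding adj_V(1)[OF i m h True] Vs[OF j E_in_L[OF m Sh]] VE[OF m Sh] by simp
      finally show ?thesis unfolding y by simp
    next
      case False
      have mi: "m - single i 1 \<in> N" by (rule N_diff_single[OF m i False])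
      have e: "m + single j 1 - single i 1 = m - single i 1 + single j 1" by (simp add: fun_eq_iff)
      have "adj L (V i) (V j (E m h)) = hscale K (c (single j 1) m * c (- single i 1) (m + single j 1))
          (E (m - single i 1 + single j 1) h)"
        unfolding 1 using adj_V(2)[OF i mj h] False ij by (simp add: e)
      also have "c (single j 1) m * c (- single i 1) (m + single j 1)
          = cnj (lam i j) * (c (- single i 1) m * c (single j 1) (m - single i 1))"
        unfolding ph[symmetric] by (simp add: twist_simps)
      also have "hscale K \<dots> (E (m - single i 1 + single j 1) h) = hscale K (cnj (lam i j)) (V j (adj L (V i) (E m h)))"
        unfolding adj_V(2)[OF i m h False] Vs[OF j E_in_L[OF mi h]] VE[OF mi h] by simp
      finally show ?thesis unfolding y by simp
    qed
  qed (intro contraction_op_scale contraction_op_compose[OF A[OF i] V[OF j]]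
      contraction_op_compose[OF V[OF j] A[OF i]] lam1 L.complex_hilbert_space_axioms)+
qed

section \<open>Dilation properties on the whole space and on its analytic part\<close>

lemma word_U_L: "w \<in> lists ({1..k} \<times> UNIV) \<Longrightarrow> x \<in> hcarrier L \<Longrightarrow> word_op U w x \<in> hcarrier L"
proof (induction w)
  case (Cons p w)
  obtain i and n :: nat where p: "p = (i, n)" "i \<in> {1..k}" using Cons.prems by (cases p) auto
  have "(U i ^^ n) z \<in> hcarrier L" if "z \<in> hcarrier L" for z n
    by (induction n) (use that U_L[OF p(2)] in auto)
  then show ?case using Cons p by (simp add: word_op_fprod)
qed (simp add: word_op_fprod)

lemma word_V: "w \<in> lists ({1..k} \<times> UNIV) \<Longrightarrow> x \<in> hcarrier L \<Longrightarrow> word_op V w x = word_op U w x"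
proof (induction w)
  case (Cons p w)
  obtain i and n :: nat where p: "p = (i, n)" "i \<in> {1..k}" using Cons.prems by (cases p) auto
  have "(U i ^^ n) z \<in> hcarrier L \<and> (V i ^^ n) z = (U i ^^ n) z" if "z \<in> hcarrier L" for z n
    by (induction n) (use that U_L[OF p(2)] V_eq in auto)
  then show ?case using Cons p word_U_L[of w x] by (simp add: word_op_fprod)
qed (simp add: word_op_fprod)

lemma E0_L: "h \<in> hcarrier H \<Longrightarrow> E 0 h \<in> hcarrier L"
  by (rule E_in_L[OF N_0])

lemma T_word_carrier: "w \<in> lists ({1..k} \<times> UNIV) \<Longrightarrow> h \<in> hcarrier H \<Longrightarrow> word_op T w h \<in> hcarrier H"
  unfolding word_op_fprod
  by (rule fprod_in) (use contraction_op_carrier[OF contraction_op_funpow[OF T_contraction]] in auto)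

text \<open>Since \<open>adj L (V i)\<close> maps \<open>E 0 g\<close> to
  \<open>E 0 (S i g)\<close>, powers of U_i pass to the right argument exactly as powers of T_i do
  in \<open>H\<close>. The induction keeps g arbitrary for this reason.\<close>

lemma word_inner:
  assumes "w \<in> lists ({1..k} \<times> UNIV)" "h \<in> hcarrier H" "g \<in> hcarrier H"
  shows "hinner K (word_op U w (E 0 h)) (E 0 g) = hinner H (word_op T w h) g"
  using assms
proof (induction w arbitrary: g)
  case Nil
  then show ?case using S.ker_same by (simp add: word_op_fprod gram)
next
  case (Cons p w)
  obtain i and n :: nat where p: "p = (i, n)" "i \<in> {1..k}" using Cons.hyps by (cases p) auto
  have w: "w \<in> lists ({1..k} \<times> UNIV)" by (rule Cons.hyps)
  have pow: "hinner K ((U i ^^ n) z) (E 0 g) = hinner K z (E 0 ((S i ^^ n) g))"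
    if z: "z \<in> hcarrier L" and g: "g \<in> hcarrier H" for z g n
    using g
  proof (induction n arbitrary: g)
    case (Suc n)
    have zn: "(U i ^^ n) z \<in> hcarrier L" by (induction n) (use z U_L[OF p(2)] in auto)
    have "hinner K (U i ((U i ^^ n) z)) (E 0 g) = hinner K ((U i ^^ n) z) (E 0 (S i g))"
      using L.adj_exists(2)[OF isometry_op_contraction[OF V_isometry[OF p(2)]] E0_L[OF Suc.prems] zn]
      by (simp add: V_eq[OF zn] adj_V_E0[OF p(2) Suc.prems])
    also have "\<dots> = hinner K z (E 0 ((S i ^^ n) (S i g)))"
      by (rule Suc.IH[OF S_carrier[OF p(2) Suc.prems]])
    finally show ?case by (simp only: funpow.simps comp_apply funpow_swap1)
  qed simp
  have pow_T: "hinner H ((T i ^^ n) z) g = hinner H z ((S i ^^ n) g)"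
    if z: "z \<in> hcarrier H" and g: "g \<in> hcarrier H" for z g n
    using g
  proof (induction n arbitrary: g)
    case (Suc n)
    have "(T i ^^ n) z \<in> hcarrier H" by (induction n) (use z p(2) in auto)
    then have "hinner H (T i ((T i ^^ n) z)) g = hinner H ((T i ^^ n) z) (S i g)"
      by (rule T_inner[OF p(2) Suc.prems])
    also have "\<dots> = hinner H z ((S i ^^ n) (S i g))"
      by (rule Suc.IH[OF S_carrier[OF p(2) Suc.prems]])
    finally show ?case by (simp only: funpow.simps comp_apply funpow_swap1)
  qed simp
  have Sg: "(S i ^^ n) g \<in> hcarrier H" by (rule S.funpow_carrier[OF p(2) Cons.prems(2)])
  have "hinner K (word_op U (p # w) (E 0 h)) (E 0 g) = hinner K ((U i ^^ n) (word_op U w (E 0 h))) (E 0 g)"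
    by (simp add: word_op_fprod p(1))
  also have "\<dots> = hinner K (word_op U w (E 0 h)) (E 0 ((S i ^^ n) g))"
    by (rule pow[OF word_U_L[OF w E0_L[OF Cons.prems(1)]] Cons.prems(2)])
  also have "\<dots> = hinner H (word_op T w h) ((S i ^^ n) g)"
    by (rule Cons.IH[OF Cons.prems(1) Sg])
  also have "\<dots> = hinner H ((T i ^^ n) (word_op T w h)) g"
    by (rule pow_T[OF T_word_carrier[OF w Cons.prems(1)] Cons.prems(2), symmetric])
  also have "(T i ^^ n) (word_op T w h) = word_op T (p # w) h"
    by (simp add: word_op_fprod p(1))
  finally show ?case .
qed

lemma dilates_K: "dilates k H T K (E 0) U"
  unfolding dilates_def
proof (intro ballI)
  fix w :: "(nat \<times> nat) list" and h assume w: "w \<in> lists ({1..k} \<times> UNIV)" and h: "h \<in> hcarrier H"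
  show "orth_proj K (E 0 ` hcarrier H) (word_op U w (E 0 h)) = E 0 (word_op T w h)"
    using orth_proj_range_iff[OF H.complex_hilbert_space_axioms K.complex_hilbert_space_axioms isometry_E0,
        of "word_op U w (E 0 h)" "word_op T w h"] word_inner[OF w h] word_U_L[OF w E0_L[OF h]] L_subset
      T_word_carrier[OF w h] by blast
qed

text \<open>The adjoint of an ordered monomial has its factors reversed, and restoring the order
  costs \<open>inverse (c a a)\<close>. The phase is found without reordering, by evaluating the
  inner product of \<open>E a u\<close> and \<open>E 0 g\<close> once as a word and once through the
  kernel.\<close>

lemma T_monomial_inner:
  assumes a: "\<And>i. i \<in> {1..k} \<Longrightarrow> 0 \<le> a i" and u: "u \<in> hcarrier H" and g: "g \<in> hcarrier H"
  shows "hinner H (ordered_monomial k T (\<lambda>i. nat (a i)) u) g = inverse (c a a) * hinner H u (S.mon a g)"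
proof -
  have "hinner H (ordered_monomial k T (\<lambda>i. nat (a i)) u) g = hinner K (E a u) (E 0 g)"
  proof -
    have "a \<in> N" using a by (simp add: N_def)
    then show ?thesis
      unfolding ordered_monomial_word
      by (subst E_word[OF _ u]) (auto intro!: word_inner[symmetric] u g)
  qed
  also have "\<dots> = S.ker a u 0 g" by (rule gram[OF u g])
  also have "\<dots> = S.ker a u (\<lambda>_. 0) g" by (rule S.ker_cong) auto
  also have "\<dots> = inverse (c a a) * hinner H u (S.mon a g)"
  proof -
    have s: "S.D (sup a (\<lambda>_. 0)) m x = S.D a m x" for m x
    proof -
      have s0: "sup a (\<lambda>_. 0) i = a i" if "i \<in> {1..k}" for i
        using a[OF that] by (simp add: sup_int_def)
      have "S.mon (sup a (\<lambda>_. 0) - m) x = S.mon (a - m) x"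
        by (rule S.mon_cong) (use s0 in simp)
      moreover have "c (sup a (\<lambda>_. 0)) m = c a m"
        by (rule twist_cong) (use s0 in simp_all)
      moreover have "(\<forall>i\<in>{1..k}. m i \<le> sup a (\<lambda>_. 0) i) = (\<forall>i\<in>{1..k}. m i \<le> a i)"
        using s0 by simp
      ultimately show ?thesis unfolding S.D_def by simp
    qed
    have "S.D a a u = hscale H (cnj (c a a)) u" using S.D_le[of a a u] by simp
    moreover have "S.D a (\<lambda>_. 0) g = S.mon a g"
    proof -
      have "S.mon (a - (\<lambda>_. 0)) g = S.mon a g" by (rule S.mon_cong) auto
      then show ?thesis using S.D_le[of "\<lambda>_. 0" a g] a by simp
    qed
    ultimately show ?thesis
      unfolding S.ker_def s using u g by (simp add: H.inner_scale cnj_twist)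
  qed
  finally show ?thesis .
qed

text \<open>The phase of the mixed monomial times that of the kernel entry is c(a, - b) / c(a, a -
  b) = 1 / c(a, a), the very factor that appears on the side of \<open>T\<close>.\<close>

lemma regular_dilates_K: "regular_dilates k H T K (E 0) U"
  unfolding regular_dilates_def
proof (intro allI ballI)
  fix p :: "nat \<Rightarrow> int" and h assume h: "h \<in> hcarrier H"
  define a b where "a i = max (- p i) 0" and "b i = max (p i) 0" for i
  have pab: "- p = a - b" by (auto simp: a_def b_def fun_eq_iff)
  have mm: "mixed_monomial k K U p (E 0 h) = hscale K (c a (- b)) (E (a - b) h)"
    using mixed_monomial_E[OF h, of p] unfolding pab a_def[abs_def, symmetric] b_def[abs_def, symmetric] .
  have mT: "mixed_monomial k H T p h = ordered_monomial k T (\<lambda>i. nat (a i)) (S.mon b h)"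
    unfolding mixed_monomial_T a_def[abs_def] b_def[abs_def] ..
  have "hinner K (mixed_monomial k K U p (E 0 h)) (E 0 g) = hinner H (mixed_monomial k H T p h) g"
    if g: "g \<in> hcarrier H" for g
  proof -
    have s: "sup (a - b) 0 = a" by (auto simp: fun_eq_iff sup_int_def a_def b_def)
    have ab: "S.D a (a - b) h = hscale H (cnj (c a (a - b))) (S.mon b h)"
    proof -
      have "S.mon (a - (a - b)) h = S.mon b h" by (rule S.mon_cong) simp
      then show ?thesis using S.D_le[of "a - b" a h] by (simp add: b_def)
    qed
    have a0: "S.D a 0 g = S.mon a g"
      using S.D_le[of 0 a g] by (simp add: a_def)
    have "hinner K (mixed_monomial k K U p (E 0 h)) (E 0 g) = c a (- b) * S.ker (a - b) h 0 g"
      unfolding mm using h g E_carrier by (simp add: K.inner_scale gram)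
    also have "\<dots> = c a (- b) * (cnj (c a (a - b)) * hinner H (S.mon b h) (S.mon a g))"
      unfolding S.ker_def s ab a0 using h g by (simp add: H.inner_scale)
    also have "\<dots> = inverse (c a a) * hinner H (S.mon b h) (S.mon a g)"
      by (simp add: twist_simps)
    also have "\<dots> = hinner H (mixed_monomial k H T p h) g"
      unfolding mT by (rule T_monomial_inner[symmetric]) (use h g in \<open>auto simp: a_def\<close>)
    finally show ?thesis .
  qed
  moreover have "mixed_monomial k K U p (E 0 h) \<in> hcarrier K"
    unfolding mm using E_carrier[OF h] by simp
  ultimately show "orth_proj K (E 0 ` hcarrier H) (mixed_monomial k K U p (E 0 h)) = E 0 (mixed_monomial k H T p h)"
    using orth_proj_range_iff[OF H.complex_hilbert_space_axioms K.complex_hilbert_space_axioms isometry_E0]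
      mixed_monomial_T_carrier[OF h] by blast
qed

lemma commuting_unitaries_K: "commuting_unitaries_over k lam H K (E 0) U"
  unfolding commuting_unitaries_over_def
  using K.complex_hilbert_space_axioms isometry_E0 unitary doubly_commuting_K by blast

lemma unitary_minimal_K: "unitary_minimal k H K (E 0) U"
  unfolding unitary_minimal_def span_E_zword[symmetric] dense ..

lemma isometry_E0_L: "isometry_op H L (E 0)"
  using isometry_E0 E0_L unfolding isometry_op_def linear_op_def by (auto simp: Pi_iff)

lemma commuting_isometries_L: "commuting_isometries_over k lam H L (E 0) V"
  unfolding commuting_isometries_over_def
  using L.complex_hilbert_space_axioms isometry_E0_L V_isometry doubly_commuting_L by blast

lemma dilates_L: "dilates k H T L (E 0) V"
proof -
  \<comment> \<open>\<open>orth_proj\<close> depends on the space only through its inner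
    product.\<close>
  have "orth_proj L M x = orth_proj K M x" for M x by (simp add: orth_proj_def)
  then show ?thesis
    using dilates_K E0_L unfolding dilates_def by (simp add: word_V)
qed

lemma isometric_minimal_L: "isometric_minimal k H L (E 0) V"
proof -
  have "{word_op V w (E 0 h) | w h. w \<in> lists ({1..k} \<times> UNIV) \<and> h \<in> hcarrier H} = G"
    unfolding G_def using word_V[OF _ E0_L] by (metis (no_types, lifting))
  moreover have "G \<subseteq> closed_span K G" using K.closed_span_base[OF G_carrier] by blast
  ultimately show ?thesis
    unfolding isometric_minimal_def analytic_part_def L_carrier
    using K.closed_span_restrict[OF G_carrier, of G] by (simp add: L_eq)
qed

theorem unique:
  assumes K': "commuting_unitaries_over k lam H K' J' U'" and reg: "regular_dilates k H T K' J' U'"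
    and min: "unitary_minimal k H K' J' U'"
  shows "\<exists>\<Gamma>. dilation_iso k H K (E 0) U K' J' U' \<Gamma>"
proof -
  define E' where "E' = (\<lambda>m h. zword_op K' U' (map (\<lambda>i. (i, m i)) [1..<Suc k]) (J' h))"
  have KK: "complex_hilbert_space K'" and J': "isometry_op H K' J'"
    and U': "\<And>i. i \<in> {1..k} \<Longrightarrow> unitary_op K' K' (U' i)" and dc: "doubly_commuting k lam K' U'"
    using K' unfolding commuting_unitaries_over_def by blast+
  have J'c: "J' h \<in> hcarrier K'" if "h \<in> hcarrier H" for h by (rule isometry_op_carrier[OF J' that])
  note sys = shift_system_of_unitaries[where X = "hcarrier H" and J = J', OF KK U' twisting_axioms dc J'c]
  interpret K': shift_system k lam K' U' E' "hcarrier H" unfolding E'_def by (rule sys(1))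
  have E'0: "E' 0 = J'" unfolding E'_def by (rule sys(2))
  have J'0: "isometry_op H K' (E' 0)" "regular_dilates k H T K' (E' 0) U'"
    unfolding E'0 using J' reg by auto
  \<comment> \<open>Both entries equal the same expression in \<open>T\<close> by
    \<open>regular_gram\<close>.\<close>
  have gram': "hinner K (E m h) (E n g) = hinner K' (E' m h) (E' n g)"
    if "h \<in> hcarrier H" "g \<in> hcarrier H" for m n h g
    using regular_gram[OF polyball_axioms refl isometry_E0 regular_dilates_K that, of m n]
      K'.regular_gram[OF polyball_axioms refl J'0 that, of m n] by simp
  have dense': "closed_span K' (case_prod E' ` (UNIV \<times> hcarrier H)) = hcarrier K'"
    using min unfolding K'.span_E_zword E'0 unitary_minimal_def by simp
  have c: "case_prod E ` (UNIV \<times> hcarrier H) \<subseteq> hcarrier K" "case_prod E' ` (UNIV \<times> hcarrier H) \<subseteq> hcarrier K'"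
    using E_carrier K'.E_carrier by auto
  obtain \<Gamma> where \<Gamma>: "unitary_op K K' \<Gamma>"
    "\<And>p. p \<in> UNIV \<times> hcarrier H \<Longrightarrow> \<Gamma> (case_prod E p) = case_prod E' p"
  proof (rule unitary_extension[OF K.complex_hilbert_space_axioms KK c(1) dense c(2) dense'])
    show "hinner K (case_prod E p) (case_prod E q) = hinner K' (case_prod E' p) (case_prod E' q)"
      if "p \<in> UNIV \<times> hcarrier H" "q \<in> UNIV \<times> hcarrier H" for p q
      using that gram' by auto
  qed (rule that)
  have \<Gamma>E: "\<Gamma> (E m h) = E' m h" if "h \<in> hcarrier H" for m h
    using \<Gamma>(2)[of "(m, h)"] that by simp
  note \<Gamma>c = unitary_op_contraction[OF \<Gamma>(1)]
  have "\<Gamma> (U i x) = U' i (\<Gamma> x)" if i: "i \<in> {1..k}" and x: "x \<in> hcarrier K" for i x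
  proof (rule contraction_ops_agree[OF K.complex_hilbert_space_axioms KK
        contraction_op_compose[OF \<Gamma>c U_contraction[OF i]]
        contraction_op_compose[OF K'.U_contraction[OF i] \<Gamma>c] c(1)])
    show "x \<in> closed_span K (case_prod E ` (UNIV \<times> hcarrier H))" using x dense by simp
    fix y assume "y \<in> case_prod E ` (UNIV \<times> hcarrier H)"
    then obtain m h where y: "y = E m h" and h: "h \<in> hcarrier H" by auto
    show "\<Gamma> (U i y) = U' i (\<Gamma> y)"
      unfolding y E_shift[OF i h] \<Gamma>E[OF h] K'.E_shift[OF i h]
      using linear_op_scale[OF contraction_op_linear[OF \<Gamma>c] E_carrier[OF h]] \<Gamma>E[OF h] by simp
  qed
  moreover have "\<Gamma> (E 0 h) = J' h" if "h \<in> hcarrier H" for h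
    using \<Gamma>E[OF that, of 0] E'0 by simp
  ultimately show ?thesis
    unfolding dilation_iso_def using \<Gamma>(1) by blast
qed

end

text \<open>\<open>ker_shift\<close> says that the total family \<open>E m h\<close> and its
  phase-corrected translates have the same Gram matrix, so \<open>unitary_extension\<close> yields
  the operators U_i.\<close>

lemma (in polyball) exists_dilation:
  obtains K :: "((nat \<Rightarrow> int) \<Rightarrow> 'a) hspace" and U E where "kernel_dilation k lam H T K U E"
proof -
  obtain K :: "((nat \<Rightarrow> int) \<Rightarrow> 'a) hspace" and E where
    K: "complex_hilbert_space K" and E: "\<And>m. linear_op H K (E m)"
    and gram: "\<And>m n h g. h \<in> hcarrier H \<Longrightarrow> g \<in> hcarrier H \<Longrightarrow> hinner K (E m h) (E n g) = S.ker m h n g"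
    and dense: "closed_span K (case_prod E ` (UNIV \<times> hcarrier H)) = hcarrier K"
    using kernel_space by metis
  interpret K: complex_hilbert_space K by fact
  let ?I = "UNIV \<times> hcarrier H"
  have Ec: "E m h \<in> hcarrier K" if "h \<in> hcarrier H" for m h by (rule linear_op_carrier[OF E that])
  have c: "case_prod E ` ?I \<subseteq> hcarrier K" using Ec by auto
  have "\<exists>A. unitary_op K K A \<and> (\<forall>m. \<forall>h\<in>hcarrier H. A (E m h) = hscale K (c (single i 1) m) (E (m + single i 1) h))"
    for i
  proof -
    let ?e = "single i 1"
    let ?F = "\<lambda>(m, h). hscale K (c ?e m) (E (m + ?e) h)"
    have Fc: "?F ` ?I \<subseteq> hcarrier K" using Ec by auto
    have "case_prod E ` ?I \<subseteq> closed_span K (?F ` ?I)"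
    proof
      fix y assume "y \<in> case_prod E ` ?I"
      then obtain m h where y: "y = E m h" and h: "h \<in> hcarrier H" by auto
      \<comment> \<open>Translation by e_i permutes all multi-indices, so the translated family is
        total too: every \<open>E m h\<close> is reached from the index m - e_i. With negative
        entries excluded this would fail, and only isometries would result.\<close>
      have y': "y = hscale K (inverse (c ?e (m - ?e))) (?F (m - ?e, h))" by (simp add: y)
      have "?F (m - ?e, h) \<in> ?F ` ?I" using h by (intro imageI) simp
      then show "y \<in> closed_span K (?F ` ?I)"
        unfolding y' by (intro K.span_closed_span[OF Fc] K.vs.span_scale K.vs.span_base)
    qed
    from K.closed_span_minimal[OF Fc this] have Fd: "closed_span K (?F ` ?I) = hcarrier K"
      unfolding dense using K.closed_span_carrier[OF Fc] by (intro subset_antisym)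
    obtain A where "unitary_op K K A" "\<And>p. p \<in> ?I \<Longrightarrow> A (case_prod E p) = ?F p"
    proof (rule unitary_extension[OF K K c dense Fc Fd])
      fix p q :: "(nat \<Rightarrow> int) \<times> 'a" assume "p \<in> ?I" "q \<in> ?I"
      then obtain m h n g where pq: "p = (m, h)" "q = (n, g)" "h \<in> hcarrier H" "g \<in> hcarrier H" by auto
      have "hinner K (?F p) (?F q) = c ?e m * cnj (c ?e n) * S.ker (m + ?e) h (n + ?e) g"
        using pq Ec by (simp add: K.inner_scale K.inner_scale_right gram)
      also have "\<dots> = S.ker m h n g" unfolding S.ker_shift[OF pq(3,4)] by (simp add: cnj_twist field_simps)
      finally show "hinner K (case_prod E p) (case_prod E q) = hinner K (?F p) (?F q)"
        using pq by (simp add: gram)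
    qed (rule that)
    then show ?thesis by fastforce
  qed
  then obtain U where U: "\<And>i. unitary_op K K (U i)"
    "\<And>i m h. h \<in> hcarrier H \<Longrightarrow> U i (E m h) = hscale K (c (single i 1) m) (E (m + single i 1) h)"
    by metis
  \<comment> \<open>Indices that differ only outside {1..k} name the same vector: the kernel does
    not see those entries, so the difference has norm 0.\<close>
  have cong: "E m h = E n h" if h: "h \<in> hcarrier H" and mn: "\<And>i. i \<in> {1..k} \<Longrightarrow> m i = n i" for m n h
  proof -
    have "S.ker m h n h = S.ker m h m h" "S.ker n h m h = S.ker m h m h" "S.ker n h n h = S.ker m h m h"
      by (rule S.ker_cong; simp add: mn)+
    then have "hinner K (E m h - E n h) (E m h - E n h) = 0"
      using Ec[OF h] h by (simp add: K.inner_diff K.inner_diff_right gram)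
    then show ?thesis using K.inner_definite[of "E m h - E n h"] Ec[OF h] by simp
  qed
  have "kernel_dilation k lam H T K U E"
    by (intro kernel_dilation.intro shift_system.intro shift_system_axioms.intro kernel_dilation_axioms.intro
        polyball_axioms twisting_axioms K U Ec gram dense E; (assumption | rule cong; blast))
  with that show ?thesis by blast
qed

theorem theorem6p7:
  fixes k :: nat
    and lam :: "nat \<Rightarrow> nat \<Rightarrow> complex"
    and H :: "'a::ab_group_add hspace"
    and T :: "nat \<Rightarrow> 'a \<Rightarrow> 'a"
  assumes "1 \<le> k"
    and "\<And>i j. \<lbrakk>i \<in> {1..k}; j \<in> {1..k}; i \<noteq> j\<rbrakk> \<Longrightarrow> cmod (lam i j) = 1"
    and "\<And>i j. \<lbrakk>i \<in> {1..k}; j \<in> {1..k}; i \<noteq> j\<rbrakk> \<Longrightarrow> lam j i = cnj (lam i j)"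
    and "complex_hilbert_space H"
    and "T \<in> regular_polyball k lam H"
  shows "\<exists>(K :: ((nat \<Rightarrow> int) \<Rightarrow> 'a) hspace) J U.
      commuting_unitaries_over k lam H K J U
    \<and> \<comment> \<open>(i)\<close> dilates k H T K J U
    \<and> \<comment> \<open>(ii)\<close> regular_dilates k H T K J U
    \<and> \<comment> \<open>(iii)\<close> unitary_minimal k H K J U
    \<and> \<comment> \<open>(iv)\<close> (\<forall>(K' :: 'b::ab_group_add hspace) J' U'.
          commuting_unitaries_over k lam H K' J' U' \<and> dilates k H T K' J' U'
        \<and> regular_dilates k H T K' J' U' \<and> unitary_minimal k H K' J' U'
        \<longrightarrow> (\<exists>\<Gamma>. dilation_iso k H K J U K' J' U' \<Gamma>))
    \<and> \<comment> \<open>(v)\<close> (let L = K\<lparr>hcarrier := analytic_part k H K J U\<rparr>;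
               V = (\<lambda>i. restrict (U i) (hcarrier L))
           in commuting_isometries_over k lam H L J V
            \<and> dilates k H T L J V
            \<and> isometric_minimal k H L J V
            \<and> (\<forall>i\<in>{1..k}. \<forall>h\<in>hcarrier H. J (adj H (T i) h) = adj L (V i) (J h)))"
proof -
  interpret polyball k lam H T
    by (intro polyball.intro twisting.intro polyball_axioms.intro assms(2-5))
  obtain K :: "((nat \<Rightarrow> int) \<Rightarrow> 'a) hspace" and U E where "kernel_dilation k lam H T K U E"
    by (rule exists_dilation)
  then interpret D: kernel_dilation k lam H T K U E .
  have LV: "K\<lparr>hcarrier := analytic_part k H K (E 0) U\<rparr> = D.L"
    "(\<lambda>i. restrict (U i) (hcarrier D.L)) = D.V"
    by (simp_all add: D.L_def D.V_def fun_eq_iff)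
  have adjoint: "\<forall>i\<in>{1..k}. \<forall>h\<in>hcarrier H.
      E 0 (adj H (T i) h) = adj D.L (restrict (U i) (hcarrier D.L)) (E 0 h)"
    unfolding D.V_def[symmetric] using D.adj_V_E0 by (simp add: S_def)
  have unique: "\<forall>(K' :: 'b hspace) J' U'.
      commuting_unitaries_over k lam H K' J' U' \<and> dilates k H T K' J' U'
    \<and> regular_dilates k H T K' J' U' \<and> unitary_minimal k H K' J' U'
    \<longrightarrow> (\<exists>\<Gamma>. dilation_iso k H K (E 0) U K' J' U' \<Gamma>)"
    using D.unique by blast
  \<comment> \<open>The inclusion of \<open>H\<close> is \<open>E 0\<close>, an isometry because the
    kernel restricted to index 0 is the inner product of \<open>H\<close>.\<close>
  show ?thesis
    unfolding Let_def
    by (intro exI[of _ K] exI[of _ "E 0"] exI[of _ U] conjI, unfold LV)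
       (rule D.commuting_unitaries_K D.dilates_K D.regular_dilates_K D.unitary_minimal_K
          unique D.commuting_isometries_L D.dilates_L D.isometric_minimal_L adjoint)+
qed

end
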